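(* Fix an integer $k\ge2$. For $j=0,1,\dots,k$ let $Q_{j,k}(x;t)=t^{k-j}(1-t)^j-x$, and let $t_{1,j}(x),\dots,t_{k-j,j}(x)$ be its ``small'' zeroes in $t$, i.e. those zeroes (Puiseux series in $x$) with $\lim_{x\to0}t(x)=0$. Then \[ \sum_{r\ge1}\mathsf{tr}(k,r)\,x^r=\frac12\sum_{j=0}^k(-1)^j\binom kj\sum_{i=1}^{k-j}\frac{t_{i,j}(x)^{j+1}(1-t_{i,j}(x))^{k-j+1}}{(1-2t_{i,j}(x))^{k-2}\,(k-j-k\,t_{i,j}(x))}. \]
   Context: For integers $k\ge 3$, $r\ge 1$, let $\mathrm{SC}(k,r)$ be a convex $k$-gon in the plane each of whose sides is subdivided by $r-1$ additional points lying on that side. A triangulation of a finite planar point set is a maximal dissection of its convex hull into triangles by non-crossing segments between points of the set (no point lying in the interior of a triangle side). For $k\ge3$, $\mathsf{tr}(k,r)$ is the number of triangulations of $\mathrm{SC}(k,r)$. For $k=2$, $\mathsf{tr}(2,r)$ is defined by $-\frac{1}{4\pi i}\int_{\mathcal C}\frac{((1-t)^{r+1}-t^{r+1})^2\,dt}{t^{2r}(1-t)^{2r}}$ with $\mathcal C$ a small positively oriented contour around $0$ (so $\mathsf{tr}(2,1)=1$ and $\mathsf{tr}(2,r)=\binom{2r-4}{r-2}$ for $r\ge2$).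
   Formalization: The prefactor 1/2 on the right-hand side is corrected to −1/2; with +1/2 the identity fails, e.g. for k=2 the right side is −(x+x²/√(1−4x)) while the generating function of tr(2,r) is x+x²/√(1−4x). *)

theory Defs
  imports
    "HOL-Complex_Analysis.Complex_Analysis"
    "HOL-Computational_Algebra.Computational_Algebra"
begin

section \<open>Puiseux series\<close>

lemma fls_compose_power_compose:
  fixes F :: "'a :: zero fls"
  assumes "d > 0" "e > 0"
  shows "fls_compose_power (fls_compose_power F d) e = fls_compose_power F (d * e)"
proof (rule fls_eqI)
  fix n :: int
  show "fls_nth (fls_compose_power (fls_compose_power F d) e) n = fls_nth (fls_compose_power F (d * e)) n"
  proof (cases "int (d * e) dvd n")
    case True
    then obtain m where "n = int d * int e * m" by (auto simp: dvd_def)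
    then show ?thesis using assms by (simp add: fls_nth_compose_power mult.assoc mult.left_commute)
  next
    case False
    have "\<not> (int e dvd n \<and> int d dvd n div int e)"
    proof
      assume *: "int e dvd n \<and> int d dvd n div int e"
      then obtain m where m: "n div int e = int d * m" by (auto simp: dvd_def)
      have "n = int e * (n div int e)" using * by simp
      with m False show False by (auto simp: ac_simps)
    qed
    then show ?thesis using assms False by (auto simp: fls_nth_compose_power)
  qed
qed

lemma fls_compose_power_inject:
  fixes F G :: "'a :: zero fls"
  assumes "d > 0" "fls_compose_power F d = fls_compose_power G d"
  shows "F = G"
proof (rule fls_eqI)
  fix n :: int
  have "fls_nth (fls_compose_power F d) (int d * n) = fls_nth (fls_compose_power G d) (int d * n)"
    using assms(2) by simp
  then show "fls_nth F n = fls_nth G n" using assms(1) by (simp add: fls_nth_compose_power)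
qed

lemma fls_compose_power_inverse:
  fixes F :: "'a :: field fls"
  assumes "d > 0"
  shows "fls_compose_power (inverse F) d = inverse (fls_compose_power F d)"
proof (cases "F = 0")
  case False
  have "fls_compose_power F d * fls_compose_power (inverse F) d = fls_compose_power (F * inverse F) d"
    by simp
  also have "\<dots> = 1" using False assms by simp
  finally show ?thesis by (metis inverse_unique)
qed simp

text \<open>A pair \<open>(d, F)\<close> with \<open>d > 0\<close> stands for the Puiseux series \<open>F(x\<^bsup>1/d\<^esup>)\<close> in the
  variable \<open>x\<close>; \<open>fls_compose_power F e\<close> is \<open>F(X\<^sup>e)\<close>.\<close>

definition puiseux_rel :: "nat \<times> 'a :: zero fls \<Rightarrow> nat \<times> 'a fls \<Rightarrow> bool" where
  "puiseux_rel p q \<longleftrightarrow> fst p > 0 \<and> fst q > 0 \<and>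
     fls_compose_power (snd p) (fst q) = fls_compose_power (snd q) (fst p)"

lemma part_equivp_puiseux_rel: "part_equivp (puiseux_rel :: nat \<times> 'a :: zero fls \<Rightarrow> _)"
proof (rule part_equivpI)
  show "\<exists>p :: nat \<times> 'a fls. puiseux_rel p p"
    by (rule exI[of _ "(1, 0)"]) (simp add: puiseux_rel_def)
  show "symp (puiseux_rel :: nat \<times> 'a fls \<Rightarrow> _)"
    by (auto simp: symp_def puiseux_rel_def)
  show "transp (puiseux_rel :: nat \<times> 'a fls \<Rightarrow> _)"
  proof (rule transpI)
    fix p q s :: "nat \<times> 'a fls"
    assume pq: "puiseux_rel p q" and qs: "puiseux_rel q s"
    obtain a F b G c H where [simp]: "p = (a, F)" "q = (b, G)" "s = (c, H)"
      by (metis surj_pair)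
    have pos: "a > 0" "b > 0" "c > 0"
      and 1: "fls_compose_power F b = fls_compose_power G a"
      and 2: "fls_compose_power G c = fls_compose_power H b"
      using pq qs by (auto simp: puiseux_rel_def)
    have "fls_compose_power (fls_compose_power F c) b = fls_compose_power (fls_compose_power F b) c"
      using pos by (simp add: fls_compose_power_compose mult.commute)
    also have "\<dots> = fls_compose_power (fls_compose_power G c) a"
      using pos by (simp add: 1 fls_compose_power_compose mult.commute)
    also have "\<dots> = fls_compose_power (fls_compose_power H a) b"
      using pos by (simp add: 2 fls_compose_power_compose mult.commute)
    finally have "fls_compose_power F c = fls_compose_power H a"
      by (rule fls_compose_power_inject[OF pos(2)])
    then show "puiseux_rel p s" using pos by (simp add: puiseux_rel_def)
  qed
qed

quotient_type (overloaded) 'a puiseux = "nat \<times> 'a :: zero fls" / partial: puiseux_rel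
  by (rule part_equivp_puiseux_rel)

lemma puiseux_rel_lift2:
  fixes f :: "'a :: field fls \<Rightarrow> 'a fls \<Rightarrow> 'a fls"
  assumes f: "\<And>F G d. d > 0 \<Longrightarrow>
      fls_compose_power (f F G) d = f (fls_compose_power F d) (fls_compose_power G d)"
    and "puiseux_rel p p'" "puiseux_rel q q'"
  shows "puiseux_rel
      (fst p * fst q, f (fls_compose_power (snd p) (fst q)) (fls_compose_power (snd q) (fst p)))
      (fst p' * fst q', f (fls_compose_power (snd p') (fst q')) (fls_compose_power (snd q') (fst p')))"
proof -
  obtain a F b G a' F' b' G' where [simp]: "p = (a, F)" "q = (b, G)" "p' = (a', F')" "q' = (b', G')"
    by (metis surj_pair)
  have pos: "a > 0" "b > 0" "a' > 0" "b' > 0"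
    and 1: "fls_compose_power F a' = fls_compose_power F' a"
    and 2: "fls_compose_power G b' = fls_compose_power G' b"
    using assms(2,3) by (auto simp: puiseux_rel_def)
  have "fls_compose_power F (b * (a' * b')) = fls_compose_power (fls_compose_power F a') (b * b')"
    using pos by (simp add: fls_compose_power_compose ac_simps)
  also have "\<dots> = fls_compose_power F' (b' * (a * b))"
    using pos by (simp add: 1 fls_compose_power_compose ac_simps)
  finally have 3: "fls_compose_power F (b * (a' * b')) = fls_compose_power F' (b' * (a * b))" .
  have "fls_compose_power G (a * (a' * b')) = fls_compose_power (fls_compose_power G b') (a * a')"
    using pos by (simp add: fls_compose_power_compose ac_simps)
  also have "\<dots> = fls_compose_power G' (a' * (a * b))"
    using pos by (simp add: 2 fls_compose_power_compose ac_simps)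
  finally have 4: "fls_compose_power G (a * (a' * b')) = fls_compose_power G' (a' * (a * b))" .
  show ?thesis
    using pos by (simp add: puiseux_rel_def f fls_compose_power_compose 3 4)
qed

instantiation puiseux :: (field) field
begin

lift_definition zero_puiseux :: "'a puiseux" is "(1, 0)"
  by (simp add: puiseux_rel_def)

lift_definition one_puiseux :: "'a puiseux" is "(1, 1)"
  by (simp add: puiseux_rel_def)

lift_definition plus_puiseux :: "'a puiseux \<Rightarrow> 'a puiseux \<Rightarrow> 'a puiseux" is
  "\<lambda>p q. (fst p * fst q,
          fls_compose_power (snd p) (fst q) + fls_compose_power (snd q) (fst p))"
  by (rule puiseux_rel_lift2) auto

lift_definition minus_puiseux :: "'a puiseux \<Rightarrow> 'a puiseux \<Rightarrow> 'a puiseux" is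
  "\<lambda>p q. (fst p * fst q,
          fls_compose_power (snd p) (fst q) - fls_compose_power (snd q) (fst p))"
  by (rule puiseux_rel_lift2) auto

lift_definition times_puiseux :: "'a puiseux \<Rightarrow> 'a puiseux \<Rightarrow> 'a puiseux" is
  "\<lambda>p q. (fst p * fst q,
          fls_compose_power (snd p) (fst q) * fls_compose_power (snd q) (fst p))"
  by (rule puiseux_rel_lift2) auto

lift_definition uminus_puiseux :: "'a puiseux \<Rightarrow> 'a puiseux" is
  "\<lambda>p. (fst p, - snd p)"
  by (auto simp: puiseux_rel_def)

lift_definition inverse_puiseux :: "'a puiseux \<Rightarrow> 'a puiseux" is
  "\<lambda>p. (fst p, inverse (snd p))"
  by (auto simp: puiseux_rel_def fls_compose_power_inverse)

definition divide_puiseux :: "'a puiseux \<Rightarrow> 'a puiseux \<Rightarrow> 'a puiseux" where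
  "divide_puiseux p q = p * inverse q"

instance
proof
  fix p q s :: "'a puiseux"
  show "p * q * s = p * (q * s)"
    by transfer (auto simp: puiseux_rel_def fls_compose_power_compose ac_simps)
  show "p * q = q * p"
    by transfer (auto simp: puiseux_rel_def fls_compose_power_compose ac_simps)
  show "1 * p = p"
    by transfer (auto simp: puiseux_rel_def fls_compose_power_compose ac_simps)
  show "p + q + s = p + (q + s)"
    by transfer (auto simp: puiseux_rel_def fls_compose_power_compose ac_simps)
  show "p + q = q + p"
    by transfer (auto simp: puiseux_rel_def fls_compose_power_compose ac_simps)
  show "0 + p = p"
    by transfer (auto simp: puiseux_rel_def fls_compose_power_compose ac_simps)
  show "- p + p = 0"
    by transfer (auto simp: puiseux_rel_def fls_compose_power_compose ac_simps)
  show "p - q = p + - q"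
    by transfer (auto simp: puiseux_rel_def fls_compose_power_compose ac_simps)
  show "(p + q) * s = p * s + q * s"
    by transfer (auto simp: puiseux_rel_def fls_compose_power_compose algebra_simps)
  show "(0 :: 'a puiseux) \<noteq> 1"
    by transfer (auto simp: puiseux_rel_def)
  show "p \<noteq> 0 \<Longrightarrow> inverse p * p = 1"
  proof transfer
    fix p :: "nat \<times> 'a fls"
    assume "puiseux_rel p p" and nz: "\<not> puiseux_rel p (1, 0)"
    then have pos: "fst p > 0" by (simp add: puiseux_rel_def)
    have "snd p \<noteq> 0"
      using nz pos by (auto simp: puiseux_rel_def)
    then have "fls_compose_power (inverse (snd p) * snd p) (fst p) = 1"
      using pos by simp
    then have "fls_compose_power (inverse (snd p)) (fst p) * fls_compose_power (snd p) (fst p) = 1"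
      by simp
    with pos show "puiseux_rel (fst (fst p, inverse (snd p)) * fst p,
        fls_compose_power (snd (fst p, inverse (snd p))) (fst p) *
        fls_compose_power (snd p) (fst (fst p, inverse (snd p)))) (1, 1)"
      by (simp add: puiseux_rel_def)
  qed
  show "p div q = p * inverse q"
    by (rule divide_puiseux_def)
  show "inverse (0 :: 'a puiseux) = 0"
    by transfer (auto simp: puiseux_rel_def)
qed

end

definition puiseux_of_fls :: "'a :: zero fls \<Rightarrow> 'a puiseux" where
  "puiseux_of_fls F = abs_puiseux (1, F)"

abbreviation puiseux_of_fps :: "'a :: zero fps \<Rightarrow> 'a puiseux" where
  "puiseux_of_fps f \<equiv> puiseux_of_fls (fps_to_fls f)"

definition puiseux_X :: "'a :: field puiseux" where
  "puiseux_X = puiseux_of_fls fls_X"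

text \<open>\<open>t(x) \<rightarrow> 0\<close> as \<open>x \<rightarrow> 0\<close>: only positive powers of \<open>x\<close> occur in \<open>t(x)\<close>.\<close>

lift_definition puiseux_small :: "'a :: zero puiseux \<Rightarrow> bool" is
  "\<lambda>p. \<forall>n \<le> 0. fls_nth (snd p) n = 0"
proof -
  have imp: "\<forall>n \<le> 0. fls_nth (snd q) n = 0"
    if rel: "puiseux_rel p q" and small: "\<forall>n \<le> 0. fls_nth (snd p) n = 0" for p q :: "nat \<times> 'a fls"
  proof (intro allI impI)
    fix n :: int assume "n \<le> 0"
    obtain a F b G where [simp]: "p = (a, F)" "q = (b, G)"
      by (metis surj_pair)
    have pos: "a > 0" "b > 0" and eq: "fls_compose_power F b = fls_compose_power G a"
      using rel by (auto simp: puiseux_rel_def)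
    have "fls_nth G n = fls_nth (fls_compose_power F b) (int a * n)"
      using pos by (simp add: eq fls_nth_compose_power)
    also have "\<dots> = 0"
    proof (cases "int b dvd int a * n")
      case True
      then obtain m where m: "int a * n = int b * m" by (auto simp: dvd_def)
      have "int b * m \<le> 0"
        using \<open>n \<le> 0\<close> m[symmetric] by (simp add: mult_nonneg_nonpos)
      then have "m \<le> 0" using pos by (simp add: mult_le_0_iff)
      then show ?thesis using pos small m by (simp add: fls_nth_compose_power)
    qed (use pos in \<open>simp add: fls_nth_compose_power\<close>)
    finally show "fls_nth (snd q) n = 0" by simp
  qed
  have sym: "puiseux_rel q p" if "puiseux_rel p q" for p q :: "nat \<times> 'a fls"
    using that by (simp add: puiseux_rel_def)
  show "(\<forall>n \<le> 0. fls_nth (snd p) n = 0) = (\<forall>n \<le> 0. fls_nth (snd q) n = 0)"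
    if "puiseux_rel p q" for p q :: "nat \<times> 'a fls"
    using imp[OF that] imp[OF sym[OF that]] by blast
qed

definition Q :: "nat \<Rightarrow> nat \<Rightarrow> complex puiseux poly" where
  "Q j k = [:0, 1:] ^ (k - j) * [:1, -1:] ^ j - [:puiseux_X:]"

definition small_zeros :: "nat \<Rightarrow> nat \<Rightarrow> complex puiseux set" where
  "small_zeros j k = {t. poly (Q j k) t = 0 \<and> puiseux_small t}"

section \<open>Triangulations of finite planar point sets\<close>

text \<open>The plane is \<^typ>\<open>complex\<close>; a line segment is represented by the set of its points.
  A triangle is represented by its set of vertices.\<close>

definition triangles :: "complex set \<Rightarrow> complex set set" where
  "triangles P = {{a, b, c} | a b c. a \<in> P \<and> b \<in> P \<and> c \<in> P \<and> \<not> collinear {a, b, c}}"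

definition sides :: "complex set \<Rightarrow> complex set set" where
  "sides T = {closed_segment a b | a b. a \<in> T \<and> b \<in> T \<and> a \<noteq> b}"

definition triangle_dissection :: "complex set \<Rightarrow> complex set set \<Rightarrow> bool" where
  "triangle_dissection P S \<longleftrightarrow>
     (\<exists>\<T> \<subseteq> triangles P.
        convex hull P = (\<Union>T\<in>\<T>. convex hull T) \<and>
        pairwise (\<lambda>T T'. interior (convex hull T) \<inter> interior (convex hull T') = {}) \<T> \<and>
        S = (\<Union>T\<in>\<T>. sides T)) \<and>
     pairwise (\<lambda>s s'. rel_interior s \<inter> rel_interior s' = {}) S \<and>
     (\<forall>s\<in>S. rel_interior s \<inter> P = {})"

definition is_triangulation :: "complex set \<Rightarrow> complex set set \<Rightarrow> bool" where
  "is_triangulation P S \<longleftrightarrow> triangle_dissection P S \<and>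
     (\<forall>S'. triangle_dissection P S' \<and> S \<subseteq> S' \<longrightarrow> S' = S)"

section \<open>Subdivided convex polygons\<close>

text \<open>\<open>v 0, \<dots>, v (k - 1)\<close> are, for \<open>k \<ge> 3\<close>, the vertices of a (nondegenerate) convex \<open>k\<close>-gon in
  counterclockwise order: every vertex not on a side lies strictly to the left of that side.\<close>

definition convex_polygon :: "nat \<Rightarrow> (nat \<Rightarrow> complex) \<Rightarrow> bool" where
  "convex_polygon k v \<longleftrightarrow>
     (\<forall>i<k. \<forall>j<k. j \<noteq> i \<and> j \<noteq> Suc i mod k \<longrightarrow>
        Im (cnj (v (Suc i mod k) - v i) * (v j - v i)) > 0)"

definition is_SC :: "nat \<Rightarrow> nat \<Rightarrow> complex set \<Rightarrow> bool" where
  "is_SC k r P \<longleftrightarrow>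
     (\<exists>v A. convex_polygon k v \<and>
        (\<forall>i<k. A i \<subseteq> open_segment (v i) (v (Suc i mod k)) \<and> finite (A i) \<and> card (A i) = r - 1) \<and>
        P = v ` {..<k} \<union> (\<Union>i<k. A i))"

text \<open>For \<open>k \<ge> 3\<close> the number of triangulations does not depend on the chosen polygon and
  subdivision; the description operator refers to this common value. The integrand for
  \<open>k = 2\<close> has poles only at \<open>0\<close> and \<open>1\<close>, so any circle around \<open>0\<close> of radius less than \<open>1\<close>
  is small enough.\<close>

definition tr :: "nat \<Rightarrow> nat \<Rightarrow> complex" where
  "tr k r =
     (if k = 2 then
        - (1 / (4 * pi * \<i>)) *
          contour_integral (circlepath 0 (1/2))
            (\<lambda>t. ((1 - t) ^ (r + 1) - t ^ (r + 1))\<^sup>2 / (t ^ (2 * r) * (1 - t) ^ (2 * r)))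
      else
        of_nat (THE n. \<forall>P. is_SC k r P \<longrightarrow> card {S. is_triangulation P S} = n))"

end

(* Let n = k r. In a triangulation of the n points every chord from a to b that is not an edge has a
   unique triangle on the side of the points a, ..., b, so triangulations correspond to recursively
   built sets of chords, in which a chord joining two non-consecutive points of one side never
   occurs. The resulting interval recursion for the number of triangulations is a quadratic matrix
   equation, which is solved by the shifted Catalan numbers; the latter are residues at t = 0 of
   t (1 - 2 t) / (t (1 - t))^(m + 1). This represents tr(k,r) as the residue of
   -1/2 ((1-t)^(r+1) - t^(r+1))^k / ((1-2t)^(k-2) (t(1-t))^(k r)), for k = 2 by definition.
   Expanding the k-th power, the j-th summand is f / (t^(k-j) (1-t)^j)^r with f independent of r. With
   m = k - j and phi = t (1-t)^(j/m), the small zeros of Q_j are the series psi(zeta x^(1/m)), where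
   psi is the inverse of phi and zeta runs over the m-th roots of unity, and Lagrange inversion turns
   the residues into the coefficients of the sum over the small zeros. *)

theory Submission
  imports Defs
begin

section \<open>Twice the signed area as orientation test; how segments and triangles meet\<close>

section \<open>Orientation of triangles in the plane\<close>

text \<open>The geometric obstacle is collinearity. Points on one side of the polygon span no
  triangle, so \<open>det3\<close> is only weakly positive along the boundary, and every strict
  inequality has to be traced to points that do not share a side. Cutting the cyclic order at
  \<open>0\<close> turns chords into ordered pairs, but the last side then ends in \<open>n\<close>,
  which is the point \<open>0\<close> again. Hence the extra clause \<open>a = 0\<close> and
  \<open>n - r \<le> b\<close> wherever collinearity is decided, and hence the separate treatment of
  the triangle over the edge from \<open>0\<close> to \<open>n - 1\<close>. Maximality comes from
  counting: all chord sets have the same cardinality, so no dissection properly contains another. On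
  the algebraic side collinearity survives only as a weight -1 for a double step along one side. A
  double step never jumps over a corner, so the generating function of weighted paths factors at the
  corners; this is why a \<open>k\<close>-th power appears.\<close>

definition det3 :: "complex \<Rightarrow> complex \<Rightarrow> complex \<Rightarrow> real" where
  "det3 a b c = Im (cnj (b - a) * (c - a))"

lemma det3_altdef:
  "det3 a b c = (Re b - Re a) * (Im c - Im a) - (Im b - Im a) * (Re c - Re a)"
  by (simp add: det3_def algebra_simps)

lemma det3_rotate: "det3 b c a = det3 a b c"
  by (simp add: det3_altdef algebra_simps)

lemma det3_swap: "det3 b a c = - det3 a b c"
  by (simp add: det3_altdef algebra_simps)

lemma det3_flip: "det3 a b c = - det3 a c b"
  by (simp add: det3_altdef algebra_simps)

lemma det3_same [simp]: "det3 a a b = 0" "det3 a b a = 0" "det3 a b b = 0"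
  by (simp_all add: det3_altdef algebra_simps)

text \<open>Sign conditions on \<open>det3 a b\<close> are half planes with normal
  \<open>\<i> * (b - a)\<close>, which makes the facts about half spaces applicable.\<close>

lemma det3_inner: "det3 a b x = inner (\<i> * (b - a)) x - inner (\<i> * (b - a)) a"
  by (simp add: det3_altdef inner_complex_def algebra_simps)

lemma det3_affine:
  assumes "u + v = 1"
  shows "det3 a b (u *\<^sub>R x + v *\<^sub>R y) = u * det3 a b x + v * det3 a b y"
proof -
  have v: "v = 1 - u" using assms by simp
  show ?thesis unfolding v by (simp add: det3_altdef algebra_simps)
qed

lemma det3_affine3:
  assumes "u + v + w = 1"
  shows "det3 a b (u *\<^sub>R x + v *\<^sub>R y + w *\<^sub>R z) = u * det3 a b x + v * det3 a b y + w * det3 a b z"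
proof -
  have w: "w = 1 - u - v" using assms by simp
  show ?thesis unfolding w by (simp add: det3_altdef algebra_simps)
qed

text \<open>Cramer's rule for barycentric coordinates: the signed areas of the three subtriangles at
  \<open>x\<close> are the weights. Kept free of division, it is a polynomial identity that also
  holds for degenerate triangles.\<close>

lemma det3_Cramer:
  "det3 i b x *\<^sub>R a + det3 b a x *\<^sub>R i + det3 a i x *\<^sub>R b = det3 a i b *\<^sub>R x"
  by (simp add: det3_altdef complex_eq_iff algebra_simps)

lemma det3_sum: "det3 i b x + det3 b a x + det3 a i x = det3 a i b"
  by (simp add: det3_altdef algebra_simps)

lemma det3_convex_hull_nonneg:
  assumes "\<And>x. x \<in> X \<Longrightarrow> det3 a b x \<ge> 0" "z \<in> convex hull X"
  shows "det3 a b z \<ge> 0"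
proof -
  have "convex {x. inner (\<i> * (b - a)) x \<ge> inner (\<i> * (b - a)) a}"
    by (rule convex_halfspace_ge)
  then have "convex hull X \<subseteq> {x. inner (\<i> * (b - a)) x \<ge> inner (\<i> * (b - a)) a}"
    using assms(1) by (intro hull_minimal) (auto simp: det3_inner)
  then show ?thesis using assms(2) by (auto simp: det3_inner)
qed

lemma det3_convex_hull_nonpos:
  assumes "\<And>x. x \<in> X \<Longrightarrow> det3 a b x \<le> 0" "z \<in> convex hull X"
  shows "det3 a b z \<le> 0"
  using det3_convex_hull_nonneg[of X b a z] assms by (simp add: det3_swap[of b a])

lemma collinear_iff_det3: "collinear {a, b, c} \<longleftrightarrow> det3 a b c = 0"
proof
  assume "collinear {a, b, c}"
  then have "collinear {b, c, a}" by (simp add: insert_commute)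
  then consider "b = a" | t where "c = t *\<^sub>R b + (1 - t) *\<^sub>R a"
    unfolding collinear_3_expand[of b c a] by (metis add.commute)
  then show "det3 a b c = 0"
  proof cases
    case (2 t)
    show ?thesis unfolding 2 by (simp add: det3_altdef algebra_simps)
  qed simp
next
  assume *: "det3 a b c = 0"
  show "collinear {a, b, c}"
  proof (cases "a = b")
    case False
    \<comment> \<open>\<open>t\<close> is the coefficient of the orthogonal projection of
      \<open>c - a\<close> to \<open>b - a\<close>. This avoids a case distinction on which
      coordinate of \<open>b - a\<close> vanishes.\<close>
    define N where "N = (Re b - Re a)\<^sup>2 + (Im b - Im a)\<^sup>2"
    define t where "t = ((Re c - Re a) * (Re b - Re a) + (Im c - Im a) * (Im b - Im a)) / N"
    have "N \<noteq> 0" using False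
      by (metis N_def complex_eq_iff eq_iff_diff_eq_0 sum_power2_eq_zero_iff)
    have e: "(Re b - Re a) * (Im c - Im a) = (Im b - Im a) * (Re c - Re a)"
      using * by (simp add: det3_altdef)
    have Nt: "N * t = (Re c - Re a) * (Re b - Re a) + (Im c - Im a) * (Im b - Im a)"
      using \<open>N \<noteq> 0\<close> by (simp add: t_def)
    have "N * (Re c - Re a) = N * t * (Re b - Re a)"
      unfolding Nt unfolding N_def power2_eq_square using e by algebra
    then have 1: "Re c - Re a = t * (Re b - Re a)" using \<open>N \<noteq> 0\<close> by simp
    have "N * (Im c - Im a) = N * t * (Im b - Im a)"
      unfolding Nt unfolding N_def power2_eq_square using e by algebra
    then have 2: "Im c - Im a = t * (Im b - Im a)" using \<open>N \<noteq> 0\<close> by simp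
    have "c = t *\<^sub>R b + (1 - t) *\<^sub>R a"
      using 1 2 by (simp add: complex_eq_iff algebra_simps)
    then have "collinear {b, c, a}" unfolding collinear_3_expand[of b c a] by blast
    then show ?thesis by (simp add: insert_commute)
  qed auto
qed

lemma mem_convex_hull_triangle:
  assumes "det3 a i b > 0" "det3 a i x \<ge> 0" "det3 i b x \<ge> 0" "det3 b a x \<ge> 0"
  shows "x \<in> convex hull {a, i, b}"
proof -
  let ?D = "det3 a i b"
  have "x = (1 / ?D) *\<^sub>R (?D *\<^sub>R x)" using assms(1) by simp
  also have "\<dots> = (det3 i b x / ?D) *\<^sub>R a + (det3 b a x / ?D) *\<^sub>R i + (det3 a i x / ?D) *\<^sub>R b"
    by (subst det3_Cramer[symmetric]) (simp add: scaleR_add_right)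
  finally show ?thesis
    unfolding convex_hull_3 using assms det3_sum[of i b x a]
    by (intro CollectI exI[of _ "det3 i b x / ?D"] exI[of _ "det3 b a x / ?D"] exI[of _ "det3 a i x / ?D"])
       (simp flip: add_divide_distrib)
qed

lemma mem_closed_segment_triangle_side:
  assumes "det3 a i b > 0" "det3 a i x = 0" "det3 i b x \<ge> 0" "det3 b a x \<ge> 0"
  shows "x \<in> closed_segment a i"
proof -
  let ?D = "det3 a i b"
  have "x = (1 / ?D) *\<^sub>R (?D *\<^sub>R x)" using assms(1) by simp
  also have "\<dots> = (det3 i b x / ?D) *\<^sub>R a + (det3 b a x / ?D) *\<^sub>R i"
    by (subst det3_Cramer[symmetric]) (simp add: assms scaleR_add_right)
  also have "det3 i b x / ?D = 1 - det3 b a x / ?D"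
    using assms det3_sum[of i b x a] by (simp add: field_simps)
  finally show ?thesis
    unfolding closed_segment_def using assms det3_sum[of i b x a]
    by (intro CollectI exI[of _ "det3 b a x / ?D"]) simp
qed

text \<open>If the segment from \<open>y\<close> to \<open>z\<close> met the line through \<open>a\<close> and \<open>i\<close> beyond \<open>i\<close>, it would leave the
  half plane \<open>det3 i q \<ge> 0\<close>, which has \<open>i\<close> on its boundary.\<close>

lemma segment_crosses_side:
  assumes D: "det3 a i b > 0"
    and y: "det3 b a y \<ge> 0"
    and z: "det3 a i z \<ge> 0" "det3 b a z \<ge> 0"
    and q: "q \<noteq> i" "det3 i q a \<ge> 0" "det3 i q b \<ge> 0" "det3 i q y \<ge> 0" "det3 i q z \<ge> 0"
    and x: "x \<in> closed_segment y z" "det3 a i x < 0"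
  shows "\<exists>w\<in>closed_segment a i. x \<in> closed_segment y w"
proof -
  \<comment> \<open>\<open>u\<close> is written in barycentric coordinates; the vertex
    \<open>i\<close> contributes nothing because it lies on the line through \<open>i\<close> and
    \<open>q\<close>.\<close>
  have l: "det3 a i b * det3 i q u = det3 i b u * det3 i q a + det3 a i u * det3 i q b" for u
    by (simp add: det3_altdef algebra_simps)
  obtain t where t: "0 \<le> t" "t \<le> 1" "x = (1 - t) *\<^sub>R y + t *\<^sub>R z"
    using x(1) by (auto simp: closed_segment_def)
  \<comment> \<open>If \<open>a\<close> lay on the line through \<open>i\<close> and
    \<open>q\<close>, then either \<open>b\<close> would too, which forces \<open>q = i\<close>, or
    the half plane would bound the same side as the line through \<open>a\<close> and
    \<open>i\<close>, contradicting \<open>det3 a i x < 0\<close>.\<close>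
  have qa: "det3 i q a > 0"
  proof (rule ccontr)
    assume "\<not> ?thesis"
    then have qa: "det3 i q a = 0" using q by simp
    have "det3 i q b \<noteq> 0"
    proof
      assume qb: "det3 i q b = 0"
      have "det3 i b q *\<^sub>R a + det3 b a q *\<^sub>R i + det3 a i q *\<^sub>R b = det3 a i b *\<^sub>R q"
        by (rule det3_Cramer)
      moreover have z: "det3 i b q = 0" "det3 a i q = 0"
        using qa qb by (simp_all add: det3_altdef algebra_simps)
      moreover have "det3 b a q = det3 a i b"
        using det3_sum[of i b q a] z by simp
      ultimately show False using D q(1) by simp
    qed
    then have qb: "det3 i q b > 0" using q by simp
    have "det3 a i x * det3 i q b \<ge> 0"
    proof -
      have "det3 i q x \<ge> 0" using t q by (simp add: det3_affine)
      then have "0 \<le> det3 a i b * det3 i q x" using D by simp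
      then show ?thesis by (simp add: l qa)
    qed
    with qb x(2) show False by (simp add: zero_le_mult_iff)
  qed
  \<comment> \<open>The parameter at which the segment from \<open>x\<close> to \<open>z\<close>
    meets the line through \<open>a\<close> and \<open>i\<close>.\<close>
  define s where "s = det3 a i x / (det3 a i x - det3 a i z)"
  have s: "0 < s" "s \<le> 1" using x(2) z(1) by (auto simp: s_def field_simps)
  define w where "w = (1 - s) *\<^sub>R x + s *\<^sub>R z"
  have w0: "det3 a i w = 0"
  proof -
    have "det3 a i w = (1 - s) * det3 a i x + s * det3 a i z" by (simp add: w_def det3_affine)
    also have "\<dots> = 0" using x(2) z(1) by (simp add: s_def field_simps)
    finally show ?thesis .
  qed
  have "det3 b a x \<ge> 0" using t y z by (simp add: det3_affine)
  then have w1: "det3 b a w \<ge> 0" using s z by (simp add: w_def det3_affine)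
  have "det3 i q x \<ge> 0" using t q by (simp add: det3_affine)
  then have "det3 i q w \<ge> 0" using s q by (simp add: w_def det3_affine)
  then have "0 \<le> det3 a i b * det3 i q w" using D by simp
  then have "det3 i b w \<ge> 0" using qa by (simp add: l w0 zero_le_mult_iff)
  then have "w \<in> closed_segment a i"
    using mem_closed_segment_triangle_side[OF D w0 _ w1] by blast
  moreover have "x \<in> closed_segment y w"
  proof -
    \<comment> \<open>The parameter of \<open>w\<close> on the segment from \<open>y\<close> to
      \<open>z\<close>; relative to the segment from \<open>y\<close> to \<open>w\<close>, the point
      \<open>x\<close> has parameter \<open>t / t'\<close>.\<close>
    define t' where "t' = (1 - s) * t + s"
    have "s * t \<le> s * 1" using s t by (intro mult_left_mono) auto
    moreover have "(1 - s) * t \<ge> 0" using s t by simp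
    ultimately have t': "t' > 0" "t \<le> t'"
      using s t by (auto simp: t'_def left_diff_distrib)
    have w_eq: "w = (1 - t') *\<^sub>R y + t' *\<^sub>R z"
      by (simp add: w_def t t'_def algebra_simps)
    have "(1 - t / t') *\<^sub>R y + (t / t') *\<^sub>R w = (1 - t / t' + (t / t') * (1 - t')) *\<^sub>R y + ((t / t') * t') *\<^sub>R z"
      unfolding w_eq scaleR_add_right scaleR_add_left scaleR_scaleR by simp
    moreover have "(t / t') * t' = t" "1 - t / t' + (t / t') * (1 - t') = 1 - t"
      using t' by (simp_all add: field_simps)
    ultimately have "x = (1 - t / t') *\<^sub>R y + (t / t') *\<^sub>R w" using t(3) by simp
    then show ?thesis unfolding closed_segment_def using t t'
      by (intro CollectI exI[of _ "t / t'"]) auto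
  qed
  ultimately show ?thesis by blast
qed

text \<open>A point of the segment that is outside the triangle lies beyond the side
  \<open>a i\<close> or beyond the side \<open>i b\<close>, and both cases are instances of
  \<open>segment_crosses_side\<close>, the second after a reflection.\<close>

lemma segment_split:
  assumes D: "det3 a i b > 0"
    and y: "det3 i b y \<ge> 0" "det3 b a y \<ge> 0"
    and z: "det3 a i z \<ge> 0" "det3 b a z \<ge> 0"
    and q: "q \<noteq> i" "det3 i q a \<ge> 0" "det3 i q b \<ge> 0" "det3 i q y \<ge> 0" "det3 i q z \<ge> 0"
    and x: "x \<in> closed_segment y z"
  shows "x \<in> convex hull {a, i, b} \<or> (\<exists>w\<in>closed_segment a i. x \<in> closed_segment y w) \<or>
    (\<exists>w\<in>closed_segment i b. x \<in> closed_segment w z)"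
proof -
  have "det3 b a x \<ge> 0"
    using x y z by (auto simp: closed_segment_def det3_affine)
  moreover have "\<exists>w\<in>closed_segment i b. x \<in> closed_segment w z" if neg: "det3 i b x < 0"
  proof -
    \<comment> \<open>Complex conjugation reverses orientation and so exchanges the roles of
      \<open>a\<close> and \<open>b\<close> and of \<open>y\<close> and \<open>z\<close>. Reflecting
      \<open>q\<close> in \<open>i\<close> beforehand compensates the reversal for the supporting
      half plane at \<open>i\<close>.\<close>
    have c: "det3 (cnj u) (cnj v) (cnj w) = det3 v u w" for u v w
      by (simp add: det3_altdef algebra_simps)
    have cs: "cnj u \<in> closed_segment (cnj v) (cnj w) \<longleftrightarrow> u \<in> closed_segment v w" for u v w
      by (auto simp: closed_segment_def complex_eq_iff)
    define q' where "q' = 2 * i - q"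
    have q': "det3 q' i u = det3 i q u" for u
      by (simp add: q'_def det3_altdef algebra_simps)
    have "\<exists>w\<in>closed_segment (cnj b) (cnj i). cnj x \<in> closed_segment (cnj z) w"
    proof (rule segment_crosses_side[where b = "cnj a" and q = "cnj q'" and z = "cnj y"])
      show "det3 (cnj b) (cnj i) (cnj a) > 0"
        using D by (simp add: c det3_altdef algebra_simps)
      show "cnj q' \<noteq> cnj i" using q(1) by (simp add: q'_def)
    qed (use assms neg in \<open>auto simp: c cs q' closed_segment_commute\<close>)
    then obtain w where w: "w \<in> closed_segment (cnj b) (cnj i)" "cnj x \<in> closed_segment (cnj z) w" by blast
    have "cnj w \<in> closed_segment i b" "x \<in> closed_segment (cnj w) z"
      using w cs[of "cnj w" b i] cs[of x z "cnj w"] by (simp_all add: closed_segment_commute)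
    then show ?thesis by blast
  qed
  ultimately show ?thesis
    using segment_crosses_side[OF D y(2) z q x] mem_convex_hull_triangle[OF D, of x] by linarith
qed

lemma interior_separated:
  assumes "a \<noteq> b" "\<And>x. x \<in> X \<Longrightarrow> det3 a b x \<le> 0" "\<And>y. y \<in> Y \<Longrightarrow> det3 a b y \<ge> 0"
  shows "interior (convex hull X) \<inter> interior (convex hull Y) = {}"
proof -
  let ?u = "\<i> * (b - a)"
  have nz: "?u \<noteq> 0" using assms(1) by simp
  have "convex hull X \<subseteq> {x. inner ?u x \<le> inner ?u a}"
    using det3_convex_hull_nonpos[of X a b] assms(2) by (auto simp: det3_inner)
  then have 1: "interior (convex hull X) \<subseteq> {x. inner ?u x < inner ?u a}"
    using interior_mono interior_halfspace_le[OF nz] by blast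
  have "convex hull Y \<subseteq> {x. inner ?u x \<ge> inner ?u a}"
    using det3_convex_hull_nonneg[of Y a b] assms(3) by (auto simp: det3_inner)
  then have 2: "interior (convex hull Y) \<subseteq> {x. inner ?u x > inner ?u a}"
    using interior_mono interior_halfspace_ge[OF nz] by blast
  show ?thesis using 1 2 by force
qed

text \<open>The signed areas of four points give an affine dependence between them. Here its
  coefficients are positive with \<open>a\<close>, \<open>b\<close> on one side and
  \<open>c\<close>, \<open>d\<close> on the other, and dividing by the common sum \<open>N\<close>
  exhibits the crossing point.\<close>

lemma open_segments_cross:
  assumes "det3 a c b > 0" "det3 a b d > 0" "det3 a c d > 0" "det3 c b d > 0"
  shows "open_segment a b \<inter> open_segment c d \<noteq> {}"
proof -
  define N where "N = det3 a c b + det3 a b d"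
  have N: "N > 0" "N = det3 c b d + det3 a c d"
    using assms by (auto simp: N_def det3_altdef algebra_simps)
  define t where "t = det3 a c d / N"
  define s where "s = det3 a c b / N"
  have t: "0 < t" "t < 1" and s: "0 < s" "s < 1"
    using assms N N_def by (auto simp: t_def s_def field_simps)
  have 1: "1 - t = det3 c b d / N" "1 - s = det3 a b d / N"
    using N(1) N(2) N_def by (auto simp: t_def s_def field_simps)
  have e: "det3 c b d *\<^sub>R a + det3 a c d *\<^sub>R b = det3 a b d *\<^sub>R c + det3 a c b *\<^sub>R d"
    by (simp add: det3_altdef complex_eq_iff algebra_simps)
  have "(1 - t) *\<^sub>R a + t *\<^sub>R b = (1 / N) *\<^sub>R (det3 c b d *\<^sub>R a + det3 a c d *\<^sub>R b)"
    unfolding 1 by (simp add: t_def scaleR_add_right)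
  also have "\<dots> = (1 - s) *\<^sub>R c + s *\<^sub>R d"
    unfolding 1 by (simp add: e s_def scaleR_add_right)
  finally have eq: "(1 - t) *\<^sub>R a + t *\<^sub>R b = (1 - s) *\<^sub>R c + s *\<^sub>R d" .
  have "a \<noteq> b" "c \<noteq> d" using assms by auto
  then have "(1 - t) *\<^sub>R a + t *\<^sub>R b \<in> open_segment a b \<inter> open_segment c d"
    using t s eq by (auto simp: in_segment)
  then show ?thesis by blast
qed

lemma det3_open_segment_eq_0:
  assumes "z \<in> open_segment c d" "det3 a b z = 0"
    and "(det3 a b c \<ge> 0 \<and> det3 a b d \<ge> 0) \<or> (det3 a b c \<le> 0 \<and> det3 a b d \<le> 0)"
  shows "det3 a b c = 0 \<and> det3 a b d = 0"
proof -
  obtain t where t: "0 < t" "t < 1" "z = (1 - t) *\<^sub>R c + t *\<^sub>R d"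
    using assms(1) by (auto simp: in_segment)
  then have "(1 - t) * det3 a b c = - (t * det3 a b d)"
    using assms(2) by (simp add: det3_affine)
  moreover have "(1 - t) * det3 a b c \<ge> 0 \<and> t * det3 a b d \<ge> 0 \<or> (1 - t) * det3 a b c \<le> 0 \<and> t * det3 a b d \<le> 0"
    using assms(3) t by (auto simp: mult_le_0_iff)
  ultimately have "(1 - t) * det3 a b c = 0 \<and> t * det3 a b d = 0" by linarith
  then show ?thesis using t by simp
qed

lemma det3_open_segment [simp]: "z \<in> open_segment a b \<Longrightarrow> det3 a b z = 0"
  by (auto simp: in_segment det3_affine)

lemma open_segment_on_line:
  fixes v w :: complex
  assumes "w \<noteq> 0" "\<alpha> < \<beta>"
  shows "open_segment (v + of_real \<alpha> * w) (v + of_real \<beta> * w) = (\<lambda>t. v + of_real t * w) ` {\<alpha><..<\<beta>}"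
proof (intro equalityI subsetI)
  fix z assume "z \<in> open_segment (v + of_real \<alpha> * w) (v + of_real \<beta> * w)"
  then obtain t where t: "0 < t" "t < 1"
    "z = (1 - t) *\<^sub>R (v + of_real \<alpha> * w) + t *\<^sub>R (v + of_real \<beta> * w)"
    by (auto simp: in_segment)
  then have "z = v + of_real (\<alpha> + t * (\<beta> - \<alpha>)) * w"
    by (simp add: scaleR_conv_of_real algebra_simps)
  moreover have "\<alpha> + t * (\<beta> - \<alpha>) > \<alpha>" using t assms by simp
  moreover have "\<alpha> + t * (\<beta> - \<alpha>) < \<beta>"
  proof -
    have "t * (\<beta> - \<alpha>) < 1 * (\<beta> - \<alpha>)" using t assms by (intro mult_strict_right_mono) auto
    then show ?thesis by simp
  qed
  ultimately show "z \<in> (\<lambda>t. v + of_real t * w) ` {\<alpha><..<\<beta>}"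
    by (intro image_eqI[of _ _ "\<alpha> + t * (\<beta> - \<alpha>)"]) auto
next
  fix z assume "z \<in> (\<lambda>t. v + of_real t * w) ` {\<alpha><..<\<beta>}"
  then obtain \<gamma> where g: "\<alpha> < \<gamma>" "\<gamma> < \<beta>" "z = v + of_real \<gamma> * w" by auto
  define t where "t = (\<gamma> - \<alpha>) / (\<beta> - \<alpha>)"
  have "z = (1 - t) *\<^sub>R (v + of_real \<alpha> * w) + t *\<^sub>R (v + of_real \<beta> * w)"
  proof -
    have "\<gamma> = \<alpha> + t * (\<beta> - \<alpha>)" using assms by (simp add: t_def)
    then have "z = v + of_real (\<alpha> + t * (\<beta> - \<alpha>)) * w" using g by simp
    then show ?thesis by (simp add: scaleR_conv_of_real algebra_simps)
  qed
  moreover have "0 < t" "t < 1" using g by (auto simp: t_def)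
  ultimately show "z \<in> open_segment (v + of_real \<alpha> * w) (v + of_real \<beta> * w)"
    using assms by (auto simp: in_segment)
qed

section \<open>Recursively built chord sets, their size and their unique decomposition\<close>

section \<open>Triangulations as sets of chords\<close>

text \<open>The points of \<open>SC(k,r)\<close> are numbered \<open>0, \<dots>, k * r - 1\<close> along the boundary, so that the closed side \<open>s\<close>
  carries the numbers from \<open>s * r\<close> to \<open>Suc s * r\<close>; the end \<open>k * r\<close> of the last side is the point \<open>0\<close>,
  a coincidence that \<open>same_side\<close> does not see.\<close>

definition same_side :: "nat \<Rightarrow> nat \<Rightarrow> nat \<Rightarrow> bool" where
  "same_side r a b \<longleftrightarrow> (\<exists>s. s * r \<le> a \<and> b \<le> Suc s * r)"

text \<open>\<open>tri r a b S\<close>: the chords \<open>S\<close> triangulate the polygon with the vertices \<open>a, \<dots>, b\<close>; the vertex \<open>i\<close> is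
  the apex of the triangle over the chord from \<open>a\<close> to \<open>b\<close>.\<close>

inductive tri :: "nat \<Rightarrow> nat \<Rightarrow> nat \<Rightarrow> (nat \<times> nat) set \<Rightarrow> bool" for r where
  tri_edge: "tri r a (Suc a) {(a, Suc a)}"
| tri_node: "a < i \<Longrightarrow> i < b \<Longrightarrow> \<not> same_side r a b \<Longrightarrow> tri r a i S \<Longrightarrow> tri r i b S' \<Longrightarrow>
    tri r a b (insert (a, b) (S \<union> S'))"

lemma tri_less: "tri r a b S \<Longrightarrow> a < b"
  by (induction rule: tri.induct) auto

lemma tri_range: "tri r a b S \<Longrightarrow> (x, y) \<in> S \<Longrightarrow> a \<le> x \<and> x < y \<and> y \<le> b"
proof (induction arbitrary: x y rule: tri.induct)
  case (tri_node a i b S S')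
  consider "(x, y) = (a, b)" | "(x, y) \<in> S" | "(x, y) \<in> S'" using tri_node.prems by blast
  then show ?case
  proof cases
    case 2
    then show ?thesis using tri_node.IH(1)[of x y] tri_node.hyps(1,2) by simp
  next
    case 3
    then show ?thesis using tri_node.IH(2)[of x y] tri_node.hyps(1,2) by simp
  qed (use tri_node.hyps in simp)
qed simp

lemma tri_mem: "tri r a b S \<Longrightarrow> (a, b) \<in> S"
  by (induction rule: tri.induct) auto

lemma tri_finite: "tri r a b S \<Longrightarrow> finite S"
  by (induction rule: tri.induct) auto

text \<open>A triangulated polygon with \<open>m = b - a + 1\<close> vertices has
  \<open>2 * m - 3\<close> segments, boundary included. That the number does not depend on
  \<open>S\<close> later yields maximality.\<close>

lemma tri_card: "tri r a b S \<Longrightarrow> card S + 1 = 2 * (b - a)"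
proof (induction rule: tri.induct)
  case (tri_node a i b S S')
  have 1: "a \<le> x \<and> x < y \<and> y \<le> i" if "(x, y) \<in> S" for x y using tri_range[OF tri_node(4) that] .
  have 2: "i \<le> x \<and> x < y \<and> y \<le> b" if "(x, y) \<in> S'" for x y using tri_range[OF tri_node(5) that] .
  have "(a, b) \<notin> S \<union> S'"
    using 1[of a b] 2[of a b] tri_node(1,2) by auto
  moreover have "(x, y) \<notin> S'" if "(x, y) \<in> S" for x y
    using 1[of x y] 2[of x y] that by auto
  then have "S \<inter> S' = {}" by auto
  ultimately have "S \<inter> S' = {}" "(a, b) \<notin> S \<union> S'" by blast+
  then have "card (insert (a, b) (S \<union> S')) = Suc (card S + card S')"
    using tri_finite[OF tri_node(4)] tri_finite[OF tri_node(5)] by (simp add: card_Un_disjoint)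
  then show ?case using tri_node by simp
qed simp

lemma tri_chord:
  assumes "tri r a b S" "(x, y) \<in> S"
  shows "y = Suc x \<or> \<not> same_side r x y"
  using assms by (induction arbitrary: x y rule: tri.induct) auto

lemma tri_noncrossing:
  assumes "tri r a b S" "(x, y) \<in> S" "(x', y') \<in> S" "x < x'" "x' < y"
  shows "y' \<le> y"
  using assms
proof (induction arbitrary: x y x' y' rule: tri.induct)
  case (tri_node a i b S S')
  have S: "a \<le> x \<and> x < y \<and> y \<le> i" if "(x, y) \<in> S" for x y using tri_range[OF tri_node(4) that] .
  have S': "i \<le> x \<and> x < y \<and> y \<le> b" if "(x, y) \<in> S'" for x y using tri_range[OF tri_node(5) that] .
  consider "(x, y) = (a, b)" | "(x', y') = (a, b)" "(x, y) \<noteq> (a, b)" | "(x, y) \<in> S" "(x', y') \<in> S" | "(x, y) \<in> S'" "(x', y') \<in> S'"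
    | "(x, y) \<in> S" "(x', y') \<in> S'" | "(x, y) \<in> S'" "(x', y') \<in> S"
    using tri_node.prems(1,2) by blast
  then show ?case
  proof cases
    case 1
    then show ?thesis using tri_node.prems(2) S[of x' y'] S'[of x' y'] tri_node.hyps(1,2) by auto
  next
    case 2
    then show ?thesis using tri_node.prems S[of x y] S'[of x y] tri_node.hyps(1,2) by auto
  next
    case 3
    then show ?thesis using tri_node.IH(1) tri_node.prems by blast
  next
    case 4
    then show ?thesis using tri_node.IH(2) tri_node.prems by blast
  next
    case 5
    then show ?thesis using S[of x y] S'[of x' y'] tri_node.prems by auto
  next
    case 6
    then show ?thesis using S'[of x y] S[of x' y'] tri_node.prems by auto
  qed
qed auto

text \<open>The apex can be read off from the chord set: it is the largest \<open>j < b\<close> for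
  which \<open>(a, j)\<close> occurs. Cutting the set at the apex then returns both halves.\<close>

lemma tri_inject:
  assumes "tri r a i S1" "tri r i b S2" "tri r a j T1" "tri r j b T2"
    "insert (a, b) (S1 \<union> S2) = insert (a, b) (T1 \<union> T2)"
  shows "i = j \<and> S1 = T1 \<and> S2 = T2"
proof -
  have aux: "j \<le> i" if "tri r a i S1" "tri r i b S2" "tri r a j T1" "tri r j b T2"
    "insert (a, b) (S1 \<union> S2) = insert (a, b) (T1 \<union> T2)" for i j S1 S2 T1 T2
  proof -
    have "(a, j) \<in> insert (a, b) (S1 \<union> S2)" using tri_mem[OF that(3)] that(5) by blast
    then show ?thesis
      using tri_range[OF that(1), of a j] tri_range[OF that(2), of a j] tri_less[OF that(1)] tri_less[OF that(4)]
      by auto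
  qed
  have ij: "i = j" using aux[OF assms] aux[OF assms(3,4,1,2) assms(5)[symmetric]] by simp
  have l: "{(x, y) \<in> insert (a, b) (U1 \<union> U2). y \<le> i} = U1 \<and> {(x, y) \<in> insert (a, b) (U1 \<union> U2). i \<le> x} = U2"
    if U: "tri r a i U1" "tri r i b U2" for U1 U2
  proof -
    have 1: "a \<le> x \<and> x < y \<and> y \<le> i" if "(x, y) \<in> U1" for x y using tri_range[OF U(1) that] .
    have 2: "i \<le> x \<and> x < y \<and> y \<le> b" if "(x, y) \<in> U2" for x y using tri_range[OF U(2) that] .
    have 3: "a < i" "i < b" using tri_less U by auto
    show ?thesis
    proof (intro conjI set_eqI; clarify)
      fix x y
      show "(x, y) \<in> {(x, y) \<in> insert (a, b) (U1 \<union> U2). y \<le> i} \<longleftrightarrow> (x, y) \<in> U1"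
        using 1[of x y] 2[of x y] 3 by auto
      show "(x, y) \<in> {(x, y) \<in> insert (a, b) (U1 \<union> U2). i \<le> x} \<longleftrightarrow> (x, y) \<in> U2"
        using 1[of x y] 2[of x y] 3 by auto
    qed
  qed
  show ?thesis
    using l[OF assms(1,2)] l[of T1 T2] assms(3,4) ij unfolding assms(5) by simp
qed

lemma tri_cases:
  "tri r a b S \<longleftrightarrow> b = Suc a \<and> S = {(a, b)} \<or> \<not> same_side r a b \<and>
    (\<exists>i\<in>{a<..<b}. \<exists>S1 S2. tri r a i S1 \<and> tri r i b S2 \<and> S = insert (a, b) (S1 \<union> S2))"
  by (subst tri.simps, unfold Bex_def greaterThanLessThan_iff) (rule iffI; elim disjE exE conjE; simp; blast)

lemma tri_Collect_edge: "{S. tri r a (Suc a) S} = {{(a, Suc a)}}"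
  by (subst tri_cases) auto

lemma tri_Collect_same_side: "same_side r a b \<Longrightarrow> b \<noteq> Suc a \<Longrightarrow> {S. tri r a b S} = {}"
  by (subst tri_cases) simp

lemma tri_Collect_node:
  "\<not> same_side r a b \<Longrightarrow> b \<noteq> Suc a \<Longrightarrow> {S. tri r a b S} =
    (\<Union>i\<in>{a<..<b}. (\<lambda>(S, S'). insert (a, b) (S \<union> S')) ` ({S. tri r a i S} \<times> {S. tri r i b S}))"
proof (intro set_eqI)
  fix S assume *: "\<not> same_side r a b" "b \<noteq> Suc a"
  have "tri r a b S \<longleftrightarrow> (\<exists>i\<in>{a<..<b}. \<exists>S1 S2. tri r a i S1 \<and> tri r i b S2 \<and> S = insert (a, b) (S1 \<union> S2))"
    unfolding tri_cases[of r a b] using * by blast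
  then show "S \<in> {S. tri r a b S} \<longleftrightarrow> S \<in> (\<Union>i\<in>{a<..<b}. (\<lambda>(S, S'). insert (a, b) (S \<union> S')) ` ({S. tri r a i S} \<times> {S. tri r i b S}))"
    unfolding mem_Collect_eq UN_iff image_iff Bex_def mem_Sigma_iff by (simp add: split_paired_Ex)
qed

lemma tri_Collect_finite: "finite {S. tri r a b S}"
proof (rule finite_subset)
  show "{S. tri r a b S} \<subseteq> Pow ({..b} \<times> {..b})"
  proof clarify
    fix S x y assume "tri r a b S" "(x, y) \<in> S"
    then show "x \<in> {..b} \<and> y \<in> {..b}" using tri_range[of r a b S x y] by simp
  qed
qed auto

lemma card_tri_split:
  "card (\<Union>i\<in>I. (\<lambda>(S, S'). insert (a, b) (S \<union> S')) ` ({S. tri r a i S} \<times> {S. tri r i b S})) =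
   (\<Sum>i\<in>I. card {S. tri r a i S} * card {S. tri r i b S})" if "finite I"
proof -
  let ?f = "\<lambda>(S, S'). insert (a, b) (S \<union> S')"
  have "card (\<Union>i\<in>I. ?f ` ({S. tri r a i S} \<times> {S. tri r i b S})) =
    (\<Sum>i\<in>I. card (?f ` ({S. tri r a i S} \<times> {S. tri r i b S})))"
  proof (rule card_UN_disjoint[OF that])
    show "\<forall>i\<in>I. finite (?f ` ({S. tri r a i S} \<times> {S. tri r i b S}))"
      by (simp add: tri_Collect_finite)
    show "\<forall>i\<in>I. \<forall>j\<in>I. i \<noteq> j \<longrightarrow> ?f ` ({S. tri r a i S} \<times> {S. tri r i b S}) \<inter>
        ?f ` ({S. tri r a j S} \<times> {S. tri r j b S}) = {}"
    proof (intro ballI impI, rule ccontr)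
      fix i j assume "i \<noteq> j" "?f ` ({S. tri r a i S} \<times> {S. tri r i b S}) \<inter>
        ?f ` ({S. tri r a j S} \<times> {S. tri r j b S}) \<noteq> {}"
      then obtain S1 S2 T1 T2 where "tri r a i S1" "tri r i b S2" "tri r a j T1" "tri r j b T2"
        "insert (a, b) (S1 \<union> S2) = insert (a, b) (T1 \<union> T2)" by auto
      from tri_inject[OF this] \<open>i \<noteq> j\<close> show False by simp
    qed
  qed
  also have "\<dots> = (\<Sum>i\<in>I. card {S. tri r a i S} * card {S. tri r i b S})"
  proof (rule sum.cong[OF refl])
    fix i assume "i \<in> I"
    have "inj_on ?f ({S. tri r a i S} \<times> {S. tri r i b S})"
    proof (rule inj_onI)
      fix X Y assume XY: "X \<in> {S. tri r a i S} \<times> {S. tri r i b S}" "Y \<in> {S. tri r a i S} \<times> {S. tri r i b S}" "?f X = ?f Y"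
      obtain S1 S2 T1 T2 where e: "X = (S1, S2)" "Y = (T1, T2)" by (metis surj_pair)
      show "X = Y" using tri_inject[of r a i S1 b S2 i T1 T2] XY unfolding e by simp
    qed
    then show "card (?f ` ({S. tri r a i S} \<times> {S. tri r i b S})) = card {S. tri r a i S} * card {S. tri r i b S}"
      by (simp add: card_image card_cartesian_product)
  qed
  finally show ?thesis .
qed

section \<open>Orientation, betweenness and chords for points numbered along the boundary\<close>

section \<open>Points on the sides of a convex polygon\<close>

text \<open>All that the combinatorics needs to know about the polygon: strict orientation of
  triples not on a common side, and the order of the points along each side. Indices are reduced
  modulo \<open>n\<close> in the second part so that the last side reaches the point
  \<open>0\<close>; the exception \<open>a = 0\<close> and \<open>n - r \<le> b\<close> in the first
  part is the triple on the last side that \<open>same_side\<close> misses.\<close>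

locale side_points =
  fixes k r n :: nat and p :: "nat \<Rightarrow> complex"
  assumes k: "k \<ge> 3" and r: "r \<ge> 1" and n: "n = k * r"
    and det3_pos: "a < b \<Longrightarrow> b < c \<Longrightarrow> c < n \<Longrightarrow> \<not> same_side r a c \<Longrightarrow> \<not> (a = 0 \<and> n - r \<le> b) \<Longrightarrow>
      det3 (p a) (p b) (p c) > 0"
    and side: "s < k \<Longrightarrow> \<exists>v w \<tau>. w \<noteq> 0 \<and>
      (\<forall>x. s * r \<le> x \<and> x \<le> Suc s * r \<longrightarrow> p (x mod n) = v + of_real (\<tau> x) * w) \<and>
      (\<forall>x y. s * r \<le> x \<and> x < y \<and> y \<le> Suc s * r \<longrightarrow> \<tau> x < (\<tau> y :: real))"
begin

lemma n_ge: "3 * r \<le> n" "n \<ge> 3"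
proof -
  show "3 * r \<le> n" using k by (simp add: n)
  then show "n \<ge> 3" using r by linarith
qed

lemma same_side_less: "same_side r a b \<Longrightarrow> a < n \<Longrightarrow> \<exists>s<k. s * r \<le> a \<and> b \<le> Suc s * r"
  unfolding same_side_def n by (metis le_less_trans mult_less_cancel2)

lemma last_side: "(k - 1) * r = n - r" "Suc (k - 1) * r = n"
  using k by (auto simp: n diff_mult_distrib)

lemma not_wrap_same: "\<not> same_side r 0 b" if "r < b"
  using that r by (auto simp: same_side_def)

lemma side_between:
  assumes "s < k" "s * r \<le> a" "a < b" "b < c" "c \<le> Suc s * r"
  shows "p (b mod n) \<in> open_segment (p (a mod n)) (p (c mod n))"
proof -
  obtain v w \<tau> where w: "w \<noteq> 0" "\<And>x. s * r \<le> x \<Longrightarrow> x \<le> Suc s * r \<Longrightarrow> p (x mod n) = v + of_real (\<tau> x) * w"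
    "\<And>x y. s * r \<le> x \<Longrightarrow> x < y \<Longrightarrow> y \<le> Suc s * r \<Longrightarrow> \<tau> x < (\<tau> y :: real)"
    using side[OF assms(1)] by blast
  have "\<tau> a < \<tau> b" "\<tau> b < \<tau> c" using assms by (auto intro: w(3))
  then show ?thesis
    using assms w(1) by (simp add: w(2) open_segment_on_line del: mult_Suc)
qed

lemma side_disjoint:
  assumes "s < k" "s * r \<le> a" "a < b" "b \<le> c" "c < d" "d \<le> Suc s * r"
  shows "open_segment (p (a mod n)) (p (b mod n)) \<inter> open_segment (p (c mod n)) (p (d mod n)) = {}"
proof -
  obtain v w \<tau> where w: "w \<noteq> 0" "\<And>x. s * r \<le> x \<Longrightarrow> x \<le> Suc s * r \<Longrightarrow> p (x mod n) = v + of_real (\<tau> x) * w"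
    "\<And>x y. s * r \<le> x \<Longrightarrow> x < y \<Longrightarrow> y \<le> Suc s * r \<Longrightarrow> \<tau> x < (\<tau> y :: real)"
    using side[OF assms(1)] by blast
  have "\<tau> a < \<tau> b" "\<tau> c < \<tau> d" "\<tau> b \<le> \<tau> c"
    using assms w(3)[of a b] w(3)[of c d] w(3)[of b c] by (auto simp: le_less)
  then show ?thesis
    using assms w(1) by (auto simp: w(2) open_segment_on_line simp del: mult_Suc)
qed

lemma side_not_between:
  assumes "s < k" "s * r \<le> a" "a < b" "b \<le> Suc s * r" "s * r \<le> c" "c \<le> Suc s * r" "c \<le> a \<or> b \<le> c"
  shows "p (c mod n) \<notin> open_segment (p (a mod n)) (p (b mod n))"
proof -
  obtain v w \<tau> where w: "w \<noteq> 0" "\<And>x. s * r \<le> x \<Longrightarrow> x \<le> Suc s * r \<Longrightarrow> p (x mod n) = v + of_real (\<tau> x) * w"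
    "\<And>x y. s * r \<le> x \<Longrightarrow> x < y \<Longrightarrow> y \<le> Suc s * r \<Longrightarrow> \<tau> x < (\<tau> y :: real)"
    using side[OF assms(1)] by blast
  have "\<tau> a < \<tau> b" "\<tau> c \<le> \<tau> a \<or> \<tau> b \<le> \<tau> c"
    using assms w(3)[of a b] w(3)[of c a] w(3)[of b c] by (auto simp: le_less)
  then show ?thesis
    using assms w(1) by (auto simp: w(2) open_segment_on_line simp del: mult_Suc)
qed

lemma same_side_det3:
  assumes "a < b" "b < c" "c < n" "same_side r a c"
  shows "det3 (p a) (p b) (p c) = 0"
proof -
  obtain s where s: "s < k" "s * r \<le> a" "c \<le> Suc s * r"
    using same_side_less assms by (meson less_trans)
  have "p b \<in> open_segment (p a) (p c)" using side_between[of s a b c] s assms by simp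
  then have "det3 (p a) (p c) (p b) = 0" by simp
  then show ?thesis by (metis det3_rotate det3_swap neg_equal_0_iff_equal)
qed

lemma wrap_det3:
  assumes "n - r \<le> b" "b < c" "c < n"
  shows "det3 (p 0) (p b) (p c) = 0"
proof -
  have "p (c mod n) \<in> open_segment (p (b mod n)) (p (n mod n))"
    by (rule side_between[of "k - 1"]) (use assms last_side k in auto)
  then have "det3 (p b) (p 0) (p c) = 0" using assms by simp
  then show ?thesis by (simp add: det3_swap[of "p 0"])
qed

lemma det3_nonneg:
  assumes "a \<le> b" "b \<le> c" "c < n"
  shows "det3 (p a) (p b) (p c) \<ge> 0"
proof (cases "a = b \<or> b = c")
  case False
  then show ?thesis using assms det3_pos[of a b c] same_side_det3[of a b c] wrap_det3[of b c]
    by (cases "same_side r a c \<or> (a = 0 \<and> n - r \<le> b)") auto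
qed auto

lemma det3_eq_0_iff:
  assumes "a < b" "b < c" "c < n"
  shows "det3 (p a) (p b) (p c) = 0 \<longleftrightarrow> same_side r a c \<or> (a = 0 \<and> n - r \<le> b)"
  using assms det3_pos[of a b c] same_side_det3[of a b c] wrap_det3[of b c] by force

text \<open>If two points coincided, every triple containing both would be degenerate. As there are
  at least three sides, some third point contradicts this.\<close>

lemma p_neq:
  assumes "a < b" "b < n"
  shows "p a \<noteq> p b"
proof
  assume eq: "p a = p b"
  have *: "same_side r a c \<or> (a = 0 \<and> n - r \<le> b)" if "b < c" "c < n" for c
    using det3_eq_0_iff[OF assms(1) that] eq by simp
  have 2: "same_side r c b \<or> (c = 0 \<and> n - r \<le> a)" if "c < a" for c
    using det3_eq_0_iff[OF that assms] eq by simp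
  have 3: "same_side r a b \<or> (a = 0 \<and> n - r \<le> c)" if "a < c" "c < b" for c
    using det3_eq_0_iff[OF that assms(2)] eq by simp
  show False
  proof (cases "a = 0")
    case True
    then consider "b \<le> r" | "r < b" by linarith
    then show ?thesis
    proof cases
      case 1
      then have "same_side r 0 (n - 1) \<or> n - r \<le> b" using *[of "n - 1"] True n_ge r by auto
      then have "same_side r 0 (n - 1)" using 1 n_ge r by linarith
      moreover have "r < n - 1" using n_ge r by linarith
      ultimately show ?thesis using not_wrap_same[of "n - 1"] by blast
    next
      case 2
      then show ?thesis using 3[of 1] True r n_ge not_wrap_same[of b] by auto
    qed
  next
    case False
    then have "same_side r 0 b \<or> n - r \<le> a" using 2[of 0] by simp
    moreover have "n - r \<le> a" if "same_side r 0 b"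
    proof -
      have "b \<le> r" using that not_wrap_same[of b] by linarith
      then have "same_side r a (n - 1)" using *[of "n - 1"] False n_ge r by auto
      then obtain s where s: "s * r \<le> a" "n - 1 \<le> Suc s * r" by (auto simp: same_side_def)
      then have "n - 1 \<le> r + a" by simp
      moreover have "s * r < 1 * r" using s \<open>b \<le> r\<close> assms by linarith
      then have "s = 0" by (simp only: mult_less_cancel2) simp
      ultimately show ?thesis using s n_ge r by simp
    qed
    ultimately have a: "n - r \<le> a" by blast
    then have "same_side r 1 b" using 2[of 1] n_ge r by auto
    then obtain s where s: "s * r \<le> 1" "b \<le> Suc s * r" by (auto simp: same_side_def)
    have "b \<le> 1 + r" using s by simp
    then show False using a n_ge r assms by linarith
  qed
qed

lemma p_eq_iff: "a < n \<Longrightarrow> b < n \<Longrightarrow> p a = p b \<longleftrightarrow> a = b"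
  using p_neq[of a b] p_neq[of b a] by (metis linorder_neqE_nat)

text \<open>These turn out to be exactly the pairs whose open segment contains no further point:
  neighbours, including the wrap-around pair \<open>0\<close> and \<open>n - 1\<close>, and pairs
  that lie on no common side.\<close>

definition chord :: "nat \<Rightarrow> nat \<Rightarrow> bool" where
  "chord a b \<longleftrightarrow> a < b \<and> b < n \<and>
     (b = Suc a \<or> (a = 0 \<and> b = n - 1) \<or> \<not> (same_side r a b \<or> (a = 0 \<and> n - r \<le> b)))"

lemma not_same_side_ends: "\<not> same_side r 0 (n - 1)"
  using not_wrap_same[of "n - 1"] n_ge r by auto

lemma chord_det3_pos:
  assumes "chord a b" "a < i" "i < b" "\<not> (a = 0 \<and> b = n - 1)"
  shows "det3 (p a) (p i) (p b) > 0"
  using assms by (intro det3_pos) (auto simp: chord_def)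

lemma chord_no_points:
  assumes "chord a b" "x < n"
  shows "p x \<notin> open_segment (p a) (p b)"
proof
  assume x: "p x \<in> open_segment (p a) (p b)"
  have ab: "a < b" "b < n" using assms by (auto simp: chord_def)
  have d: "det3 (p a) (p b) (p x) = 0" using x by simp
  have "x \<noteq> a" "x \<noteq> b" using x by (auto simp: open_segment_def)
  then consider "x < a" | "a < x" "x < b" | "b < x" by linarith
  then show False
  proof cases
    case 1
    then have "same_side r x b \<or> (x = 0 \<and> n - r \<le> a)"
      using d ab det3_eq_0_iff[of x a b] by (simp add: det3_rotate)
    then show False
    proof
      assume "same_side r x b"
      then obtain s where "s < k" "s * r \<le> x" "b \<le> Suc s * r" using same_side_less assms by blast
      then show False using side_not_between[of s a b x] 1 ab x assms(2) by simp
    next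
      assume "x = 0 \<and> n - r \<le> a"
      then show False using side_not_between[of "k - 1" a b n] 1 ab x last_side k by simp
    qed
  next
    case 2
    have "det3 (p a) (p x) (p b) = 0" using d det3_swap[of "p x"] det3_rotate by (metis neg_0_equal_iff_equal)
    then have "same_side r a b \<or> (a = 0 \<and> n - r \<le> x)"
      using 2 ab det3_eq_0_iff[of a x b] by simp
    then have *: "a = 0" "b = n - 1" "n - r \<le> x"
      using assms 2 not_same_side_ends by (auto simp: chord_def)
    then show False using side_not_between[of "k - 1" b n x] 2 ab x last_side k by (simp add: open_segment_commute)
  next
    case 3
    then have "same_side r a x \<or> (a = 0 \<and> n - r \<le> b)"
      using d ab det3_eq_0_iff[of a b x] assms by simp
    then show False
    proof
      assume "same_side r a x"
      then obtain s where "s < k" "s * r \<le> a" "x \<le> Suc s * r" using same_side_less ab by (meson less_trans)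
      then show False using side_not_between[of s a b x] 3 ab x assms(2) by simp
    next
      assume "a = 0 \<and> n - r \<le> b"
      then show False using assms 3 n_ge r by (auto simp: chord_def)
    qed
  qed
qed

lemma chord_if_no_points:
  assumes "a < b" "b < n" "\<And>x. x < n \<Longrightarrow> p x \<notin> open_segment (p a) (p b)"
  shows "chord a b"
proof (rule ccontr)
  assume nc: "\<not> chord a b"
  then have sw: "same_side r a b \<or> (a = 0 \<and> n - r \<le> b)" and ne: "b \<noteq> Suc a" "\<not> (a = 0 \<and> b = n - 1)"
    using assms by (auto simp: chord_def)
  from sw show False
  proof
    assume "same_side r a b"
    then obtain s where "s < k" "s * r \<le> a" "b \<le> Suc s * r" using same_side_less assms by (meson less_trans)
    then have "p (Suc a mod n) \<in> open_segment (p (a mod n)) (p (b mod n))"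
      using assms ne by (intro side_between[of s]) auto
    then show False using assms(3)[of "Suc a"] assms(1,2) by simp
  next
    assume *: "a = 0 \<and> n - r \<le> b"
    then have "p (Suc b mod n) \<in> open_segment (p (b mod n)) (p (n mod n))"
      using assms ne last_side k by (intro side_between[of "k - 1"]) auto
    moreover have "Suc b < n" using assms ne * by linarith
    ultimately show False using assms(3)[of "Suc b"] assms(1,2) * by (simp add: open_segment_commute)
  qed
qed

lemma chords_cross:
  assumes "chord a b" "chord c d" "a < c" "c < b" "b < d"
  shows "open_segment (p a) (p b) \<inter> open_segment (p c) (p d) \<noteq> {}"
proof (rule open_segments_cross)
  have ss: "same_side r x y" if "same_side r x' y'" "x' \<le> x" "y \<le> y'" for x x' y y'
    using that unfolding same_side_def by (meson le_trans)
  have d: "d < n" using assms by (auto simp: chord_def)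
  have 1: "\<not> same_side r a b" "\<not> (a = 0 \<and> n - r \<le> b)" using assms d by (auto simp: chord_def)
  have 2: "\<not> same_side r c d" using assms by (auto simp: chord_def)
  show "det3 (p a) (p c) (p b) > 0" using assms 1 d by (intro det3_pos) auto
  show "det3 (p a) (p b) (p d) > 0" using assms 1 d ss[of a d a b] by (intro det3_pos) auto
  show "det3 (p a) (p c) (p d) > 0" using assms 1 d ss[of a d a b] by (intro det3_pos) auto
  show "det3 (p c) (p b) (p d) > 0" using assms 2 d by (intro det3_pos) auto
qed

text \<open>Whether the chords follow each other or are nested, both ends of the second lie weakly
  on one side of the line through the first. A common inner point therefore puts all ends on that
  line, hence on one side of the polygon, where the order along the side excludes it.\<close>

lemma noncrossing_chords_disjoint_aux:
  assumes "chord a b" "chord c d" "b \<le> c \<or> (a \<le> c \<and> d \<le> b \<and> (a, b) \<noteq> (c, d))"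
  shows "open_segment (p a) (p b) \<inter> open_segment (p c) (p d) = {}"
proof (rule ccontr)
  assume "\<not> ?thesis"
  then obtain z where z: "z \<in> open_segment (p a) (p b)" "z \<in> open_segment (p c) (p d)" by blast
  have ab: "a < b" "b < n" and cd: "c < d" "d < n" using assms by (auto simp: chord_def)
  have d0: "det3 (p a) (p b) z = 0" using z(1) by simp
  from assms(3) show False
  proof
    assume bc: "b \<le> c"
    have "det3 (p a) (p b) (p d) = 0"
      using det3_open_segment_eq_0[OF z(2) d0] det3_nonneg[of a b c] det3_nonneg[of a b d] ab cd bc by auto
    then have "same_side r a d \<or> (a = 0 \<and> n - r \<le> b)"
      using det3_eq_0_iff[of a b d] ab cd bc by simp
    then show False
    proof
      assume "same_side r a d"
      then obtain s where "s < k" "s * r \<le> a" "d \<le> Suc s * r" using same_side_less ab by (meson less_trans)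
      then show False using side_disjoint[of s a b c d] ab cd bc z by auto
    next
      assume "a = 0 \<and> n - r \<le> b"
      then show False using assms(1) ab cd bc n_ge r by (auto simp: chord_def)
    qed
  next
    assume nest: "a \<le> c \<and> d \<le> b \<and> (a, b) \<noteq> (c, d)"
    have neg: "det3 (p a) (p b) (p x) \<le> 0" if "a \<le> x" "x \<le> b" for x
      using det3_nonneg[of a x b] that ab by (metis det3_rotate det3_swap neg_0_le_iff_le)
    have zero: "det3 (p a) (p b) (p c) = 0 \<and> det3 (p a) (p b) (p d) = 0"
      using det3_open_segment_eq_0[OF z(2) d0] neg[of c] neg[of d] nest cd by auto
    \<comment> \<open>An end of the second chord that is strictly inside the first one.\<close>
    define x where "x = (if a < c then c else d)"
    have x: "a < x" "x < b" using nest cd by (auto simp: x_def)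
    have "det3 (p a) (p x) (p b) = 0"
      using zero by (metis x_def det3_rotate det3_swap neg_0_equal_iff_equal)
    then have "same_side r a b \<or> (a = 0 \<and> n - r \<le> x)"
      using det3_eq_0_iff[of a x b] ab x by simp
    \<comment> \<open>Only the wrap-around edge can be collinear with a point between its indices;
      that point is on the last side.\<close>
    then have *: "a = 0" "b = n - 1" "n - r \<le> x"
      using assms(1) x not_same_side_ends n_ge r by (auto simp: chord_def)
    have "n - r \<le> c"
    proof (cases "a < c")
      case False
      then have "c = 0" "x = d" "d < n - 1" using nest * x by (auto simp: x_def)
      then show ?thesis using assms(2) * n_ge r by (auto simp: chord_def)
    qed (use * in \<open>auto simp: x_def\<close>)
    then show False
      using side_disjoint[of "k - 1" c d "n - 1" n] last_side k nest * cd n_ge z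
      by (auto simp: open_segment_commute)
  qed
qed

lemma noncrossing_chords_disjoint:
  assumes "chord a b" "chord c d" "(a, b) \<noteq> (c, d)"
    "\<not> (a < c \<and> c < b \<and> b < d)" "\<not> (c < a \<and> a < d \<and> d < b)"
  shows "open_segment (p a) (p b) \<inter> open_segment (p c) (p d) = {}"
proof -
  have "b \<le> c \<or> d \<le> a \<or> (a \<le> c \<and> d \<le> b) \<or> (c \<le> a \<and> b \<le> d)" using assms(4,5) by linarith
  then show ?thesis
    using noncrossing_chords_disjoint_aux[OF assms(1,2)] noncrossing_chords_disjoint_aux[OF assms(2,1)] assms(3)
    by (metis inf_commute)
qed

end

section \<open>Each chord set cuts the convex hull into triangles\<close>

section \<open>From chords to dissections\<close>

lemma sides_triangle:
  assumes "a \<noteq> b" "b \<noteq> c" "a \<noteq> c"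
  shows "sides {a, b, c} = {closed_segment a b, closed_segment b c, closed_segment a c}"
  using assms by (auto simp: sides_def closed_segment_commute)

context side_points
begin

abbreviation seg :: "nat \<times> nat \<Rightarrow> complex set" where
  "seg x \<equiv> closed_segment (p (fst x)) (p (snd x))"

lemma seg_inject:
  assumes "a < b" "b < n" "c < d" "d < n" "seg (a, b) = seg (c, d)"
  shows "(a, b) = (c, d)"
proof -
  have "{p a, p b} = {p c, p d}" using assms(5) by simp
  then show ?thesis using assms(1-4) by (auto simp: doubleton_eq_iff p_eq_iff)
qed

text \<open>The hull of a union of two convex sets consists of the segments between them, so the
  claim reduces to one segment from the left part to the right part, which
  \<open>segment_split\<close> divides.\<close>

lemma hull_split:
  assumes i: "a < i" "i < b" "b < n" and D: "det3 (p a) (p i) (p b) > 0"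
  shows "convex hull (p ` {a..b}) =
    convex hull (p ` {a..i}) \<union> convex hull {p a, p i, p b} \<union> convex hull (p ` {i..b})"
proof (intro equalityI subsetI)
  fix x assume "x \<in> convex hull (p ` {a..b})"
  moreover have "p ` {a..b} = p ` {a..i} \<union> p ` {i..b}"
    using i by (simp flip: image_Un add: ivl_disj_un)
  moreover have "p ` {a..i} \<union> p ` {i..b} \<subseteq> convex hull (p ` {a..i}) \<union> convex hull (p ` {i..b})"
    by (meson Un_mono hull_subset)
  ultimately have "x \<in> convex hull (convex hull (p ` {a..i}) \<union> convex hull (p ` {i..b}))"
    using hull_mono by (metis subsetD)
  then obtain u v y z where uv: "u \<ge> 0" "v \<ge> 0" "u + v = 1"
    and y: "y \<in> convex hull (p ` {a..i})" and z: "z \<in> convex hull (p ` {i..b})" and x: "x = u *\<^sub>R y + v *\<^sub>R z"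
    using i by (subst (asm) convex_hull_union_two) (auto simp del: Un_iff)
  have xs: "x \<in> closed_segment y z"
  proof -
    have "u = 1 - v" using uv by simp
    then show ?thesis using uv unfolding closed_segment_def x by (intro CollectI exI[of _ v]) simp
  qed
  have nn: "det3 (p b) (p a) (p c) \<ge> 0" if "a \<le> c" "c \<le> b" for c
    using det3_nonneg[of a c b] that i det3_rotate[of "p a" "p c" "p b"] by simp
  have 1: "det3 (p i) (p b) y \<ge> 0"
  proof (rule det3_convex_hull_nonneg[OF _ y])
    fix w assume "w \<in> p ` {a..i}"
    then obtain c where "w = p c" "a \<le> c" "c \<le> i" by auto
    then show "det3 (p i) (p b) w \<ge> 0" using det3_nonneg[of c i b] i det3_rotate[of "p i" "p b" "p c"] \<open>w = p c\<close> by simp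
  qed
  have 2: "det3 (p b) (p a) y \<ge> 0"
    by (rule det3_convex_hull_nonneg[OF _ y]) (use i nn in force)
  have 3: "det3 (p a) (p i) z \<ge> 0"
    by (rule det3_convex_hull_nonneg[OF _ z]) (use i det3_nonneg in force)
  have 4: "det3 (p b) (p a) z \<ge> 0"
    by (rule det3_convex_hull_nonneg[OF _ z]) (use i nn in force)
  \<comment> \<open>The line through \<open>p i\<close> and the next point supports the polygon at
    \<open>p i\<close>; this is the half plane that \<open>segment_split\<close> asks for.\<close>
  have q: "det3 (p i) (p (Suc i)) (p c) \<ge> 0" if "c \<le> b" for c
  proof (cases "c \<le> i")
    case True
    then show ?thesis using det3_nonneg[of c i "Suc i"] i det3_rotate[of "p i" "p (Suc i)" "p c"] by simp
  next
    case False
    then show ?thesis using det3_nonneg[of i "Suc i" c] i that by simp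
  qed
  have 5: "det3 (p i) (p (Suc i)) y \<ge> 0" "det3 (p i) (p (Suc i)) z \<ge> 0"
    by (rule det3_convex_hull_nonneg[OF _ y], use i q in force, rule det3_convex_hull_nonneg[OF _ z], use i q in force)
  have "p (Suc i) \<noteq> p i" using p_eq_iff[of i "Suc i"] i by auto
  from segment_split[OF D 1 2 3 4 this _ _ 5 xs] q[of a] q[of b] i
  consider "x \<in> convex hull {p a, p i, p b}" | w where "w \<in> closed_segment (p a) (p i)" "x \<in> closed_segment y w"
    | w where "w \<in> closed_segment (p i) (p b)" "x \<in> closed_segment w z"
    by (metis less_imp_le_nat less_trans order.refl)
  then show "x \<in> convex hull (p ` {a..i}) \<union> convex hull {p a, p i, p b} \<union> convex hull (p ` {i..b})"
  proof cases
    case (2 w)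
    have "closed_segment (p a) (p i) \<subseteq> convex hull (p ` {a..i})"
      unfolding segment_convex_hull by (rule hull_mono) (use i in auto)
    then show ?thesis using 2 y closed_segment_subset[of y _ w] convex_convex_hull by blast
  next
    case (3 w)
    have "closed_segment (p i) (p b) \<subseteq> convex hull (p ` {i..b})"
      unfolding segment_convex_hull by (rule hull_mono) (use i in auto)
    then show ?thesis using 3 z closed_segment_subset[of w _ z] convex_convex_hull by blast
  qed auto
next
  fix x assume "x \<in> convex hull (p ` {a..i}) \<union> convex hull {p a, p i, p b} \<union> convex hull (p ` {i..b})"
  moreover have "convex hull (p ` {a..i}) \<subseteq> convex hull (p ` {a..b})"
    "convex hull {p a, p i, p b} \<subseteq> convex hull (p ` {a..b})"
    "convex hull (p ` {i..b}) \<subseteq> convex hull (p ` {a..b})"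
    by (rule hull_mono; use i in force)+
  ultimately show "x \<in> convex hull (p ` {a..b})" by blast
qed

text \<open>The segment from \<open>a\<close> to \<open>b\<close> is added to the cover and to the
  sides so that the degenerate polygon with \<open>b = Suc a\<close> fits in with no triangles at
  all.\<close>

definition dissects :: "nat \<Rightarrow> nat \<Rightarrow> (nat \<times> nat) set \<Rightarrow> complex set set \<Rightarrow> bool" where
  "dissects a b S \<T> \<longleftrightarrow> \<T> \<subseteq> triangles (p ` {a..b}) \<and>
     convex hull (p ` {a..b}) = seg (a, b) \<union> (\<Union>T\<in>\<T>. convex hull T) \<and>
     pairwise (\<lambda>T T'. interior (convex hull T) \<inter> interior (convex hull T') = {}) \<T> \<and>
     seg ` S = insert (seg (a, b)) (\<Union>T\<in>\<T>. sides T)"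

lemma triangle_points: "T \<in> triangles (p ` A) \<Longrightarrow> x \<in> T \<Longrightarrow> \<exists>c\<in>A. x = p c"
  by (auto simp: triangles_def)

lemma triangles_mono: "A \<subseteq> B \<Longrightarrow> triangles A \<subseteq> triangles B"
  by (auto simp: triangles_def)

text \<open>The line through \<open>p a\<close> and \<open>p i\<close> separates the left part from
  everything else, and the line through \<open>p i\<close> and \<open>p b\<close> separates the new
  triangle from the right part.\<close>

lemma dissects_combine:
  assumes i: "a < i" "i < b" "b < n" and D: "det3 (p a) (p i) (p b) > 0"
    and 1: "dissects a i S1 \<T>1" and 2: "dissects i b S2 \<T>2"
  shows "dissects a b (insert (a, b) (S1 \<union> S2)) (insert {p a, p i, p b} (\<T>1 \<union> \<T>2))"
proof -
  let ?T = "{p a, p i, p b}"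
  have t1: "\<T>1 \<subseteq> triangles (p ` {a..i})" and t2: "\<T>2 \<subseteq> triangles (p ` {i..b})"
    using 1 2 by (auto simp: dissects_def)
  have "?T \<in> triangles (p ` {a..b})"
    using i D unfolding triangles_def by (intro CollectI exI[of _ "p a"] exI[of _ "p i"] exI[of _ "p b"])
      (auto simp: collinear_iff_det3)
  moreover have "triangles (p ` {a..i}) \<subseteq> triangles (p ` {a..b})" "triangles (p ` {i..b}) \<subseteq> triangles (p ` {a..b})"
    using i by (intro triangles_mono image_mono; auto)+
  ultimately have A: "insert ?T (\<T>1 \<union> \<T>2) \<subseteq> triangles (p ` {a..b})"
    using t1 t2 by blast
  have sub: "seg (a, i) \<subseteq> convex hull ?T" "seg (i, b) \<subseteq> convex hull ?T" "seg (a, b) \<subseteq> convex hull ?T"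
    by (simp add: segment_convex_hull, rule hull_mono, force)+
  have "convex hull (p ` {a..b}) = (seg (a, i) \<union> (\<Union>T\<in>\<T>1. convex hull T)) \<union> convex hull ?T \<union> (seg (i, b) \<union> (\<Union>T\<in>\<T>2. convex hull T))"
    using hull_split[OF i D] 1 2 unfolding dissects_def by argo
  also have "\<dots> = seg (a, b) \<union> (\<Union>T\<in>insert ?T (\<T>1 \<union> \<T>2). convex hull T)"
    using sub by auto
  finally have B: "convex hull (p ` {a..b}) = seg (a, b) \<union> (\<Union>T\<in>insert ?T (\<T>1 \<union> \<T>2). convex hull T)" .
  have ne: "p a \<noteq> p i" "p i \<noteq> p b" "p a \<noteq> p b" using i p_eq_iff by auto
  have nonpos: "det3 (p a) (p i) (p c) \<le> 0" if "c \<in> {a..i}" for c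
    using det3_nonneg[of a c i] that i det3_flip[of "p a" "p i" "p c"] by simp
  have nonneg: "det3 (p a) (p i) (p c) \<ge> 0" if "c \<in> {i..b}" for c
    using det3_nonneg[of a i c] that i by simp
  have nonpos': "det3 (p i) (p b) (p c) \<le> 0" if "c \<in> {i..b}" for c
    using det3_nonneg[of i c b] that i det3_flip[of "p i" "p b" "p c"] by simp
  have d1: "interior (convex hull T) \<inter> interior (convex hull T') = {}" if "T \<in> \<T>1" "T' \<in> insert ?T \<T>2" for T T'
  proof (rule interior_separated[OF ne(1)])
    show "det3 (p a) (p i) x \<le> 0" if "x \<in> T" for x
      using triangle_points[of T _ x] t1 \<open>T \<in> \<T>1\<close> that nonpos by blast
    show "det3 (p a) (p i) y \<ge> 0" if "y \<in> T'" for y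
    proof (cases "T' = ?T")
      case True
      then show ?thesis using that D by auto
    next
      case False
      then show ?thesis
        using triangle_points[of T' _ y] t2 \<open>T' \<in> insert ?T \<T>2\<close> that nonneg by blast
    qed
  qed
  have d2: "interior (convex hull T) \<inter> interior (convex hull ?T) = {}" if "T \<in> \<T>2" for T
  proof (rule interior_separated[OF ne(2)])
    show "det3 (p i) (p b) x \<le> 0" if "x \<in> T" for x
      using triangle_points[of T _ x] t2 \<open>T \<in> \<T>2\<close> that nonpos' by blast
    show "det3 (p i) (p b) y \<ge> 0" if "y \<in> ?T" for y
      using that D det3_rotate[of "p i" "p b" "p a"] by auto
  qed
  have C: "pairwise (\<lambda>T T'. interior (convex hull T) \<inter> interior (convex hull T') = {}) (insert ?T (\<T>1 \<union> \<T>2))"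
    using 1 2 d1 d2 unfolding dissects_def pairwise_def by (metis (no_types, lifting) Int_commute UnE insert_iff)
  have "seg ` insert (a, b) (S1 \<union> S2) = insert (seg (a, b)) (seg ` S1 \<union> seg ` S2)" by auto
  also have "\<dots> = insert (seg (a, b)) (insert (seg (a, i)) (\<Union>T\<in>\<T>1. sides T) \<union> insert (seg (i, b)) (\<Union>T\<in>\<T>2. sides T))"
    using 1 2 unfolding dissects_def by argo
  also have "\<dots> = insert (seg (a, b)) (\<Union>T\<in>insert ?T (\<T>1 \<union> \<T>2). sides T)"
    using sides_triangle[OF ne(1,2,3)] by auto
  finally show ?thesis using A B C unfolding dissects_def by blast
qed

lemma tri_dissects:
  assumes "tri r a b S" "b < n" "a > 0 \<or> b < n - r"
  shows "\<exists>\<T>. dissects a b S \<T>"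
  using assms
proof (induction rule: tri.induct)
  case (tri_edge a)
  have "{a..Suc a} = {a, Suc a}" by auto
  then have "dissects a (Suc a) {(a, Suc a)} {}"
    by (simp add: dissects_def segment_convex_hull)
  then show ?case by blast
next
  case (tri_node a i b S S')
  obtain \<T>1 \<T>2 where "dissects a i S \<T>1" "dissects i b S' \<T>2"
    using tri_node by fastforce
  moreover have "det3 (p a) (p i) (p b) > 0"
    using tri_node by (intro det3_pos) auto
  ultimately show ?case using dissects_combine[of a i b] tri_node by blast
qed

lemma tri_is_chord:
  assumes "tri r a b S" "b < n" "a > 0 \<or> b < n - r" "(x, y) \<in> S"
  shows "chord x y"
  using tri_range[OF assms(1,4)] tri_chord[OF assms(1,4)] assms(2,3) by (auto simp: chord_def)

text \<open>The outermost step is not an instance of \<open>tri_node\<close>: an apex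
  \<open>i \<ge> n - r\<close> would lie on the last side together with \<open>0\<close> and
  \<open>n - 1\<close>, and \<open>same_side\<close> does not notice this. Therefore the apex is
  bounded by \<open>n - r\<close> here.\<close>

definition tris :: "(nat \<times> nat) set set" where
  "tris = (\<Union>i\<in>{0<..<n - r}. (\<lambda>(S, S'). insert (0, n - 1) (S \<union> S')) `
     ({S. tri r 0 i S} \<times> {S. tri r i (n - 1) S}))"

lemma trisI:
  "0 < i \<Longrightarrow> i < n - r \<Longrightarrow> tri r 0 i S1 \<Longrightarrow> tri r i (n - 1) S2 \<Longrightarrow> insert (0, n - 1) (S1 \<union> S2) \<in> tris"
  unfolding tris_def by (intro UN_I[of i] image_eqI[of _ _ "(S1, S2)"]) auto

lemma trisE:
  assumes "S \<in> tris"
  obtains i S1 S2 where "0 < i" "i < n - r" "tri r 0 i S1" "tri r i (n - 1) S2" "S = insert (0, n - 1) (S1 \<union> S2)"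
  using assms unfolding tris_def by auto

lemma tris_chord:
  assumes "S \<in> tris" "(x, y) \<in> S"
  shows "chord x y"
  using assms(1)
proof (cases rule: trisE)
  case (1 i S1 S2)
  have "chord 0 (n - 1)" using n_ge by (auto simp: chord_def)
  then show ?thesis
    using 1 assms(2) tri_is_chord[of 0 i S1 x y] tri_is_chord[of i "n - 1" S2 x y] n_ge by auto
qed

lemma tris_noncrossing:
  assumes "S \<in> tris" "(x, y) \<in> S" "(x', y') \<in> S"
  shows "\<not> (x < x' \<and> x' < y \<and> y < y')"
  using assms(1)
proof (cases rule: trisE)
  case (1 i S1 S2)
  have S1: "x < y \<and> y \<le> i" if "(x, y) \<in> S1" for x y using tri_range[OF 1(3) that] by simp
  have S2: "i \<le> x \<and> x < y \<and> y \<le> n - 1" if "(x, y) \<in> S2" for x y using tri_range[OF 1(4) that] by simp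
  show ?thesis
    using assms(2,3) 1 S1[of x y] S1[of x' y'] S2[of x y] S2[of x' y']
      tri_noncrossing[OF 1(3), of x y x' y'] tri_noncrossing[OF 1(4), of x y x' y'] by auto
qed

lemma P_eq: "p ` {..<n} = p ` {0..n - 1}"
  using n_ge by (intro arg_cong[of _ _ "image p"]) auto

lemma seg_rel_interior: "chord a b \<Longrightarrow> rel_interior (seg (a, b)) = open_segment (p a) (p b)"
  using p_eq_iff[of a b] by (auto simp: rel_interior_closed_segment chord_def)

lemma tris_dissection:
  assumes "S \<in> tris"
  shows "triangle_dissection (p ` {..<n}) (seg ` S)"
  using assms
proof (cases rule: trisE)
  case (1 i S1 S2)
  obtain \<T>1 \<T>2 where d: "dissects 0 i S1 \<T>1" "dissects i (n - 1) S2 \<T>2"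
  proof -
    have "i < n" "n - 1 < n" using 1(2) n_ge by auto
    then show ?thesis using that tri_dissects[OF 1(3)] tri_dissects[OF 1(4)] 1(1,2) by blast
  qed
  have D: "det3 (p 0) (p i) (p (n - 1)) > 0"
    using 1(1,2) n_ge not_same_side_ends r by (intro det3_pos) auto
  let ?\<T> = "insert {p 0, p i, p (n - 1)} (\<T>1 \<union> \<T>2)"
  have "i < n - 1" "n - 1 < n" using 1(2) n_ge r by auto
  then have dd: "dissects 0 (n - 1) S ?\<T>"
    using dissects_combine[OF 1(1) _ _ D d] 1(5) by simp
  have ne: "p 0 \<noteq> p i" "p i \<noteq> p (n - 1)" "p 0 \<noteq> p (n - 1)" using 1(1) \<open>i < n - 1\<close> n_ge p_eq_iff by auto
  have "seg (0, n - 1) \<in> sides {p 0, p i, p (n - 1)}" using sides_triangle[OF ne(1,2,3)] by simp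
  moreover have "seg (0, n - 1) \<subseteq> convex hull {p 0, p i, p (n - 1)}"
    by (simp add: segment_convex_hull, rule hull_mono, force)
  \<comment> \<open>The edge from \<open>0\<close> to \<open>n - 1\<close> is a side of the
    outermost triangle, so the terms that \<open>dissects\<close> adds for the degenerate case
    disappear.\<close>
  ultimately have absorb: "insert (seg (0, n - 1)) (\<Union>T\<in>?\<T>. sides T) = (\<Union>T\<in>?\<T>. sides T)"
    "seg (0, n - 1) \<union> (\<Union>T\<in>?\<T>. convex hull T) = (\<Union>T\<in>?\<T>. convex hull T)"
    by (intro insert_absorb Un_absorb1; auto)+
  note X = dd[unfolded dissects_def absorb, folded P_eq]
  have Y: "pairwise (\<lambda>s s'. rel_interior s \<inter> rel_interior s' = {}) (seg ` S)"
  proof (rule pairwiseI)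
    fix s s' assume "s \<in> seg ` S" "s' \<in> seg ` S" "s \<noteq> s'"
    then obtain e e' where e: "s = seg e" "s' = seg e'" "e \<in> S" "e' \<in> S" "e \<noteq> e'" by blast
    obtain a b c d where ed: "e = (a, b)" "e' = (c, d)" by fastforce
    have "chord a b" "chord c d" using tris_chord[OF assms] e(3,4) ed by auto
    moreover have "\<not> (a < c \<and> c < b \<and> b < d)" "\<not> (c < a \<and> a < d \<and> d < b)"
      using tris_noncrossing[OF assms] e(3,4) ed by blast+
    ultimately have "open_segment (p a) (p b) \<inter> open_segment (p c) (p d) = {}"
      using noncrossing_chords_disjoint[of a b c d] e(5) ed by blast
    then show "rel_interior s \<inter> rel_interior s' = {}"
      using seg_rel_interior[OF \<open>chord a b\<close>] seg_rel_interior[OF \<open>chord c d\<close>]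
      unfolding e(1,2) ed by simp
  qed
  have Z: "\<forall>s\<in>seg ` S. rel_interior s \<inter> p ` {..<n} = {}"
  proof
    fix s assume "s \<in> seg ` S"
    then obtain a b where s: "s = seg (a, b)" "(a, b) \<in> S" by fastforce
    then have "chord a b" using tris_chord[OF assms] by simp
    then show "rel_interior s \<inter> p ` {..<n} = {}"
      using chord_no_points[of a b] seg_rel_interior[of a b] s(1) by auto
  qed
  show ?thesis unfolding triangle_dissection_def
    by (intro conjI Y Z exI[of _ ?\<T>]) (use X in simp_all)
qed

end

section \<open>Each dissection comes from a chord set; finding the triangle below a chord\<close>

section \<open>From dissections to chords\<close>

context side_points
begin

lemma triangle_indices:
  assumes "T \<in> triangles (p ` {..<n})"
  obtains x y z where "x < y" "y < z" "z < n" "T = {p x, p y, p z}" "det3 (p x) (p y) (p z) > 0"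
proof -
  obtain a b c where abc: "a < n" "b < n" "c < n" "T = {p a, p b, p c}" "\<not> collinear {p a, p b, p c}"
    using assms unfolding triangles_def by blast
  have "a \<noteq> b" "b \<noteq> c" "a \<noteq> c" using abc(5) by (auto simp: collinear_iff_det3)
  then consider "a < b \<and> b < c" | "a < c \<and> c < b" | "b < a \<and> a < c" | "b < c \<and> c < a" | "c < a \<and> a < b" | "c < b \<and> b < a"
    by linarith
  then have "\<exists>x y z. x < y \<and> y < z \<and> z < n \<and> {a, b, c} = {x, y, z}"
  proof cases
    case 1
    then show ?thesis using abc(3) by blast
  next
    case 2
    then show ?thesis using abc(2) by (intro exI[of _ a] exI[of _ c] exI[of _ b]) auto
  next
    case 3
    then show ?thesis using abc(3) by (intro exI[of _ b] exI[of _ a] exI[of _ c]) auto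
  next
    case 4
    then show ?thesis using abc(1) by (intro exI[of _ b] exI[of _ c] exI[of _ a]) auto
  next
    case 5
    then show ?thesis using abc(2) by (intro exI[of _ c] exI[of _ a] exI[of _ b]) auto
  next
    case 6
    then show ?thesis using abc(1) by (intro exI[of _ c] exI[of _ b] exI[of _ a]) auto
  qed
  then obtain x y z where xyz: "x < y" "y < z" "z < n" "{a, b, c} = {x, y, z}" by blast
  have "T = p ` {a, b, c}" using abc by simp
  also have "\<dots> = {p x, p y, p z}" by (simp add: xyz)
  finally have T: "T = {p x, p y, p z}" .
  moreover have "det3 (p x) (p y) (p z) \<noteq> 0"
    using abc(4,5) T collinear_iff_det3 by metis
  ultimately show ?thesis using that[of x y z] xyz det3_nonneg[of x y z] by fastforce
qed

lemma sides_indices: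
  assumes "x < y" "y < z" "z < n"
  shows "sides {p x, p y, p z} = {seg (x, y), seg (y, z), seg (x, z)}"
  using assms by (subst sides_triangle) (auto simp: p_eq_iff)

end

locale dissected_side_points = side_points +
  fixes S \<T>
  assumes tri: "\<T> \<subseteq> triangles (p ` {..<n})"
    and cover: "convex hull (p ` {..<n}) = (\<Union>T\<in>\<T>. convex hull T)"
    and S: "S = (\<Union>T\<in>\<T>. sides T)"
    and disjoint: "pairwise (\<lambda>s s'. rel_interior s \<inter> rel_interior s' = {}) S"
    and no_points: "\<forall>s\<in>S. rel_interior s \<inter> p ` {..<n} = {}"
begin

definition chords :: "(nat \<times> nat) set" where
  "chords = {(a, b). a < b \<and> b < n \<and> seg (a, b) \<in> S}"

lemma triangle_chords:
  assumes "{p x, p y, p z} \<in> \<T>" "x < y" "y < z" "z < n"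
  shows "(x, y) \<in> chords" "(y, z) \<in> chords" "(x, z) \<in> chords"
proof -
  have "{seg (x, y), seg (y, z), seg (x, z)} \<subseteq> S"
    using S sides_indices[OF assms(2-4)] assms(1) by blast
  then show "(x, y) \<in> chords" "(y, z) \<in> chords" "(x, z) \<in> chords"
    using assms(2-4) by (auto simp: chords_def)
qed

lemma S_eq: "S = seg ` chords"
proof (intro equalityI subsetI)
  fix s assume "s \<in> S"
  then obtain T where T: "T \<in> \<T>" "s \<in> sides T" by (auto simp: S)
  then obtain x y z where xyz: "x < y" "y < z" "z < n" "T = {p x, p y, p z}"
    using triangle_indices tri by (metis subsetD)
  have "s \<in> {seg (x, y), seg (y, z), seg (x, z)}" using T(2) xyz sides_indices by simp
  then show "s \<in> seg ` chords" using triangle_chords[of x y z] T(1) xyz by blast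
qed (auto simp: chords_def)

lemma chords_chord:
  assumes "(a, b) \<in> chords"
  shows "chord a b"
proof -
  have ab: "a < b" "b < n" "seg (a, b) \<in> S" using assms by (auto simp: chords_def)
  have "p a \<noteq> p b" using ab p_eq_iff by simp
  then have "rel_interior (seg (a, b)) = open_segment (p a) (p b)"
    by (simp add: rel_interior_closed_segment)
  then show ?thesis using ab no_points by (intro chord_if_no_points) auto
qed

lemma chords_noncrossing:
  assumes "(a, b) \<in> chords" "(c, d) \<in> chords" "a < c" "c < b"
  shows "d \<le> b"
proof (rule ccontr)
  assume "\<not> d \<le> b"
  then have ne: "open_segment (p a) (p b) \<inter> open_segment (p c) (p d) \<noteq> {}"
    using chords_cross chords_chord assms by simp
  have "seg (a, b) \<noteq> seg (c, d)"
    using seg_inject[of a b c d] assms by (auto simp: chords_def)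
  then have "rel_interior (seg (a, b)) \<inter> rel_interior (seg (c, d)) = {}"
    using disjoint assms unfolding chords_def pairwise_def by blast
  with ne show False
    using assms seg_rel_interior chords_chord by metis
qed

lemma finite_\<T>: "finite \<T>"
proof (rule finite_subset[OF tri])
  have "triangles (p ` {..<n}) \<subseteq> Pow (p ` {..<n})" by (auto simp: triangles_def)
  then show "finite (triangles (p ` {..<n}))" by (rule finite_subset) simp
qed

text \<open>A vertex strictly between \<open>a\<close> and \<open>b\<close> and a vertex beyond them
  would be joined by a side of the triangle that crosses the chord.\<close>

lemma triangle_on_one_side:
  assumes "(a, b) \<in> chords" "{p x, p y, p z} \<in> \<T>" "x < y" "y < z" "z < n"
  shows "a \<le> x \<and> z \<le> b \<or> (\<forall>c\<in>{x, y, z}. c \<le> a \<or> b \<le> c)"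
proof -
  note c = triangle_chords[OF assms(2-5)]
  have ab: "a < b" using assms(1) by (simp add: chords_def)
  show ?thesis
  proof (rule ccontr)
    assume nt: "\<not> ?thesis"
    then obtain c where c: "c \<in> {x, y, z}" "a < c" "c < b" by force
    have "\<not> x < a"
    proof
      assume "x < a"
      then have "(x, c) \<in> chords" using c \<open>(x, y) \<in> chords\<close> \<open>(x, z) \<in> chords\<close> by auto
      then show False using chords_noncrossing[of x c a b] assms(1) \<open>x < a\<close> c by simp
    qed
    moreover have "\<not> b < z"
    proof
      assume "b < z"
      then have "(c, z) \<in> chords" using c \<open>(y, z) \<in> chords\<close> \<open>(x, z) \<in> chords\<close> by auto
      then show False using chords_noncrossing[of a b c z] assms(1) \<open>b < z\<close> c by simp
    qed
    ultimately show False using nt by simp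
  qed
qed

lemma midpoint_between:
  assumes "chord a b"
  shows "midpoint (p a) (p b) \<in> open_segment (p a) (p b)"
  using p_eq_iff[of a b] assms by (simp add: midpoint_in_open_segment chord_def)

lemma det3_midpoint_triangle:
  assumes "m \<in> convex hull {p x, p y, p z}"
  obtains u v w where "u \<ge> 0" "v \<ge> 0" "w \<ge> 0" "u + v + w = 1" "m = u *\<^sub>R p x + v *\<^sub>R p y + w *\<^sub>R p z"
  using assms unfolding convex_hull_3 by blast

text \<open>A triangle covering the midpoint \<open>m\<close> of the chord might lie on the wrong
  side of it, so \<open>m\<close> is approached from the correct side. Points close to
  \<open>m\<close> there are covered by triangles with vertices among \<open>a, ..., b\<close>;
  these are finitely many closed sets, so one of them contains \<open>m\<close>. Since only
  \<open>a\<close> and \<open>b\<close> are on the line of the chord, both must be vertices.\<close>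

lemma triangle_at_chord:
  assumes ab: "(a, b) \<in> chords" "b \<noteq> Suc a" "\<not> (a = 0 \<and> b = n - 1)"
  shows "\<exists>i. a < i \<and> i < b \<and> {p a, p i, p b} \<in> \<T>"
proof -
  have ab': "a < b" "b < n" using ab by (auto simp: chords_def)
  \<comment> \<open>Any vertex strictly between \<open>a\<close> and \<open>b\<close> would do as
    the direction of approach.\<close>
  define j where "j = Suc a"
  have j: "a < j" "j < b" using ab ab' by (auto simp: j_def)
  define m where "m = midpoint (p a) (p b)"
  have mo: "m \<in> open_segment (p a) (p b)" unfolding m_def by (rule midpoint_between[OF chords_chord[OF ab(1)]])
  then have m0: "det3 (p a) (p b) m = 0" by simp
  have neg: "det3 (p a) (p b) (p i) < 0" if "a < i" "i < b" for i
    using chord_det3_pos[OF chords_chord[OF ab(1)] that ab(3)] by (simp add: det3_flip[of "p a" "p b" "p i"])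
  have pos: "det3 (p a) (p b) (p c) \<ge> 0" if "c \<le> a \<or> b \<le> c" "c < n" for c
    using that det3_nonneg[of c a b] det3_nonneg[of a b c] ab' by (auto simp: det3_rotate)
  define \<T>' where "\<T>' = {T \<in> \<T>. T \<subseteq> p ` {a..b}}"
  define U where "U = (\<Union>T\<in>\<T>'. convex hull T)"
  have "closed U"
    unfolding U_def
  proof (rule closed_UN)
    show "finite \<T>'" using finite_\<T> by (simp add: \<T>'_def)
    show "\<forall>T\<in>\<T>'. closed (convex hull T)"
      by (intro ballI compact_imp_closed compact_convex_hull finite_imp_compact)
         (auto simp: \<T>'_def intro: finite_subset)
  qed
  \<comment> \<open>Strictly below the chord, a covering triangle cannot have all its vertices on
    the other side, so all of them are between \<open>a\<close> and \<open>b\<close>.\<close>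
  have "open_segment m (p j) \<subseteq> U"
  proof
    fix q assume q: "q \<in> open_segment m (p j)"
    then obtain t where t: "0 < t" "t < 1" "q = (1 - t) *\<^sub>R m + t *\<^sub>R p j"
      by (auto simp: in_segment)
    then have qneg: "det3 (p a) (p b) q < 0"
      using m0 neg[OF j] by (simp add: det3_affine mult_less_0_iff)
    have "p a \<in> convex hull (p ` {..<n})" "p b \<in> convex hull (p ` {..<n})" "p j \<in> convex hull (p ` {..<n})"
      using ab' j by (auto intro!: hull_inc)
    moreover have "m \<in> closed_segment (p a) (p b)" using mo open_closed_segment by blast
    ultimately have "m \<in> convex hull (p ` {..<n})"
      using closed_segment_subset[of "p a" "convex hull (p ` {..<n})" "p b"] convex_convex_hull by blast
    then have "q \<in> convex hull (p ` {..<n})"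
      using closed_segment_subset[of m "convex hull (p ` {..<n})" "p j"] q open_closed_segment
        \<open>p j \<in> _\<close> convex_convex_hull by blast
    then obtain T where T: "T \<in> \<T>" "q \<in> convex hull T" unfolding cover by blast
    obtain x y z where xyz: "x < y" "y < z" "z < n" "T = {p x, p y, p z}"
      using triangle_indices tri T(1) by (metis subsetD)
    have "a \<le> x \<and> z \<le> b"
    proof (rule ccontr)
      assume "\<not> ?thesis"
      then have "\<forall>c\<in>{x, y, z}. c \<le> a \<or> b \<le> c"
        using triangle_on_one_side[OF ab(1)] T(1) xyz by blast
      then have "det3 (p a) (p b) c \<ge> 0" if "c \<in> T" for c
        using that xyz pos by auto
      from det3_convex_hull_nonneg[OF this T(2)] qneg show False by simp
    qed
    then have "T \<in> \<T>'" using T(1) xyz by (auto simp: \<T>'_def)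
    then show "q \<in> U" using T(2) by (auto simp: U_def)
  qed
  then have "closure (open_segment m (p j)) \<subseteq> U"
    using \<open>closed U\<close> by (rule closure_minimal)
  moreover have "m \<noteq> p j" using m0 neg[OF j] by auto
  then have "closure (open_segment m (p j)) = closed_segment m (p j)" by simp
  ultimately have "m \<in> U" by auto
  then obtain T where T: "T \<in> \<T>" "T \<subseteq> p ` {a..b}" "m \<in> convex hull T" by (auto simp: U_def \<T>'_def)
  obtain x y z where xyz: "x < y" "y < z" "z < n" "T = {p x, p y, p z}"
    using triangle_indices tri T(1) by (metis subsetD)
  have r: "c \<in> {a..b}" if "c < n" "p c \<in> T" for c
  proof -
    have "p c \<in> p ` {a..b}" using T(2) that(2) by (rule subsetD)
    then obtain c' where "c' \<in> {a..b}" "p c = p c'" by blast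
    then show ?thesis using p_eq_iff[of c c'] that ab' by auto
  qed
  have ax: "a \<le> x" "z \<le> b" using r[of x] r[of z] xyz by auto
  obtain u v w where uvw: "u \<ge> 0" "v \<ge> 0" "w \<ge> 0" "u + v + w = 1" "m = u *\<^sub>R p x + v *\<^sub>R p y + w *\<^sub>R p z"
    using T(3) xyz(4) det3_midpoint_triangle by metis
  have np: "det3 (p a) (p b) (p c) \<le> 0" if "a \<le> c" "c \<le> b" for c
    using neg[of c] that by (cases "c = a \<or> c = b") auto
  \<comment> \<open>Barycentric weights of \<open>m\<close>: three terms of the same sign add up to
    zero, so a vertex off the line has weight zero. The middle vertex is off the line, and
    \<open>m\<close> is not itself a vertex.\<close>
  have sum0: "u * det3 (p a) (p b) (p x) + v * det3 (p a) (p b) (p y) + w * det3 (p a) (p b) (p z) = 0"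
    using m0 uvw by (simp add: det3_affine3)
  have each: "u * det3 (p a) (p b) (p x) \<le> 0" "v * det3 (p a) (p b) (p y) \<le> 0" "w * det3 (p a) (p b) (p z) \<le> 0"
    using np[of x] np[of y] np[of z] uvw ax xyz by (auto simp: mult_le_0_iff)
  have "v * det3 (p a) (p b) (p y) = 0" using each sum0 by linarith
  moreover have "det3 (p a) (p b) (p y) < 0" using ax xyz by (intro neg) auto
  ultimately have "v = 0" by simp
  have mne: "m \<noteq> p c" if "c < n" for c
    using chord_no_points[OF chords_chord[OF ab(1)] that] mo by auto
  have "u \<noteq> 0" using mne[of z] uvw xyz \<open>v = 0\<close> by auto
  have "w \<noteq> 0" using mne[of x] uvw xyz \<open>v = 0\<close> by auto
  have "x = a"
  proof (rule ccontr)
    assume "x \<noteq> a"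
    then have "det3 (p a) (p b) (p x) < 0" using neg[of x] ax xyz by simp
    moreover have "u * det3 (p a) (p b) (p x) = 0" using each sum0 by linarith
    ultimately show False using \<open>u \<noteq> 0\<close> by simp
  qed
  moreover have "z = b"
  proof (rule ccontr)
    assume "z \<noteq> b"
    then have "det3 (p a) (p b) (p z) < 0" using neg[of z] ax xyz by simp
    moreover have "w * det3 (p a) (p b) (p z) = 0" using each sum0 by linarith
    ultimately show False using \<open>w \<noteq> 0\<close> by simp
  qed
  ultimately show ?thesis using T(1) xyz by blast
qed

text \<open>All points lie weakly on one side of the edge from \<open>0\<close> to
  \<open>n - 1\<close>, so every triangle covering its midpoint is on the correct side and no limit
  is required. The difficulty is that the whole last side is on the line of this edge: a triangle
  with two vertices there has to be ruled out.\<close>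

lemma triangle_at_base: "\<exists>i. 0 < i \<and> i < n - r \<and> {p 0, p i, p (n - 1)} \<in> \<T>"
proof -
  let ?f = "det3 (p 0) (p (n - 1))"
  have ch: "chord 0 (n - 1)" using n_ge by (auto simp: chord_def)
  define m where "m = midpoint (p 0) (p (n - 1))"
  have mo: "m \<in> open_segment (p 0) (p (n - 1))" unfolding m_def by (rule midpoint_between[OF ch])
  then have m0: "?f m = 0" by simp
  have mne: "m \<noteq> p c" if "c < n" for c
    using chord_no_points[OF ch that] mo by auto
  have "p 0 \<in> convex hull (p ` {..<n})" "p (n - 1) \<in> convex hull (p ` {..<n})"
    using n_ge by (auto intro!: hull_inc)
  then have "m \<in> convex hull (p ` {..<n})"
    using closed_segment_subset[of "p 0" "convex hull (p ` {..<n})" "p (n - 1)"] convex_convex_hull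
      open_closed_segment[OF mo] by blast
  then obtain T where T: "T \<in> \<T>" "m \<in> convex hull T" unfolding cover by blast
  obtain x y z where xyz: "x < y" "y < z" "z < n" "T = {p x, p y, p z}" "det3 (p x) (p y) (p z) > 0"
    using triangle_indices tri T(1) by (metis subsetD)
  obtain u v w where uvw: "u \<ge> 0" "v \<ge> 0" "w \<ge> 0" "u + v + w = 1" "m = u *\<^sub>R p x + v *\<^sub>R p y + w *\<^sub>R p z"
    using T(2) xyz(4) det3_midpoint_triangle by metis
  have neg: "?f (p c) < 0" if "0 < c" "c < n - r" for c
  proof -
    have "det3 (p 0) (p c) (p (n - 1)) > 0"
      using that not_same_side_ends r n_ge by (intro det3_pos) auto
    then show ?thesis using det3_flip[of "p 0" "p (n - 1)" "p c"] by linarith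
  qed
  have np: "?f (p c) \<le> 0" if "c < n" for c
    using det3_nonneg[of 0 c "n - 1"] that n_ge det3_flip[of "p 0" "p (n - 1)" "p c"] by linarith
  have sum0: "u * ?f (p x) + v * ?f (p y) + w * ?f (p z) = 0"
    using m0 uvw by (simp add: det3_affine3)
  have each: "u * ?f (p x) \<le> 0" "v * ?f (p y) \<le> 0" "w * ?f (p z) \<le> 0"
    using np[of x] np[of y] np[of z] uvw xyz by (auto simp: mult_le_0_iff)
  then have "u * ?f (p x) = 0" "v * ?f (p y) = 0" "w * ?f (p z) = 0" using sum0 by linarith+
  then have zero: "u = 0 \<or> \<not> (0 < x \<and> x < n - r)" "v = 0 \<or> \<not> (0 < y \<and> y < n - r)" "w = 0 \<or> \<not> (0 < z \<and> z < n - r)"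
    using neg[of x] neg[of y] neg[of z] by auto
  note c = triangle_chords[OF _ xyz(1-3)]
  have cc: "chord x y" "chord y z" "chord x z" using c T(1) xyz(4) chords_chord by auto
  \<comment> \<open>On the last side, segments among the points up to \<open>n - 1\<close> do not
    reach into the open segment from \<open>p (n - 1)\<close> to \<open>p 0\<close>.\<close>
  have lastseg: "m \<notin> closed_segment (p s) (p t)" if "n - r \<le> s" "s < t" "t < n" for s t
  proof
    assume "m \<in> closed_segment (p s) (p t)"
    then have "m \<in> open_segment (p s) (p t)" using mne that by (auto simp: open_segment_def)
    moreover have "open_segment (p (s mod n)) (p (t mod n)) \<inter> open_segment (p ((n - 1) mod n)) (p (n mod n)) = {}"
      using last_side k that n_ge by (intro side_disjoint[of "k - 1"]) auto
    ultimately show False using that mo n_ge by (auto simp: open_segment_commute)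
  qed
  have "y < n - r"
  proof (rule ccontr)
    assume y: "\<not> y < n - r"
    have ss: "\<not> same_side r x z" "x \<noteq> 0"
      using det3_eq_0_iff[of x y z] xyz y by auto
    have "x < n - r"
    proof (rule ccontr)
      assume "\<not> x < n - r"
      then have "same_side r x z" unfolding same_side_def
        using last_side xyz by (intro exI[of _ "k - 1"]) auto
      then show False using ss by simp
    qed
    then have "u = 0" using zero(1) ss by simp
    then have "m \<in> closed_segment (p y) (p z)"
    proof -
      have "v = 1 - w" using uvw \<open>u = 0\<close> by simp
      then show ?thesis using uvw \<open>u = 0\<close> unfolding closed_segment_def
        by (intro CollectI exI[of _ w]) simp
    qed
    then show False using lastseg[of y z] y xyz by simp
  qed
  then have "v = 0" using zero(2) xyz by simp
  then have mxz: "m = u *\<^sub>R p x + w *\<^sub>R p z" "u + w = 1" using uvw by auto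
  have "u \<noteq> 0" using mne[of z] mxz xyz by auto
  have "w \<noteq> 0" using mne[of x] mxz xyz by auto
  have "x = 0" using zero(1) \<open>u \<noteq> 0\<close> xyz \<open>y < n - r\<close> by auto
  moreover have "z \<ge> n - r" using zero(3) \<open>w \<noteq> 0\<close> xyz by auto
  \<comment> \<open>A chord from \<open>0\<close> to a point of the last side contains no further
    points only if it is the wrap-around edge.\<close>
  ultimately have "z = n - 1" using cc(3) xyz by (auto simp: chord_def)
  with \<open>x = 0\<close> \<open>y < n - r\<close> xyz T(1) show ?thesis by blast
qed

lemma chords_tri:
  assumes "(a, b) \<in> chords" "\<not> (a = 0 \<and> b = n - 1)"
  shows "tri r a b {(x, y) \<in> chords. a \<le> x \<and> y \<le> b}"
  using assms
proof (induction "b - a" arbitrary: a b rule: less_induct)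
  case less
  have ab: "a < b" "b < n" using less.prems by (auto simp: chords_def)
  have lt: "x < y" if "(x, y) \<in> chords" for x y using that by (simp add: chords_def)
  show ?case
  proof (cases "b = Suc a")
    case True
    have "{(x, y) \<in> chords. a \<le> x \<and> y \<le> b} = {(a, Suc a)}"
      using True less.prems(1) lt by force
    then show ?thesis using True tri_edge by simp
  next
    case False
    then obtain i where i: "a < i" "i < b" "{p a, p i, p b} \<in> \<T>"
      using triangle_at_chord less.prems by blast
    have ai: "(a, i) \<in> chords" and ib: "(i, b) \<in> chords"
      using triangle_chords[OF i(3,1,2) ab(2)] by auto
    have "\<not> same_side r a b" using chords_chord[OF less.prems(1)] False less.prems(2) unfolding chord_def by blast
    moreover have "tri r a i {(x, y) \<in> chords. a \<le> x \<and> y \<le> i}"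
    proof (rule less.hyps)
      show "i - a < b - a" using i by linarith
      show "\<not> (a = 0 \<and> i = n - 1)" using i ab by linarith
    qed (rule ai)
    moreover have "tri r i b {(x, y) \<in> chords. i \<le> x \<and> y \<le> b}"
    proof (rule less.hyps)
      show "b - i < b - a" using i by linarith
      show "\<not> (i = 0 \<and> b = n - 1)" using i ab by linarith
    qed (rule ib)
    ultimately have "tri r a b (insert (a, b) ({(x, y) \<in> chords. a \<le> x \<and> y \<le> i} \<union> {(x, y) \<in> chords. i \<le> x \<and> y \<le> b}))"
      by (rule tri_node[OF i(1,2)])
    also have "insert (a, b) ({(x, y) \<in> chords. a \<le> x \<and> y \<le> i} \<union> {(x, y) \<in> chords. i \<le> x \<and> y \<le> b}) =
      {(x, y) \<in> chords. a \<le> x \<and> y \<le> b}"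
    proof (intro equalityI subsetI)
      fix e assume e: "e \<in> {(x, y) \<in> chords. a \<le> x \<and> y \<le> b}"
      obtain x y where xy: "e = (x, y)" "(x, y) \<in> chords" "a \<le> x" "y \<le> b" using e by auto
      \<comment> \<open>A chord straddling the apex \<open>i\<close> must, by non-crossing with both
        legs of the triangle, reach from \<open>a\<close> to \<open>b\<close>.\<close>
      have "(x, y) = (a, b) \<or> y \<le> i \<or> i \<le> x"
      proof (cases "y \<le> i \<or> i \<le> x")
        case False
        then have "b \<le> y" "\<not> a < x"
          using chords_noncrossing[OF xy(2) ib] chords_noncrossing[OF ai xy(2)] by linarith+
        then show ?thesis using xy(3,4) by simp
      qed auto
      then show "e \<in> insert (a, b) ({(x, y) \<in> chords. a \<le> x \<and> y \<le> i} \<union> {(x, y) \<in> chords. i \<le> x \<and> y \<le> b})"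
        using xy by auto
    qed (use i less.prems(1) in auto)
    finally show ?thesis .
  qed
qed

lemma chords_tris: "chords \<in> tris"
proof -
  obtain i where i: "0 < i" "i < n - r" "{p 0, p i, p (n - 1)} \<in> \<T>"
    using triangle_at_base by blast
  have i': "i < n - 1" "n - 1 < n" using i r n_ge by auto
  have ai: "(0, i) \<in> chords" and ib: "(i, n - 1) \<in> chords" and ab: "(0, n - 1) \<in> chords"
    using triangle_chords[OF i(3,1) i'] by auto
  let ?S1 = "{(x, y) \<in> chords. 0 \<le> x \<and> y \<le> i}" and ?S2 = "{(x, y) \<in> chords. i \<le> x \<and> y \<le> n - 1}"
  have t: "tri r 0 i ?S1" "tri r i (n - 1) ?S2"
    using chords_tri[OF ai] chords_tri[OF ib] i i' by auto
  have eq: "chords = insert (0, n - 1) (?S1 \<union> ?S2)"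
  proof (intro equalityI subsetI)
    fix e assume e: "e \<in> chords"
    obtain x y where xy: "e = (x, y)" "(x, y) \<in> chords" using e by (metis surj_pair)
    have "y \<le> n - 1" using xy(2) by (auto simp: chords_def)
    then have "(x, y) = (0, n - 1) \<or> y \<le> i \<or> i \<le> x"
    proof (cases "y \<le> i \<or> i \<le> x")
      case False
      then have "n - 1 \<le> y" "\<not> 0 < x"
        using chords_noncrossing[OF xy(2) ib] chords_noncrossing[OF ai xy(2)] by linarith+
      then show ?thesis using \<open>y \<le> n - 1\<close> by simp
    qed auto
    then show "e \<in> insert (0, n - 1) (?S1 \<union> ?S2)"
      using xy \<open>y \<le> n - 1\<close> by auto
  qed (use ab in auto)
  show ?thesis using trisI[OF i(1,2) t] by (simp only: eq[symmetric])
qed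

end

context side_points
begin

lemma dissection_tris:
  assumes "triangle_dissection (p ` {..<n}) S"
  shows "S \<in> (`) seg ` tris"
proof -
  obtain \<T> where "\<T> \<subseteq> triangles (p ` {..<n})" "convex hull (p ` {..<n}) = (\<Union>T\<in>\<T>. convex hull T)"
    "S = (\<Union>T\<in>\<T>. sides T)"
    using assms unfolding triangle_dissection_def by blast
  then interpret dissected_side_points k r n p S \<T>
    using assms unfolding triangle_dissection_def by unfold_locales auto
  show ?thesis using S_eq chords_tris by blast
qed

lemma tris_card: "S \<in> tris \<Longrightarrow> card S + 3 = 2 * n"
proof (elim trisE)
  fix i S1 S2 assume i: "0 < i" "i < n - r" and t: "tri r 0 i S1" "tri r i (n - 1) S2" and S: "S = insert (0, n - 1) (S1 \<union> S2)"
  have 1: "y \<le> i \<and> x < y" if "(x, y) \<in> S1" for x y using tri_range[OF t(1) that] by simp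
  have 2: "i \<le> x \<and> x < y" if "(x, y) \<in> S2" for x y using tri_range[OF t(2) that] by simp
  have "(x, y) \<notin> S2" if "(x, y) \<in> S1" for x y using 1[OF that] 2[of x y] by auto
  then have "S1 \<inter> S2 = {}" by auto
  moreover have "(0, n - 1) \<notin> S1 \<union> S2" using 1[of 0 "n - 1"] 2[of 0 "n - 1"] i r by auto
  ultimately have "card S = Suc (card S1 + card S2)"
    using t[THEN tri_finite] by (simp add: S card_Un_disjoint)
  then show "card S + 3 = 2 * n" using t[THEN tri_card] i r n_ge by simp
qed

lemma inj_on_seg: "inj_on seg {(a, b). a < b \<and> b < n}"
proof (rule inj_onI, clarify)
  fix a b c d assume "a < b" "b < n" "c < d" "d < n" "seg (a, b) = seg (c, d)"
  then show "a = c \<and> b = d" using seg_inject[of a b c d] by blast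
qed

lemma seg_inj_on_tris: "inj_on ((`) seg) tris"
proof (rule inj_onI)
  fix S S' assume SS: "S \<in> tris" "S' \<in> tris" "seg ` S = seg ` S'"
  have "inj_on seg {(a, b). a < b \<and> b < n}" by (rule inj_on_seg)
  moreover have "S \<subseteq> {(a, b). a < b \<and> b < n}" "S' \<subseteq> {(a, b). a < b \<and> b < n}"
    using tris_chord[OF SS(1)] tris_chord[OF SS(2)] by (auto simp: chord_def)
  ultimately show "S = S'" using SS(3) by (meson inj_on_image_eq_iff)
qed

text \<open>Every dissection consists of \<open>2 * n - 3\<close> segments, so none is properly
  contained in another and each is maximal.\<close>

lemma triangulations_eq: "{S. is_triangulation (p ` {..<n}) S} = (`) seg ` tris"
proof (intro equalityI subsetI)
  fix S assume "S \<in> {S. is_triangulation (p ` {..<n}) S}"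
  then show "S \<in> (`) seg ` tris" using dissection_tris by (simp add: is_triangulation_def)
next
  have card: "card (seg ` S) + 3 = 2 * n \<and> finite S" if "S \<in> tris" for S
  proof -
    have "inj_on seg {(a, b). a < b \<and> b < n}"
      by (rule inj_on_seg)
    then have "inj_on seg S"
      by (rule inj_on_subset) (use tris_chord[OF that] in \<open>auto simp: chord_def\<close>)
    moreover have "finite S" using that by (elim trisE) (auto dest: tri_finite)
    ultimately show ?thesis using tris_card[OF that] by (simp add: card_image)
  qed
  fix S assume "S \<in> (`) seg ` tris"
  then obtain A where A: "A \<in> tris" "S = seg ` A" by blast
  have "S' = S" if S': "triangle_dissection (p ` {..<n}) S'" "S \<subseteq> S'" for S'
  proof -
    obtain B where B: "B \<in> tris" "S' = seg ` B" using dissection_tris[OF S'(1)] by blast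
    then have "card S = card S'" "finite S'" using A card[OF A(1)] card[OF B(1)] by auto
    then show ?thesis using S'(2) by (metis card_subset_eq)
  qed
  then show "S \<in> {S. is_triangulation (p ` {..<n}) S}"
    using tris_dissection[OF A(1)] A(2) by (auto simp: is_triangulation_def)
qed

lemma card_triangulations:
  "card {S. is_triangulation (p ` {..<n}) S} =
    (\<Sum>i\<in>{0<..<n - r}. card {S. tri r 0 i S} * card {S. tri r i (n - 1) S})"
  unfolding triangulations_eq card_image[OF seg_inj_on_tris] unfolding tris_def
  by (rule card_tri_split) simp

end

section \<open>Numbering the points of a subdivided polygon; the count is independent of the
  polygon\<close>

section \<open>Subdivided convex polygons\<close>

lemma det3_affine_left:
  assumes "u + v = 1"
  shows "det3 (u *\<^sub>R x + v *\<^sub>R y) b c = u * det3 x b c + v * det3 y b c"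
  using det3_affine[OF assms, of b c x y] det3_rotate[of b c] by simp

lemma det3_affine_middle:
  assumes "u + v = 1"
  shows "det3 a (u *\<^sub>R x + v *\<^sub>R y) c = u * det3 a x c + v * det3 a y c"
  using det3_affine[OF assms, of c a x y] det3_rotate[of a _ c] by simp

lemma det3_on_line:
  "det3 ((1 - \<alpha>) *\<^sub>R x + \<alpha> *\<^sub>R y) ((1 - \<beta>) *\<^sub>R x + \<beta> *\<^sub>R y) z = (\<beta> - \<alpha>) * det3 x y z"
  by (simp add: det3_altdef algebra_simps)

lemma convex_polygon_det3:
  assumes "convex_polygon k v" "i < k" "j < k" "j \<noteq> i" "j \<noteq> Suc i mod k"
  shows "det3 (v i) (v (Suc i mod k)) (v j) > 0"
  using assms by (auto simp: convex_polygon_def det3_def)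

text \<open>Convexity is given only for triples that contain a side of the polygon. Induction on
  \<open>c\<close> passes to arbitrary triples by means of a Pluecker relation.\<close>

lemma convex_polygon_det3_pos:
  assumes cp: "convex_polygon k v" and "a < b" "b < c" "c < k"
  shows "det3 (v a) (v b) (v c) > 0"
proof (cases "b = Suc a")
  case True
  then show ?thesis using convex_polygon_det3[OF cp, of a c] assms by simp
next
  case False
  define e where "e = Suc a"
  have e: "a < e" "e < b" using False assms by (auto simp: e_def)
  have 1: "det3 (v a) (v e) (v x) > 0" if "e < x" "x < k" for x
    using convex_polygon_det3[OF cp, of a x] that assms by (simp add: e_def)
  have 2: "det3 (v a) (v x) (v (Suc x)) > 0" if "a < x" "Suc x < k" for x
    using convex_polygon_det3[OF cp, of x a] that by (simp add: det3_rotate[of "v x" "v (Suc x)" "v a"])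
  \<comment> \<open>The three-term Pluecker relation for vectors issuing from \<open>p\<close>. It
    is used at \<open>v a\<close> with the neighbour \<open>e\<close>, so that every factor is the
    orientation of a triple with a side or is known by induction.\<close>
  have plucker: "det3 p x z * det3 p y w = det3 p x y * det3 p z w + det3 p x w * det3 p y z" for p x y z w
    by (simp add: det3_altdef algebra_simps)
  have "Suc b \<le> c" using assms by simp
  then show ?thesis using \<open>c < k\<close>
  proof (induction c rule: dec_induct)
    case base
    then show ?case using 2[of b] assms by simp
  next
    case (step c)
    have "det3 (v a) (v e) (v c) > 0" using 1[of c] step e by simp
    moreover have "det3 (v a) (v e) (v c) * det3 (v a) (v b) (v (Suc c)) > 0"
      unfolding plucker[of "v a" "v e" "v c" "v b" "v (Suc c)"]
      using 1[of b] 1[of "Suc c"] 2[of c] step assms e by (intro add_pos_pos mult_pos_pos) auto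
    ultimately show ?case by (simp add: zero_less_mult_iff)
  qed
qed

lemma enumerate_open_segment:
  fixes a b :: complex
  assumes "A \<subseteq> open_segment a b" "finite A" "card A = r - 1" "r \<ge> 1" "a \<noteq> b"
  obtains \<tau> :: "nat \<Rightarrow> real" where "\<tau> 0 = 0" "\<tau> r = 1" "\<And>x y. x < y \<Longrightarrow> y \<le> r \<Longrightarrow> \<tau> x < \<tau> y"
    "A = (\<lambda>q. (1 - \<tau> q) *\<^sub>R a + \<tau> q *\<^sub>R b) ` {1..<r}"
proof -
  define f where "f t = (1 - t) *\<^sub>R a + t *\<^sub>R b" for t
  have inj: "inj f"
  proof (rule injI)
    fix s t assume "f s = f t"
    then have "(s - t) *\<^sub>R (b - a) = 0" by (simp add: f_def algebra_simps)
    then show "s = t" using assms(5) by simp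
  qed
  have seg: "open_segment a b = f ` {0<..<1}"
    using assms(5) by (auto simp: in_segment f_def)
  define B where "B = {t \<in> {0<..<1}. f t \<in> A}"
  have AB: "A = f ` B" using assms(1) seg by (auto simp: B_def)
  have cB: "card B = r - 1" "finite B"
    using assms(2,3) inj unfolding AB by (auto simp: card_image inj_on_subset finite_image_iff)
  \<comment> \<open>The parameters in increasing order, framed by 0 and 1, so that the position in
    the list is the number of the point on the closed side.\<close>
  define L where "L = 0 # sorted_list_of_set B @ [1]"
  have len: "length L = Suc r" using cB assms(4) by (simp add: L_def)
  have sorted: "sorted_wrt (<) L"
    using cB(2) by (auto simp: L_def sorted_wrt_append B_def)
  define \<tau> where "\<tau> q = L ! q" for q
  show ?thesis
  proof (rule that[of \<tau>])
    show "\<tau> 0 = 0" by (simp add: \<tau>_def L_def)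
    show "\<tau> r = 1" using cB assms(4) by (simp add: \<tau>_def L_def nth_append nth_Cons')
    show "\<tau> x < \<tau> y" if "x < y" "y \<le> r" for x y
      using sorted_wrt_nth_less[OF sorted that(1)] that len by (simp add: \<tau>_def)
    have "B = \<tau> ` {1..<r}"
    proof -
      have "B = set (sorted_list_of_set B)" using cB by simp
      also have "\<dots> = (\<lambda>q. sorted_list_of_set B ! q) ` {0..<r - 1}"
        using cB nth_image[of "r - 1" "sorted_list_of_set B"] by (simp add: atLeast0LessThan)
      also have "\<dots> = \<tau> ` Suc ` {0..<r - 1}"
        unfolding image_image
        by (rule image_cong) (use cB in \<open>auto simp: \<tau>_def L_def nth_append\<close>)
      also have "Suc ` {0..<r - 1} = {1..<r}"
        using assms(4) by (simp add: image_Suc_atLeastLessThan)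
      finally show ?thesis .
    qed
    then show "A = (\<lambda>q. (1 - \<tau> q) *\<^sub>R a + \<tau> q *\<^sub>R b) ` {1..<r}"
      unfolding AB by (simp add: image_image f_def)
  qed
qed

text \<open>\<open>det3\<close> is affine in each argument, so the orientation of subdivision points
  is a nonnegative combination of orientations of corners. What remains is to find a strictly
  positive term in every case. \<open>V\<close> continues the corners cyclically, with
  \<open>V k = V 0\<close>.\<close>

lemma side_points_if_convex_polygon:
  assumes cp: "convex_polygon k v" and k: "k \<ge> 3" and r: "r \<ge> 1"
    and A: "\<And>i. i < k \<Longrightarrow> A i \<subseteq> open_segment (v i) (v (Suc i mod k)) \<and> finite (A i) \<and> card (A i) = r - 1"
  shows "\<exists>p. side_points k r (k * r) p \<and> v ` {..<k} \<union> (\<Union>i<k. A i) = p ` {..<k * r}"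
proof -
  define V where "V i = v (i mod k)" for i
  have VSuc: "v (Suc i mod k) = V (Suc i)" for i by (simp add: V_def)
  have Vi: "v i = V i" if "i < k" for i using that by (simp add: V_def)
  have pos: "det3 (V a) (V b) (V c) > 0" if "a < b" "b < c" "c \<le> k" "\<not> (a = 0 \<and> c = k)" for a b c
  proof (cases "c = k")
    case True
    then show ?thesis using convex_polygon_det3_pos[OF cp, of 0 a b] that
      by (simp add: V_def det3_rotate[of "v a" "v b" "v 0"])
  next
    case False
    then show ?thesis using convex_polygon_det3_pos[OF cp, of a b c] that by (simp add: V_def)
  qed
  have nonneg: "det3 (V a) (V b) (V c) \<ge> 0" if "a \<le> b" "b \<le> c" "c \<le> k" for a b c
  proof (cases "a < b \<and> b < c \<and> \<not> (a = 0 \<and> c = k)")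
    case True
    then show ?thesis using pos[of a b c] that by simp
  next
    case False
    then have "a = b \<or> b = c \<or> V a = V c" using that by (auto simp: V_def)
    then show ?thesis by auto
  qed
  have ne: "V i \<noteq> V (Suc i)" if "i < k" for i
  proof
    assume eq: "V i = V (Suc i)"
    show False
    proof (cases "i = 0")
      case True
      then show ?thesis using pos[of 0 1 2] k eq by simp
    next
      case False
      then show ?thesis using pos[of 0 i "Suc i"] pos[of 1 i "Suc i"] pos[of "i - 1" i "Suc i"] that k eq by auto
    qed
  qed
  define good where "good i \<tau> \<longleftrightarrow> \<tau> 0 = 0 \<and> \<tau> r = 1 \<and> (\<forall>x y. x < y \<longrightarrow> y \<le> r \<longrightarrow> \<tau> x < \<tau> y) \<and>
    A i = (\<lambda>q. (1 - \<tau> q) *\<^sub>R V i + \<tau> q *\<^sub>R V (Suc i)) ` {1..<r}" for i and \<tau> :: "nat \<Rightarrow> real"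
  have "\<exists>\<tau>. good i \<tau>" if i: "i < k" for i
  proof -
    have *: "A i \<subseteq> open_segment (V i) (V (Suc i))" "finite (A i)" "card (A i) = r - 1"
      using A[OF i] unfolding VSuc Vi[OF i] by auto
    show ?thesis
      by (rule enumerate_open_segment[OF * r ne[OF i]]) (auto simp: good_def)
  qed
  then have "\<forall>i\<in>{..<k}. \<exists>\<tau>. good i \<tau>" by blast
  then obtain \<tau> where "\<forall>i\<in>{..<k}. good i (\<tau> i)" using bchoice[of "{..<k}" good] by blast
  then have good: "good i (\<tau> i)" if "i < k" for i using that by blast
  have \<tau>:
    "\<And>i. i < k \<Longrightarrow> \<tau> i 0 = 0" "\<And>i. i < k \<Longrightarrow> \<tau> i r = 1" "\<And>i x y. i < k \<Longrightarrow> x < y \<Longrightarrow> y \<le> r \<Longrightarrow> \<tau> i x < \<tau> i y"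
    "\<And>i. i < k \<Longrightarrow> A i = (\<lambda>q. (1 - \<tau> i q) *\<^sub>R V i + \<tau> i q *\<^sub>R V (Suc i)) ` {1..<r}"
    using good by (auto simp: good_def)
  \<comment> \<open>The position on the side \<open>x div r\<close>. It lies in the half-open unit
    interval: a corner is always read as the start of the side that begins there.\<close>
  define t where "t x = \<tau> (x div r) (x mod r)" for x
  define p where "p x = (1 - t x) *\<^sub>R V (x div r) + t x *\<^sub>R V (Suc (x div r))" for x
  have divk: "x div r < k" if "x < k * r" for x
    using that r by (simp add: less_mult_imp_div_less)
  have t: "0 \<le> t x" "t x < 1" "t x = 0 \<longleftrightarrow> x mod r = 0" if "x < k * r" for x
  proof -
    have m: "x mod r < r" using r by simp
    note \<tau>3 = \<tau>(3)[OF divk[OF that]] and \<tau>1 = \<tau>(1)[OF divk[OF that]] and \<tau>2 = \<tau>(2)[OF divk[OF that]]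
    show "t x < 1" using \<tau>3[OF m] \<tau>2 by (simp add: t_def)
    show "t x = 0 \<longleftrightarrow> x mod r = 0" "0 \<le> t x"
      using \<tau>3[of 0 "x mod r"] \<tau>1 m by (cases "x mod r = 0"; simp add: t_def)+
  qed
  have tless: "t x < t y" if "x < y" "x div r = y div r" "y < k * r" for x y
  proof -
    have "x mod r < y mod r" using that by (metis div_mult_mod_eq nat_add_left_cancel_less)
    then show ?thesis using \<tau>(3)[OF divk[OF that(3)], of "x mod r" "y mod r"] r that by (simp add: t_def)
  qed
  have sp: "side_points k r (k * r) p"
  proof
    fix a b c :: nat
    assume abc: "a < b" "b < c" "c < k * r" "\<not> same_side r a c" "\<not> (a = 0 \<and> k * r - r \<le> b)"
    have lt: "a < k * r" "b < k * r" using abc by auto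
    have sle: "a div r \<le> b div r" "b div r \<le> c div r" using abc by (auto intro: div_le_mono)
    have sk: "c div r < k" using divk abc by simp
    have pc: "det3 (V i) (V j) (p c) = (1 - t c) * det3 (V i) (V j) (V (c div r)) + t c * det3 (V i) (V j) (V (Suc (c div r)))" for i j
      unfolding p_def by (rule det3_affine) simp
    have bounds: "a \<ge> (a div r) * r" "b \<ge> (b div r) * r" "c \<ge> (c div r) * r"
      by (simp_all add: div_times_less_eq_dividend)
    have ub: "x < Suc (x div r) * r" for x
      using r by (simp add: dividend_less_times_div[of r x] mult.commute add.commute)
    consider "a div r < b div r" "b div r < c div r" | "a div r = b div r" "b div r < c div r"
      | "a div r < b div r" "b div r = c div r" | "a div r = c div r" using sle by linarith
    then show "det3 (p a) (p b) (p c) > 0"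
    proof cases
      case 1
      have nn: "det3 (V i) (V j) (p c) \<ge> 0" if "i \<le> j" "j \<le> c div r" for i j
        unfolding pc using that nonneg[of i j "c div r"] nonneg[of i j "Suc (c div r)"] sk t[OF abc(3)] by simp
      have ps: "det3 (V i) (V j) (p c) > 0" if "i < j" "j < c div r" for i j
        unfolding pc using that pos[of i j "c div r"] nonneg[of i j "Suc (c div r)"] sk t[OF abc(3)]
        by (intro add_pos_nonneg mult_pos_pos mult_nonneg_nonneg) auto
      have pb: "det3 (V i) (p b) (p c) = (1 - t b) * det3 (V i) (V (b div r)) (p c) + t b * det3 (V i) (V (Suc (b div r))) (p c)" for i
        unfolding p_def[of b] by (rule det3_affine_middle) simp
      have ps2: "det3 (V i) (p b) (p c) > 0" if "i < b div r" for i
        unfolding pb using that ps[of i "b div r"] nn[of i "Suc (b div r)"] 1 t[OF lt(2)]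
        by (intro add_pos_nonneg mult_pos_pos mult_nonneg_nonneg) auto
      have nn2: "det3 (V i) (p b) (p c) \<ge> 0" if "i \<le> b div r" for i
        unfolding pb using that nn[of i "b div r"] nn[of i "Suc (b div r)"] 1 t[OF lt(2)] by simp
      have "det3 (p a) (p b) (p c) = (1 - t a) * det3 (V (a div r)) (p b) (p c) + t a * det3 (V (Suc (a div r))) (p b) (p c)"
        unfolding p_def[of a] by (rule det3_affine_left) simp
      then show ?thesis
        using ps2[of "a div r"] nn2[of "Suc (a div r)"] 1 t[OF lt(1)] by (simp add: add_pos_nonneg)
    next
      case 2
      let ?s = "b div r"
      have "det3 (V ?s) (V (Suc ?s)) (p c) > 0"
      proof (cases "c div r = Suc ?s")
        case True
        \<comment> \<open>On the adjacent side, positivity depends on \<open>c\<close> being beyond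
          the common corner; otherwise \<open>a\<close> and \<open>c\<close> would share a closed
          side.\<close>
        have "c mod r \<noteq> 0"
        proof
          assume "c mod r = 0"
          then have "c = Suc ?s * r" using True by (metis add.right_neutral div_mult_mod_eq)
          then have "same_side r a c" unfolding same_side_def using bounds(1) 2 by (intro exI[of _ ?s]) simp
          then show False using abc by simp
        qed
        then have "t c > 0" using t[OF abc(3)] by (metis less_eq_real_def)
        moreover have "det3 (V ?s) (V (Suc ?s)) (V (Suc (Suc ?s))) > 0" using sk True k by (intro pos) auto
        ultimately show ?thesis by (simp add: pc True)
      next
        case False
        then have "Suc ?s < c div r" using 2 by simp
        then show ?thesis unfolding pc using pos[of ?s "Suc ?s" "c div r"] nonneg[of ?s "Suc ?s" "Suc (c div r)"] sk t[OF abc(3)]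
          by (intro add_pos_nonneg mult_pos_pos mult_nonneg_nonneg) auto
      qed
      moreover have "det3 (p a) (p b) (p c) = (t b - t a) * det3 (V ?s) (V (Suc ?s)) (p c)"
        unfolding p_def[of a] p_def[of b] 2(1) by (rule det3_on_line)
      ultimately show ?thesis using tless[of a b] abc lt 2 by simp
    next
      case 3
      let ?s = "c div r"
      have "det3 (V ?s) (V (Suc ?s)) (p a) > 0"
      proof -
        have eq: "det3 (V ?s) (V (Suc ?s)) (p a) = (1 - t a) * det3 (V (a div r)) (V ?s) (V (Suc ?s)) + t a * det3 (V (Suc (a div r))) (V ?s) (V (Suc ?s))"
          unfolding p_def[of a] by (subst det3_rotate) (rule det3_affine_left, simp)
        show ?thesis
        proof (cases "a div r = 0 \<and> Suc ?s = k")
          case True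
          \<comment> \<open>On the first side against the last one, the term with \<open>V 0\<close>
            is degenerate because \<open>V k = V 0\<close>. Strictness comes from
            \<open>t a > 0\<close>, and the wrap-around exception excludes
            \<open>a = 0\<close>.\<close>
          have "a \<noteq> 0"
          proof
            assume "a = 0"
            have "?s = k - 1" using True by linarith
            then have "k * r - r \<le> b" using bounds(2) 3 k by (simp add: diff_mult_distrib)
            then show False using abc \<open>a = 0\<close> by simp
          qed
          then have "a mod r \<noteq> 0" using True by (metis add.right_neutral div_mult_mod_eq mult_zero_left)
          then have "t a > 0" using t[OF lt(1)] by (metis less_eq_real_def)
          moreover have "det3 (V (Suc (a div r))) (V ?s) (V (Suc ?s)) > 0" using True k by (intro pos) auto
          moreover have "det3 (V (a div r)) (V ?s) (V (Suc ?s)) \<ge> 0" using True by (intro nonneg) auto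
          ultimately show ?thesis unfolding eq using t[OF lt(1)] by (simp add: add_nonneg_pos)
        next
          case False
          then have "det3 (V (a div r)) (V ?s) (V (Suc ?s)) > 0" using 3 sk by (intro pos) auto
          moreover have "det3 (V (Suc (a div r))) (V ?s) (V (Suc ?s)) \<ge> 0" using 3 sk by (intro nonneg) auto
          ultimately show ?thesis unfolding eq using t[OF lt(1)] by (simp add: add_pos_nonneg)
        qed
      qed
      moreover have "det3 (p b) (p c) (p a) = (t c - t b) * det3 (V ?s) (V (Suc ?s)) (p a)"
        unfolding p_def[of b] p_def[of c] 3(2) by (rule det3_on_line)
      ultimately show ?thesis using tless[of b c] abc 3 det3_rotate[of "p b" "p c" "p a"] by simp
    next
      case 4
      then have "same_side r a c" unfolding same_side_def using bounds(1) ub[of c]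
        by (intro exI[of _ "a div r"]) auto
      then show ?thesis using abc by simp
    qed
  next
    fix s assume s: "s < k"
    let ?w = "V (Suc s) - V s"
    have "p (x mod (k * r)) = V s + of_real (\<tau> s (x - s * r)) * ?w" if x: "s * r \<le> x" "x \<le> Suc s * r" for x
    proof (cases "x = Suc s * r")
      case True
      have "x mod (k * r) = (Suc s mod k) * r" unfolding True by (rule mult_mod_left[symmetric])
      moreover have "Suc s mod k < k" using s by simp
      ultimately have "p (x mod (k * r)) = V (Suc s mod k)" using \<tau>(1)[of "Suc s mod k"] r by (simp add: p_def t_def)
      also have "\<dots> = V (Suc s)" by (simp add: V_def)
      finally show ?thesis using True \<tau>(2)[OF s] by simp
    next
      case False
      then have x': "x div r = s" "x mod r = x - s * r"
        using x r by (auto simp: div_nat_eqI modulo_nat_def mult.commute)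
      have "Suc s * r \<le> k * r" using s by (intro mult_le_mono1) simp
      then have "x < k * r" using x False by linarith
      then show ?thesis using x' by (simp add: p_def t_def scaleR_conv_of_real algebra_simps)
    qed
    moreover have "\<tau> s (x - s * r) < \<tau> s (y - s * r)" if "s * r \<le> x" "x < y" "y \<le> Suc s * r" for x y
      using that by (intro \<tau>(3)[OF s]) auto
    ultimately show "\<exists>v w \<tau>. w \<noteq> 0 \<and>
      (\<forall>x. s * r \<le> x \<and> x \<le> Suc s * r \<longrightarrow> p (x mod (k * r)) = v + of_real (\<tau> x) * w) \<and>
      (\<forall>x y. s * r \<le> x \<and> x < y \<and> y \<le> Suc s * r \<longrightarrow> \<tau> x < (\<tau> y :: real))"
      using ne[OF s] by (intro exI[of _ "V s"] exI[of _ ?w] exI[of _ "\<lambda>x. \<tau> s (x - s * r)"]) auto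
  qed (use k r in auto)
  have pq: "p (i * r + q) = (1 - \<tau> i q) *\<^sub>R V i + \<tau> i q *\<^sub>R V (Suc i)" if "q < r" for i q
    using that by (simp add: p_def t_def)
  have "v ` {..<k} \<union> (\<Union>i<k. A i) = (\<Union>i<k. \<Union>q<r. {p (i * r + q)})"
  proof -
    have "(\<Union>q<r. {p (i * r + q)}) = insert (v i) (A i)" if "i < k" for i
    proof -
      have "{..<r} = insert 0 {1..<r}" using r by auto
      then have "(\<Union>q<r. {p (i * r + q)}) = insert (p (i * r + 0)) ((\<lambda>q. p (i * r + q)) ` {1..<r})" by auto
      also have "p (i * r + 0) = v i" using pq[of 0 i] r \<tau>(1)[OF that] Vi[OF that] by simp
      also have "(\<lambda>q. p (i * r + q)) ` {1..<r} = A i"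
        unfolding \<tau>(4)[OF that] by (rule image_cong) (use pq in auto)
      finally show ?thesis .
    qed
    then show ?thesis by auto
  qed
  also have "\<dots> = p ` {..<k * r}"
  proof (intro equalityI subsetI)
    fix z assume "z \<in> (\<Union>i<k. \<Union>q<r. {p (i * r + q)})"
    then obtain i q where iq: "i < k" "q < r" "z = p (i * r + q)" by auto
    have "Suc i * r \<le> k * r" using iq by (intro mult_le_mono1) simp
    then show "z \<in> p ` {..<k * r}" using iq by (intro image_eqI[of _ _ "i * r + q"]) auto
  next
    fix z assume "z \<in> p ` {..<k * r}"
    then obtain x where x: "x < k * r" "z = p x" by auto
    have "z = p ((x div r) * r + x mod r)" using x by simp
    then show "z \<in> (\<Union>i<k. \<Union>q<r. {p (i * r + q)})"
      using divk[OF x(1)] r by (intro UN_I[of "x div r"] UN_I[of "x mod r"]) auto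
  qed
  finally show ?thesis using sp by blast
qed

lemma is_SC_side_points:
  assumes "is_SC k r P" "k \<ge> 3" "r \<ge> 1"
  obtains p where "side_points k r (k * r) p" "P = p ` {..<k * r}"
proof -
  obtain v A where "convex_polygon k v"
    "\<And>i. i < k \<Longrightarrow> A i \<subseteq> open_segment (v i) (v (Suc i mod k)) \<and> finite (A i) \<and> card (A i) = r - 1"
    "P = v ` {..<k} \<union> (\<Union>i<k. A i)"
    using assms(1) unfolding is_SC_def by blast
  then show ?thesis using that side_points_if_convex_polygon[OF _ assms(2,3)] by metis
qed

text \<open>Existence is what makes the description in \<open>tr\<close> determinate: over an empty
  family of point sets every number would satisfy it.\<close>

lemma is_SC_exists:
  assumes "k \<ge> 3"
  shows "\<exists>P. is_SC k r P"
proof -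
  \<comment> \<open>Points on a parabola: their orientation is a Vandermonde product, whose sign is
    visible from the order of the indices.\<close>
  define v where "v i = Complex (real i) ((real i)\<^sup>2)" for i :: nat
  have d: "Im (cnj (v j - v i) * (v l - v i)) = (real j - real i) * (real l - real i) * (real l - real j)" for i j l
    by (simp add: v_def power2_eq_square algebra_simps)
  have "convex_polygon k v"
    unfolding convex_polygon_def
  proof (intro allI impI)
    fix i j assume ij: "i < k" "j < k" "j \<noteq> i \<and> j \<noteq> Suc i mod k"
    show "0 < Im (cnj (v (Suc i mod k) - v i) * (v j - v i))"
    proof (cases "Suc i = k")
      case True
      then have "0 < j" "j < i" using ij by auto
      then have "0 < real i * (real i - real j) * real j" by simp
      also have "\<dots> = (real 0 - real i) * (real j - real i) * (real j - real 0)" by (simp add: algebra_simps)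
      finally show ?thesis unfolding d using True by simp
    next
      case False
      then have "j < i \<or> Suc i < j" using ij by auto
      then have "0 < (real j - real i) * (real j - real (Suc i))"
        by (auto simp: zero_less_mult_iff)
      then show ?thesis unfolding d using False ij by simp
    qed
  qed
  define good where "good i A \<longleftrightarrow> A \<subseteq> open_segment (v i) (v (Suc i mod k)) \<and> finite A \<and> card A = r - 1" for i A
  have "\<exists>A. good i A" if "i < k" for i
  proof -
    have "v i \<noteq> v (Suc i mod k)"
    proof
      assume "v i = v (Suc i mod k)"
      then have "i = Suc i mod k" by (simp add: v_def)
      then show False using that assms by (cases "Suc i = k") auto
    qed
    then have "infinite (open_segment (v i) (v (Suc i mod k)))" by simp
    then show ?thesis unfolding good_def using infinite_arbitrarily_large by metis
  qed
  then have "\<forall>i\<in>{..<k}. \<exists>A. good i A" by blast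
  then obtain A where "\<forall>i\<in>{..<k}. good i (A i)" using bchoice[of "{..<k}" good] by blast
  then have "\<forall>i<k. A i \<subseteq> open_segment (v i) (v (Suc i mod k)) \<and> finite (A i) \<and> card (A i) = r - 1"
    by (simp add: good_def)
  with \<open>convex_polygon k v\<close> show ?thesis unfolding is_SC_def
    by (intro exI[of _ "v ` {..<k} \<union> (\<Union>i<k. A i)"] exI[of _ v] exI[of _ A]) simp
qed

definition tri_count :: "nat \<Rightarrow> nat \<Rightarrow> nat \<Rightarrow> nat" where
  "tri_count r a b = card {S. tri r a b S}"

lemma tr_eq_sum:
  assumes "k \<ge> 3" "r \<ge> 1"
  shows "tr k r = of_nat (\<Sum>i\<in>{0<..<k * r - r}. tri_count r 0 i * tri_count r i (k * r - 1))"
proof -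
  let ?N = "\<Sum>i\<in>{0<..<k * r - r}. tri_count r 0 i * tri_count r i (k * r - 1)"
  have card: "card {S. is_triangulation P S} = ?N" if P: "is_SC k r P" for P
  proof -
    obtain p where p: "side_points k r (k * r) p" "P = p ` {..<k * r}"
      using is_SC_side_points[OF P assms] .
    interpret side_points k r "k * r" p by (rule p(1))
    show ?thesis using card_triangulations by (simp add: p(2) tri_count_def)
  qed
  obtain P where P: "is_SC k r P" using is_SC_exists[OF assms(1)] by blast
  have "(THE n. \<forall>P. is_SC k r P \<longrightarrow> card {S. is_triangulation P S} = n) = ?N"
  proof (rule the_equality)
    show "\<forall>P. is_SC k r P \<longrightarrow> card {S. is_triangulation P S} = ?N" using card by blast
    show "n = ?N" if "\<forall>P. is_SC k r P \<longrightarrow> card {S. is_triangulation P S} = n" for n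
      using that P card by metis
  qed
  then show ?thesis using assms by (simp add: tr_def)
qed

section \<open>The interval recursion as a quadratic equation for triangular matrices\<close>

section \<open>Solving the recursion\<close>

text \<open>Let \<open>c\<close> and \<open>u\<close> be the strictly upper triangular matrices \<open>tri_count r\<close> and \<open>step_weight r\<close>. The
  correction \<open>-1\<close> in \<open>u\<close> cancels the contribution of a forbidden ear to \<open>c\<^sup>2\<close>, so \<open>c = u + c\<^sup>2\<close>. Hence
  \<open>c = (\<Sum>m. tree_coeff m * u\<^sup>m)\<close>, where \<open>path_weight r m\<close> is \<open>u\<^sup>m\<close>.\<close>

definition step_weight :: "nat \<Rightarrow> nat \<Rightarrow> nat \<Rightarrow> complex" where
  "step_weight r a b = (if b = Suc a then 1 else if b = a + 2 \<and> same_side r a b then -1 else 0)"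

lemma same_side_mono: "same_side r a b \<Longrightarrow> a \<le> a' \<Longrightarrow> b' \<le> b \<Longrightarrow> same_side r a' b'"
  unfolding same_side_def by (meson le_trans)

lemma tri_count_Suc [simp]: "tri_count r a (Suc a) = 1"
  by (simp add: tri_count_def tri_Collect_edge)

lemma tri_count_same_side [simp]: "same_side r a b \<Longrightarrow> b \<noteq> Suc a \<Longrightarrow> tri_count r a b = 0"
  by (simp add: tri_count_def tri_Collect_same_side)

lemma tri_count_rec:
  assumes "a < b"
  shows "of_nat (tri_count r a b) = step_weight r a b +
    (\<Sum>i\<in>{a<..<b}. of_nat (tri_count r a i) * of_nat (tri_count r i b))"
proof -
  consider "b = Suc a" | "b \<noteq> Suc a" "\<not> same_side r a b" | "b = a + 2" "same_side r a b"
    | "b > a + 2" "same_side r a b" using assms by linarith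
  then show ?thesis
  proof cases
    case 1
    then have "{a<..<b} = {}" by auto
    then show ?thesis using 1 by (simp add: step_weight_def)
  next
    case 2
    then have "tri_count r a b = (\<Sum>i\<in>{a<..<b}. tri_count r a i * tri_count r i b)"
      unfolding tri_count_def by (subst tri_Collect_node) (auto simp: card_tri_split)
    then show ?thesis using 2 by (simp add: step_weight_def)
  next
    case 3
    then have "{a<..<b} = {Suc a}" by auto
    then show ?thesis using 3 by (simp add: step_weight_def)
  next
    case 4
    have "of_nat (tri_count r a i) * of_nat (tri_count r i b) = (0 :: complex)" if "i \<in> {a<..<b}" for i
    \<comment> \<open>At least one of the two parts is longer than an edge, and it stays on the same
      side of the polygon, where its count is zero.\<close>
    proof (cases "i = Suc a")
      case True
      then have "tri_count r i b = 0" using 4 same_side_mono[OF 4(2), of i b] by (intro tri_count_same_side) auto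
      then show ?thesis by simp
    next
      case False
      then have "tri_count r a i = 0" using 4 that same_side_mono[OF 4(2), of a i] by (intro tri_count_same_side) auto
      then show ?thesis by simp
    qed
    then have "(\<Sum>i\<in>{a<..<b}. of_nat (tri_count r a i) * of_nat (tri_count r i b)) = (0 :: complex)"
      by (rule sum.neutral[OF ballI])
    then show ?thesis using 4 by (simp add: step_weight_def)
  qed
qed

text \<open>The coefficients of the solution of \<open>T = X + T\<^sup>2\<close>, i.e. the shifted Catalan numbers.\<close>

definition tree_coeff :: "nat \<Rightarrow> complex" where
  "tree_coeff m = fps_nth (fps_inv (fps_X - fps_X ^ 2)) m"

lemma tree_coeff_rec: "tree_coeff m = (if m = 1 then 1 else 0) + (\<Sum>i\<le>m. tree_coeff i * tree_coeff (m - i))"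
proof -
  define T :: "complex fps" where "T = fps_inv (fps_X - fps_X ^ 2)"
  have T0: "T $ 0 = 0" by (simp add: T_def fps_inv_def)
  have "(fps_X - fps_X ^ 2) oo T = fps_X"
    unfolding T_def by (rule fps_inv_right) simp_all
  then have "T - T ^ 2 = fps_X"
    using T0 by (simp add: fps_compose_sub_distrib fps_compose_power[symmetric])
  then have "T = fps_X + T * T" by (simp add: power2_eq_square algebra_simps)
  then have "T $ m = fps_X $ m + (T * T) $ m" by (metis fps_add_nth)
  then show ?thesis by (simp add: tree_coeff_def T_def[symmetric] fps_mult_nth atMost_atLeast0)
qed

lemma tree_coeff_0 [simp]: "tree_coeff 0 = 0"
  by (simp add: tree_coeff_def fps_inv_def)

fun path_weight :: "nat \<Rightarrow> nat \<Rightarrow> nat \<Rightarrow> nat \<Rightarrow> complex" where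
  "path_weight r 0 a b = (if a = b then 1 else 0)"
| "path_weight r (Suc m) a b = (\<Sum>i\<in>{a..b}. path_weight r m a i * step_weight r i b)"

lemma path_weight_gt: "b < a \<Longrightarrow> path_weight r m a b = 0"
  by (cases m) auto

lemma path_weight_long: "b < a + m \<Longrightarrow> path_weight r m a b = 0"
proof (induction m arbitrary: b)
  case (Suc m)
  have "path_weight r m a i * step_weight r i b = 0" if "i \<in> {a..b}" for i
  proof (cases "i < b")
    case True
    then show ?thesis using Suc by simp
  qed (simp add: step_weight_def)
  then show ?case unfolding path_weight.simps by (rule sum.neutral[OF ballI])
qed auto

lemma path_weight_1: "a \<le> b \<Longrightarrow> path_weight r (Suc 0) a b = step_weight r a b"
  by (simp add: if_distrib[of "\<lambda>x. x * _"] cong: if_cong)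

lemma path_weight_add:
  "path_weight r (m + m') a b = (\<Sum>i\<in>{a..b}. path_weight r m a i * path_weight r m' i b)"
proof (induction m' arbitrary: b)
  case 0
  show ?case
    by (cases "a \<le> b") (auto simp: if_distrib[of "\<lambda>x. _ * x"] path_weight_gt cong: if_cong)
next
  case (Suc m')
  have "path_weight r (m + Suc m') a b =
    (\<Sum>j\<in>{a..b}. (\<Sum>i\<in>{a..j}. path_weight r m a i * path_weight r m' i j) * step_weight r j b)"
    using Suc by simp
  also have "\<dots> = (\<Sum>j\<in>{a..b}. \<Sum>i\<in>{a..b}. path_weight r m a i * path_weight r m' i j * step_weight r j b)"
  proof (rule sum.cong[OF refl])
    fix j assume j: "j \<in> {a..b}"
    have "(\<Sum>i\<in>{a..j}. path_weight r m a i * path_weight r m' i j) = (\<Sum>i\<in>{a..b}. path_weight r m a i * path_weight r m' i j)"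
      by (rule sum.mono_neutral_left) (use j in \<open>auto simp: path_weight_gt\<close>)
    then show "(\<Sum>i\<in>{a..j}. path_weight r m a i * path_weight r m' i j) * step_weight r j b =
      (\<Sum>i\<in>{a..b}. path_weight r m a i * path_weight r m' i j * step_weight r j b)"
      by (simp add: sum_distrib_right)
  qed
  also have "\<dots> = (\<Sum>i\<in>{a..b}. \<Sum>j\<in>{a..b}. path_weight r m a i * path_weight r m' i j * step_weight r j b)"
    by (rule sum.swap)
  also have "\<dots> = (\<Sum>i\<in>{a..b}. path_weight r m a i * path_weight r (Suc m') i b)"
  proof (rule sum.cong[OF refl])
    fix i assume i: "i \<in> {a..b}"
    have "(\<Sum>j\<in>{a..b}. path_weight r m' i j * step_weight r j b) = (\<Sum>j\<in>{i..b}. path_weight r m' i j * step_weight r j b)"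
      by (rule sum.mono_neutral_right) (use i in \<open>auto simp: path_weight_gt\<close>)
    then show "(\<Sum>j\<in>{a..b}. path_weight r m a i * path_weight r m' i j * step_weight r j b) =
      path_weight r m a i * path_weight r (Suc m') i b"
      by (simp add: mult.assoc flip: sum_distrib_left)
  qed
  finally show ?case .
qed

text \<open>Both sides satisfy the same recursion on the length of the interval: products of powers
  of \<open>u\<close> are again powers, and the convolution of \<open>tree_coeff\<close> reproduces
  itself. The bound \<open>N\<close> makes the series finite, since a path of \<open>m\<close> steps
  covers a distance of at least \<open>m\<close>.\<close>

lemma tri_count_eq:
  assumes "a < b" "b < a + N"
  shows "of_nat (tri_count r a b) = (\<Sum>m<N. tree_coeff m * path_weight r m a b)"
  using assms
proof (induction "b - a" arbitrary: a b rule: less_induct)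
  case less
  let ?F = "\<lambda>a b. \<Sum>m<N. tree_coeff m * path_weight r m a b"
  have diag: "?F a a = 0" for a
  proof (rule sum.neutral, rule ballI)
    fix m
    show "tree_coeff m * path_weight r m a a = 0"
      using path_weight_long[of a a m r] by (cases "m = 0") auto
  qed
  have "of_nat (tri_count r a b) = step_weight r a b + (\<Sum>i\<in>{a<..<b}. ?F a i * ?F i b)"
    unfolding tri_count_rec[OF less.prems(1)]
    by (intro arg_cong2[of _ _ _ _ "(+)"] refl sum.cong arg_cong2[of _ _ _ _ "(*)"] less.hyps) (use less.prems in auto)
  also have "(\<Sum>i\<in>{a<..<b}. ?F a i * ?F i b) = (\<Sum>i\<in>{a..b}. ?F a i * ?F i b)"
  proof (rule sum.mono_neutral_left)
    show "\<forall>i\<in>{a..b} - {a<..<b}. ?F a i * ?F i b = 0"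
    proof
      fix i assume "i \<in> {a..b} - {a<..<b}"
      then have "i = a \<or> i = b" by auto
      then show "?F a i * ?F i b = 0" using diag by auto
    qed
  qed auto
  also have "\<dots> = (\<Sum>i\<in>{a..b}. \<Sum>m<N. \<Sum>m'<N. tree_coeff m * tree_coeff m' * (path_weight r m a i * path_weight r m' i b))"
    unfolding sum_product by (intro sum.cong refl) (simp add: mult_ac)
  also have "\<dots> = (\<Sum>m<N. \<Sum>i\<in>{a..b}. \<Sum>m'<N. tree_coeff m * tree_coeff m' * (path_weight r m a i * path_weight r m' i b))"
    by (rule sum.swap)
  also have "\<dots> = (\<Sum>m<N. \<Sum>m'<N. \<Sum>i\<in>{a..b}. tree_coeff m * tree_coeff m' * (path_weight r m a i * path_weight r m' i b))"
    by (intro sum.cong refl sum.swap)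
  also have "\<dots> = (\<Sum>m<N. \<Sum>m'<N. tree_coeff m * tree_coeff m' * path_weight r (m + m') a b)"
    by (simp add: path_weight_add sum_distrib_left)
  also have "\<dots> = (\<Sum>(m, m')\<in>{..<N} \<times> {..<N}. tree_coeff m * tree_coeff m' * path_weight r (m + m') a b)"
    by (simp add: sum.cartesian_product)
  \<comment> \<open>The square of index pairs is cut down to a triangle, as pairs with
    \<open>m + m' \<ge> N\<close> belong to paths that are too long.\<close>
  also have "\<dots> = (\<Sum>(m, m')\<in>{(m, m'). m + m' < N}. tree_coeff m * tree_coeff m' * path_weight r (m + m') a b)"
  proof (rule sum.mono_neutral_right)
    have long: "path_weight r (m + m') a b = 0" if "\<not> m + m' < N" for m m'
      using less.prems that by (intro path_weight_long) simp
    show "\<forall>x\<in>{..<N} \<times> {..<N} - {(m, m'). m + m' < N}.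
        (case x of (m, m') \<Rightarrow> tree_coeff m * tree_coeff m' * path_weight r (m + m') a b) = 0"
    proof (intro ballI)
      fix x assume x: "x \<in> {..<N} \<times> {..<N} - {(m, m'). m + m' < N}"
      obtain m m' where m: "x = (m, m')" by fastforce
      then have "path_weight r (m + m') a b = 0" using x long by simp
      then show "(case x of (m, m') \<Rightarrow> tree_coeff m * tree_coeff m' * path_weight r (m + m') a b) = 0"
        by (simp add: m)
    qed
  qed auto
  also have "\<dots> = (\<Sum>m<N. \<Sum>i\<le>m. tree_coeff i * tree_coeff (m - i) * path_weight r (i + (m - i)) a b)"
    by (rule sum.triangle_reindex)
  also have "\<dots> = (\<Sum>m<N. (\<Sum>i\<le>m. tree_coeff i * tree_coeff (m - i)) * path_weight r m a b)"
    by (intro sum.cong refl) (simp add: sum_distrib_right)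
  also have "\<dots> = (\<Sum>m<N. tree_coeff m * path_weight r m a b - (if m = 1 then path_weight r m a b else 0))"
  proof (intro sum.cong refl)
    fix m
    have "(\<Sum>i\<le>m. tree_coeff i * tree_coeff (m - i)) = tree_coeff m - (if m = 1 then 1 else 0)"
      using tree_coeff_rec[of m] by (simp add: algebra_simps)
    then show "(\<Sum>i\<le>m. tree_coeff i * tree_coeff (m - i)) * path_weight r m a b =
        tree_coeff m * path_weight r m a b - (if m = 1 then path_weight r m a b else 0)"
      by (cases "m = 1") (simp_all add: left_diff_distrib del: path_weight.simps)
  qed
  also have "\<dots> = ?F a b - step_weight r a b"
    using less.prems by (simp add: sum_subtractf path_weight_1 del: path_weight.simps)
  finally show ?case by simp
qed

section \<open>Generating polynomials of weighted paths, in the number of steps\<close>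

definition path_poly :: "nat \<Rightarrow> nat \<Rightarrow> complex poly" where
  "path_poly r b = Abs_poly (\<lambda>m. path_weight r m 0 b)"

lemma coeff_path_poly: "coeff (path_poly r b) m = path_weight r m 0 b"
  unfolding path_poly_def
  by (subst coeff_Abs_poly[of b]) (auto simp: path_weight_long)

lemma path_poly_0: "path_poly r 0 = 1"
proof (rule poly_eqI)
  fix m show "coeff (path_poly r 0) m = coeff 1 m"
    by (cases m) (auto simp: coeff_path_poly path_weight_long simp del: path_weight.simps(2))
qed

lemma path_poly_Suc:
  "path_poly r (Suc b) = [:0, 1:] * (path_poly r b - (if b \<ge> 1 \<and> same_side r (b - 1) (Suc b) then path_poly r (b - 1) else 0))"
proof (rule poly_eqI)
  fix m
  show "coeff (path_poly r (Suc b)) m = coeff ([:0, 1:] * (path_poly r b - (if b \<ge> 1 \<and> same_side r (b - 1) (Suc b) then path_poly r (b - 1) else 0))) m"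
  proof (cases m)
    case 0
    then show ?thesis by (simp add: coeff_path_poly)
  next
    case (Suc m')
    let ?g = "\<lambda>i. path_weight r m' 0 i * step_weight r i (Suc b)"
    have "(\<Sum>i\<in>{0..Suc b}. ?g i) = (\<Sum>i\<in>{b - 1, b}. ?g i)"
      by (rule sum.mono_neutral_right) (auto simp: step_weight_def)
    also have "\<dots> = path_weight r m' 0 b - (if b \<ge> 1 \<and> same_side r (b - 1) (Suc b) then path_weight r m' 0 (b - 1) else 0)"
      by (cases b) (auto simp: step_weight_def)
    finally show ?thesis by (simp add: Suc coeff_path_poly)
  qed
qed

text \<open>The path polynomial of a single side. In a variable y it is y^(q/2) times the Chebyshev
  polynomial of the second kind U_q at sqrt(y)/2.\<close>

fun side_poly :: "nat \<Rightarrow> complex poly" where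
  "side_poly 0 = 1"
| "side_poly (Suc 0) = [:0, 1:]"
| "side_poly (Suc (Suc q)) = [:0, 1:] * (side_poly (Suc q) - side_poly q)"

text \<open>A double step over a corner has weight zero, so every contributing path stops at each
  corner and the polynomial is a product over the sides.\<close>

lemma path_poly_eq:
  assumes "r \<ge> 1" "q \<le> r"
  shows "path_poly r (s * r + q) = side_poly r ^ s * side_poly q"
  using assms(2)
proof (induction s arbitrary: q)
  case 0
  then show ?case
  proof (induction q rule: side_poly.induct)
    case 1
    then show ?case by (simp add: path_poly_0)
  next
    case 2
    then show ?case by (simp add: path_poly_Suc path_poly_0)
  next
    case (3 q)
    have "same_side r q (Suc (Suc q))" unfolding same_side_def using 3 by (intro exI[of _ 0]) simp
    then show ?case using 3 by (simp add: path_poly_Suc)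
  qed
next
  case (Suc s)
  note outer = Suc.IH
  from Suc.prems show ?case
  proof (induction q rule: side_poly.induct)
    case 1
    then show ?case using outer[of r] by (simp add: add.commute mult.commute)
  next
    case 2
    have "\<not> same_side r (Suc s * r - 1) (Suc (Suc s * r))"
    proof
      assume "same_side r (Suc s * r - 1) (Suc (Suc s * r))"
      then obtain s' where s': "s' * r \<le> Suc s * r - 1" "Suc (Suc s * r) \<le> Suc s' * r" by (auto simp: same_side_def)
      have "s' * r < Suc s * r"
      proof -
        have "0 < Suc s * r" using assms(1) by simp
        then show ?thesis using s'(1) by linarith
      qed
      then have "Suc s' \<le> Suc s" by (simp only: mult_less_cancel2 Suc_le_eq)
      then have "Suc s' * r \<le> Suc s * r" by (rule mult_le_mono1)
      then show False using s'(2) by (metis Suc_n_not_le_n le_trans)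
    qed
    moreover have "path_poly r (Suc s * r) = side_poly r ^ Suc s" using outer[of r] by (simp add: add.commute mult.commute)
    ultimately show ?case using path_poly_Suc[of r "Suc s * r"] by (simp add: mult.commute)
  next
    case (3 q)
    have "same_side r (Suc s * r + q) (Suc s * r + Suc (Suc q))" unfolding same_side_def using 3 by (intro exI[of _ "Suc s"]) simp
    then have "path_poly r (Suc s * r + Suc (Suc q)) = [:0, 1:] * (path_poly r (Suc s * r + Suc q) - path_poly r (Suc s * r + q))"
      using path_poly_Suc[of r "Suc s * r + Suc q"] by simp
    also have "\<dots> = side_poly r ^ Suc s * side_poly (Suc (Suc q))"
      using 3 by (simp only: side_poly.simps) (simp add: algebra_simps del: mult_Suc)
    finally show ?case .
  qed
qed

text \<open>The recursion for \<open>tri_count r 0 (n - 1)\<close> also admits apexes on the last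
  side. Of these only \<open>i = n - 2\<close> contributes, with
  \<open>tri_count r 0 (n - 2)\<close>. Subtracting it is precisely the last recursion step of
  \<open>side_poly r\<close>, which completes the \<open>k\<close>-th power at the price of one
  factor of the variable; hence the index \<open>Suc m\<close>.\<close>

lemma tr_eq_tree_coeff:
  assumes k: "k \<ge> 3" and r: "r \<ge> 1"
  shows "tr k r = (\<Sum>m<k * r. tree_coeff m * coeff (side_poly r ^ k) (Suc m))"
proof -
  define n where "n = k * r"
  have n3: "3 * r \<le> n" using k by (simp add: n_def)
  let ?c = "\<lambda>a b. of_nat (tri_count r a b) :: complex"
  have nss: "\<not> same_side r 0 (n - 1)"
  proof
    assume "same_side r 0 (n - 1)"
    then obtain s where "s * r \<le> 0" "n - 1 \<le> Suc s * r" by (auto simp: same_side_def)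
    then have "n - 1 \<le> r" using r by simp
    then show False using n3 r by linarith
  qed
  have last: "same_side r i (n - 1)" if "n - r \<le> i" for i
  proof -
    have "(k - 1) * r = n - r" "Suc (k - 1) * r = n" using k by (auto simp: n_def diff_mult_distrib)
    then show ?thesis unfolding same_side_def using that by (intro exI[of _ "k - 1"]) auto
  qed
  have "tr k r = (\<Sum>i\<in>{0<..<n - r}. ?c 0 i * ?c i (n - 1))"
    using tr_eq_sum[OF k r] by (simp add: n_def)
  also have "\<dots> = (\<Sum>i\<in>{0<..<n - 1}. ?c 0 i * ?c i (n - 1)) - (\<Sum>i\<in>{n - r..<n - 1}. ?c 0 i * ?c i (n - 1))"
  proof -
    have "{0<..<n - 1} = {0<..<n - r} \<union> {n - r..<n - 1}" using n3 r by auto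
    then show ?thesis by (simp only: sum.union_disjoint[of "{0<..<n - r}" "{n - r..<n - 1}"] finite_greaterThanLessThan
      finite_atLeastLessThan, subst sum.union_disjoint) auto
  qed
  also have "(\<Sum>i\<in>{0<..<n - 1}. ?c 0 i * ?c i (n - 1)) = ?c 0 (n - 1)"
  proof -
    have "step_weight r 0 (n - 1) = 0" using nss n3 r by (auto simp: step_weight_def)
    then show ?thesis using tri_count_rec[of 0 "n - 1" r] n3 r by simp
  qed
  also have "(\<Sum>i\<in>{n - r..<n - 1}. ?c 0 i * ?c i (n - 1)) = (if r \<ge> 2 then ?c 0 (n - 2) else 0)"
  proof (cases "r \<ge> 2")
    case True
    have "(\<Sum>i\<in>{n - r..<n - 1}. ?c 0 i * ?c i (n - 1)) = (\<Sum>i\<in>{n - 2}. ?c 0 i * ?c i (n - 1))"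
    proof (rule sum.mono_neutral_right)
      show "{n - 2} \<subseteq> {n - r..<n - 1}" using True n3 by auto
      show "\<forall>i\<in>{n - r..<n - 1} - {n - 2}. ?c 0 i * ?c i (n - 1) = 0"
        using last by auto
    qed auto
    moreover have "n - 1 = Suc (n - 2)" using n3 r by simp
    then have "tri_count r (n - 2) (n - 1) = 1" by (metis tri_count_Suc)
    ultimately show ?thesis using True by simp
  next
    case False
    then have "{n - r..<n - 1} = {}" using r by auto
    then show ?thesis using False by simp
  qed
  also have "?c 0 (n - 1) - (if r \<ge> 2 then ?c 0 (n - 2) else 0) =
    (\<Sum>m<n. tree_coeff m * coeff (side_poly r ^ k) (Suc m))"
  proof -
    have c: "?c 0 b = (\<Sum>m<n. tree_coeff m * coeff (path_poly r b) m)" if "0 < b" "b < n" for b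
      using tri_count_eq[of 0 b n r] that by (simp add: coeff_path_poly)
    have kk: "n = (k - 1) * r + r" using k by (simp add: n_def diff_mult_distrib)
    have p1: "path_poly r (n - 1) = side_poly r ^ (k - 1) * side_poly (r - 1)"
      using path_poly_eq[OF r, of "r - 1" "k - 1"] kk r by simp
    have S: "side_poly r ^ k = side_poly r ^ (k - 1) * side_poly r"
      using k by (metis power_minus_mult less_le_trans zero_less_numeral)
    show ?thesis
    proof (cases "r \<ge> 2")
      case True
      have p2: "path_poly r (n - 2) = side_poly r ^ (k - 1) * side_poly (r - 2)"
        using path_poly_eq[OF r, of "r - 2" "k - 1"] kk True by simp
      have "r = Suc (Suc (r - 2))" using True by simp
      then have "side_poly r = [:0, 1:] * (side_poly (r - 1) - side_poly (r - 2))"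
        using side_poly.simps(3)[of "r - 2"] by (metis diff_Suc_1)
      then have "side_poly r ^ k = [:0, 1:] * (path_poly r (n - 1) - path_poly r (n - 2))"
        unfolding S p1 p2 by (metis mult.left_commute right_diff_distrib)
      then have "coeff (side_poly r ^ k) (Suc m) = coeff (path_poly r (n - 1)) m - coeff (path_poly r (n - 2)) m" for m
        by simp
      then show ?thesis using True c[of "n - 1"] c[of "n - 2"] n3 by (simp add: sum_subtractf right_diff_distrib)
    next
      case False
      then have "r = 1" using r by simp
      then have "side_poly r ^ k = [:0, 1:] * path_poly r (n - 1)"
        unfolding S p1 by simp
      then have "coeff (side_poly r ^ k) (Suc m) = coeff (path_poly r (n - 1)) m" for m
        by simp
      then show ?thesis using False c[of "n - 1"] n3 r by simp
    qed
  qed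
  finally show ?thesis by (simp add: n_def)
qed

section \<open>Formal residues and Lagrange inversion\<close>

section \<open>Residues\<close>

text \<open>For \<open>n > 0\<close> the series is, up to the factor \<open>-n\<close>, the
  derivative of \<open>inverse F ^ n\<close> and has no residue; for \<open>n = 0\<close> it is the
  logarithmic derivative.\<close>

lemma fls_residue_deriv_divide_power:
  fixes F :: "'a :: field_char_0 fls"
  shows "fls_residue (fls_deriv F * inverse F ^ Suc n) = (if n = 0 then of_int (fls_subdegree F) else 0)"
proof (cases "n = 0 \<or> F = 0")
  case True
  then show ?thesis using fls_residue_deriv_times_inverse_eq_subdegree(1)[of F] by auto
next
  case False
  then obtain m where m: "n = Suc m" by (cases n) auto
  have "fls_deriv (inverse F ^ Suc m) = - (of_nat (Suc m) * (fls_deriv F * inverse F ^ Suc n))"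
    unfolding fls_deriv_power[of "inverse F" "Suc m"] diff_Suc_1
    using fls_inverse_deriv[of F] False by (simp add: m power2_eq_square mult_ac)
  then have "fls_residue (of_nat (Suc m) * (fls_deriv F * inverse F ^ Suc n)) = 0"
    using fls_residue_deriv[of "inverse F ^ Suc m"] by simp
  moreover have "fls_residue (of_nat (Suc m) * G) = of_nat (Suc m) * fls_residue G" for G :: "'a fls"
    using fls_residue_of_int_times(1)[of "int (Suc m)" G] by simp
  ultimately show ?thesis using False by (simp del: of_nat_Suc)
qed

lemma fls_residue_fps [simp]: "fls_residue (fps_to_fls f) = 0"
  by simp

text \<open>Change of variable in the residue. Splitting off the constant term of \<open>H\<close>
  leaves a factor \<open>F\<close>, which lowers the pole order by one.\<close>

lemma residue_compose_divide_power:
  fixes H :: "'a :: field_char_0 fps"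
  assumes "fps_nth F 0 = 0" "fps_nth F 1 \<noteq> 0"
  shows "fls_residue (fps_to_fls (H oo F) * fls_deriv (fps_to_fls F) * inverse (fps_to_fls F) ^ Suc n) = fps_nth H n"
proof (induction n arbitrary: H)
  let ?F = "fps_to_fls F"
  have nz: "?F \<noteq> 0" using assms by auto
  have "subdegree F = 1" using assms by (intro subdegreeI) auto
  then have sd: "fls_subdegree ?F = 1" by (simp add: fls_subdegree_fls_to_fps)
  have split: "fps_to_fls (H oo F) = fls_const (fps_nth H 0) + ?F * fps_to_fls (fps_shift 1 H oo F)" for H
  proof -
    have "H = fps_const (fps_nth H 0) + fps_X * fps_shift 1 H"
      by (rule fps_ext) (simp add: fps_X_mult_nth)
    then have "H oo F = (fps_const (fps_nth H 0) + fps_X * fps_shift 1 H) oo F" by simp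
    also have "\<dots> = fps_const (fps_nth H 0) + F * (fps_shift 1 H oo F)"
      using assms by (simp add: fps_compose_add_distrib fps_compose_mult_distrib)
    finally show ?thesis by (simp add: fls_times_fps_to_fls fps_const_to_fls)
  qed
  {
    case 0
    have "fps_to_fls (H oo F) * fls_deriv ?F * inverse ?F ^ Suc 0 =
      fls_const (fps_nth H 0) * (fls_deriv ?F * inverse ?F ^ Suc 0) + fps_to_fls ((fps_shift 1 H oo F) * fps_deriv F)"
      unfolding split[of H] fls_times_fps_to_fls fls_deriv_fps_to_fls[symmetric] using nz
      by (simp add: field_simps)
    then show ?case
      using fls_residue_deriv_divide_power[of ?F 0]
      by (simp only: fls_residue_add fls_residue_fls_const_times fls_residue_fps sd) simp
  next
    case (Suc n)
    have "fps_to_fls (H oo F) * fls_deriv ?F * inverse ?F ^ Suc (Suc n) =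
      fls_const (fps_nth H 0) * (fls_deriv ?F * inverse ?F ^ Suc (Suc n)) +
      fps_to_fls (fps_shift 1 H oo F) * fls_deriv ?F * inverse ?F ^ Suc n"
      unfolding split[of H] using nz by (simp add: field_simps)
    then show ?case
      using fls_residue_deriv_divide_power[of ?F "Suc n"] Suc[of "fps_shift 1 H"]
      by (simp only: fls_residue_add fls_residue_fls_const_times) simp
  }
qed

lemma Lagrange_inversion:
  fixes G :: "'a :: field_char_0 fps"
  assumes "fps_nth F 0 = 0" "fps_nth F 1 \<noteq> 0"
  shows "fps_nth (G oo fps_inv F) n =
    fls_residue (fps_to_fls G * fls_deriv (fps_to_fls F) * inverse (fps_to_fls F) ^ Suc n)"
proof -
  have T0: "fps_nth (fps_inv F) 0 = 0" by (simp add: fps_inv_def)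
  have "(G oo fps_inv F) oo F = G oo (fps_inv F oo F)"
    by (rule fps_compose_assoc[symmetric]) (use assms T0 in auto)
  also have "\<dots> = G" using fps_inv[OF assms] by simp
  finally show ?thesis using residue_compose_divide_power[OF assms, of "G oo fps_inv F" n] by simp
qed

section \<open>The number of triangulations as a residue at 0\<close>

abbreviation T :: "complex fls" where "T \<equiv> fls_X"

definition W :: "complex fls" where "W = inverse (T * (1 - T))"

lemma T_neq [simp]: "1 - T \<noteq> 0" "T \<noteq> 1" "1 - 2 * T \<noteq> 0" "2 * T \<noteq> 1" "T * 2 \<noteq> 1"
proof -
  have "fls_nth (2 * T) 0 = 0" by (simp only: mult_2 fls_plus_nth) simp
  then have *: "fls_nth T 0 \<noteq> fls_nth 1 0" "fls_nth (2 * T) 0 \<noteq> fls_nth 1 0" by auto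
  show 1: "T \<noteq> 1" using *(1) by metis
  show 2: "2 * T \<noteq> 1" using *(2) by metis
  show "1 - T \<noteq> 0" using 1 by simp
  show "1 - 2 * T \<noteq> 0" using 2 by simp
  show "T * 2 \<noteq> 1" using 2 by (simp add: mult.commute)
qed

text \<open>\<open>T * (1 - T)\<close> is the series whose compositional inverse defines
  \<open>tree_coeff\<close>, and \<open>1 - 2 * T\<close> is its derivative, so this is Lagrange
  inversion for the identity series.\<close>

lemma residue_W:
  "fls_residue ((1 - 2 * T) * W ^ Suc n) = (if n = 0 then 1 else 0)"
  "fls_residue (T * (1 - 2 * T) * W ^ Suc n) = tree_coeff n"
proof -
  let ?F = "fps_X - fps_X ^ 2 :: complex fps"
  have F: "fps_to_fls ?F = T * (1 - T)"
    by (simp add: fps_to_fls_power power2_eq_square fls_times_fps_to_fls algebra_simps)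
  have D: "fls_deriv (fps_to_fls ?F) = 1 - 2 * T"
    unfolding F by (simp add: algebra_simps)
  have "subdegree ?F = 1" by (rule subdegreeI) auto
  then have sd: "fls_subdegree (fps_to_fls ?F) = 1" by (simp only: fls_subdegree_fls_to_fps of_nat_1)
  show "fls_residue ((1 - 2 * T) * W ^ Suc n) = (if n = 0 then 1 else 0)"
    using fls_residue_deriv_divide_power[of "fps_to_fls ?F" n] unfolding D sd unfolding F W_def by simp
  show "fls_residue (T * (1 - 2 * T) * W ^ Suc n) = tree_coeff n"
    using Lagrange_inversion[of ?F fps_X n] unfolding D unfolding F W_def tree_coeff_def
    by (simp add: fps_X_fps_compose_startby0 fps_inv_def[of "fps_X - fps_X ^ 2"])
qed

text \<open>The generating function of \<open>side_poly\<close> at \<open>W\<close> is \<open>1 / (1 - W z + W z\<^sup>2)\<close>, with poles \<open>z = T\<close> and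
  \<open>z = 1 - T\<close>; \<open>E r\<close> is its \<open>r\<close>-th coefficient.\<close>

definition E :: "nat \<Rightarrow> complex fls" where
  "E r = ((1 - T) ^ Suc r - T ^ Suc r) / ((1 - 2 * T) * (T * (1 - T)) ^ r)"

abbreviation fls_poly :: "complex poly \<Rightarrow> complex fls \<Rightarrow> complex fls" where
  "fls_poly p \<equiv> poly (map_poly fls_const p)"

lemma fls_const_sum: "fls_const (sum f A) = (\<Sum>a\<in>A. fls_const (f a))"
  by (induction A rule: infinite_finite_induct) (auto simp flip: fls_plus_const)

lemma map_poly_fls_const:
  "map_poly fls_const (p + q) = map_poly fls_const p + map_poly fls_const (q :: complex poly)"
  "map_poly fls_const (p - q) = map_poly fls_const p - map_poly fls_const q"
  "map_poly fls_const (p * q) = map_poly fls_const p * map_poly fls_const q"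
  by (rule poly_eqI; simp add: coeff_map_poly coeff_mult fls_const_sum fls_plus_const fls_minus_const)+

text \<open>\<open>T\<close> and \<open>1 - T\<close> are the roots of
  \<open>z^2 = z - T * (1 - T)\<close>, so differences of their powers satisfy the corresponding
  linear recursion.\<close>

lemma E_rec: "E (Suc (Suc q)) = W * (E (Suc q) - E q)"
proof -
  let ?P = "T * (1 - T)"
  have P: "?P \<noteq> 0" by simp
  have "1 - 2 * T \<noteq> 0" by simp
  have e: "E q = ((1 - T) ^ Suc q - T ^ Suc q) / ((1 - 2 * T) * ?P ^ q)" for q
    by (simp only: E_def)
  have "(1 - T) ^ Suc (Suc (Suc q)) - T ^ Suc (Suc (Suc q)) =
    ((1 - T) ^ Suc (Suc q) - T ^ Suc (Suc q)) - ?P * ((1 - T) ^ Suc q - T ^ Suc q)"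
    by (simp add: algebra_simps)
  moreover have "(A - P * B) / (D * P ^ Suc (Suc q)) = inverse P * (A / (D * P ^ Suc q) - B / (D * P ^ q))"
    if "D \<noteq> 0" "P \<noteq> 0" for A B D P :: "complex fls"
    using that by (simp add: field_simps)
  ultimately show ?thesis unfolding e W_def using P \<open>1 - 2 * T \<noteq> 0\<close> by (simp only:)
qed

lemma fls_poly_side_poly: "fls_poly (side_poly q) W = E q"
proof (induction q rule: side_poly.induct)
  case 1
  have "(1 - T) - T = 1 - 2 * T" by simp
  then show ?case by (simp add: E_def)
next
  case 2
  have "(1 - T) ^ 2 - T ^ 2 = 1 - 2 * T" by (simp add: power2_eq_square algebra_simps)
  then have "E (Suc 0) = (1 - 2 * T) / ((1 - 2 * T) * (T * (1 - T)))"
    by (simp add: E_def power2_eq_square)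
  then have "E (Suc 0) = W" unfolding W_def by (simp add: inverse_eq_divide)
  then show ?case by (simp add: map_poly_pCons)
next
  case (3 q)
  have "fls_poly [:0, 1:] W = W" by (simp add: map_poly_pCons)
  then show ?case by (simp only: side_poly.simps map_poly_fls_const poly_mult poly_diff 3 E_rec)
qed

lemma fls_poly_power: "fls_poly (p ^ k) x = fls_poly p x ^ k"
  by (induction k) (simp_all add: map_poly_fls_const)

lemma side_poly_dvd: "q \<ge> 1 \<Longrightarrow> [:0, 1:] dvd side_poly q"
proof (induction q rule: side_poly.induct)
  case (3 q)
  show ?case unfolding side_poly.simps by (rule dvd_triv_left)
qed auto

text \<open>\<open>E r ^ k\<close> is a polynomial in \<open>W\<close>, so both residues are read
  off from \<open>residue_W\<close> term by term. The second one is the coefficient of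
  \<open>W\<close> itself, which is absent because two factors \<open>side_poly r\<close> already
  contribute \<open>W ^ 2\<close>.\<close>

lemma residue_E_power:
  assumes "k \<ge> 2" "r \<ge> 1" "degree (side_poly r ^ k) \<le> N"
  shows "fls_residue (T * (1 - 2 * T) * E r ^ k) = (\<Sum>m<N. tree_coeff m * coeff (side_poly r ^ k) (Suc m))"
    and "fls_residue ((1 - 2 * T) * E r ^ k) = 0"
proof -
  let ?p = "side_poly r ^ k"
  have "[:0, 1:] ^ 2 dvd side_poly r ^ k"
    using dvd_power_same[OF side_poly_dvd[OF assms(2)], of k] assms(1) le_imp_power_dvd dvd_trans by blast
  then obtain p' where "?p = [:0, 1:] ^ 2 * p'" by (auto elim: dvdE)
  then have c0: "coeff ?p 0 = 0" "coeff ?p 1 = 0" by (simp_all add: power2_eq_square)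
  have "E r ^ k = fls_poly ?p W" by (simp add: fls_poly_power fls_poly_side_poly)
  also have "\<dots> = (\<Sum>i\<le>N. fls_const (coeff ?p i) * W ^ i)"
  proof -
    have "degree (map_poly fls_const ?p) \<le> N" using assms(3) by (intro degree_le) (auto simp: coeff_map_poly coeff_eq_0)
    then have "fls_poly ?p W = (\<Sum>i\<le>N. coeff (map_poly fls_const ?p) i * W ^ i)"
      unfolding poly_altdef by (intro sum.mono_neutral_left) (auto simp: coeff_eq_0)
    then show ?thesis by (simp add: coeff_map_poly)
  qed
  also have "\<dots> = (\<Sum>i<Suc N. fls_const (coeff ?p i) * W ^ i)" by (simp only: lessThan_Suc_atMost)
  also have "\<dots> = (\<Sum>m<N. fls_const (coeff ?p (Suc m)) * W ^ Suc m)"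
    by (subst sum.lessThan_Suc_shift) (simp add: c0)
  finally have E: "E r ^ k = (\<Sum>m<N. fls_const (coeff ?p (Suc m)) * W ^ Suc m)" .
  have R: "fls_residue (G * E r ^ k) = (\<Sum>m<N. coeff ?p (Suc m) * fls_residue (G * W ^ Suc m))" for G
  proof -
    have "G * E r ^ k = (\<Sum>m<N. fls_const (coeff ?p (Suc m)) * (G * W ^ Suc m))"
      unfolding E by (simp add: sum_distrib_left mult_ac)
    moreover have "fls_residue (sum f A) = (\<Sum>a\<in>A. fls_residue (f a))" for f :: "nat \<Rightarrow> complex fls" and A
      by (induction A rule: infinite_finite_induct) auto
    ultimately show ?thesis by (simp only: fls_residue_fls_const_times)
  qed
  show "fls_residue (T * (1 - 2 * T) * E r ^ k) = (\<Sum>m<N. tree_coeff m * coeff (side_poly r ^ k) (Suc m))"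
    unfolding R residue_W by (simp add: mult.commute)
  show "fls_residue ((1 - 2 * T) * E r ^ k) = 0"
    unfolding R residue_W using c0 by (intro sum.neutral ballI) simp
qed

lemma degree_side_poly: "degree (side_poly q) \<le> q"
proof (induction q rule: side_poly.induct)
  case (3 q)
  have "degree ([:0, 1:] * (side_poly (Suc q) - side_poly q)) \<le> degree [:0, 1 :: complex:] + degree (side_poly (Suc q) - side_poly q)"
    by (rule degree_mult_le)
  also have "degree (side_poly (Suc q) - side_poly q) \<le> Suc q"
    using 3 by (intro degree_diff_le) auto
  finally show ?case by simp
qed auto

text \<open>\<open>(1 - 2 * T)^2\<close> equals \<open>(1 - 2 * T) - 2 * T * (1 - 2 * T)\<close>,
  and the first part has residue zero against \<open>E r ^ k\<close>. This is the origin of the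
  factor -1/2, and it brings the formula into the shape that defines the case
  \<open>k = 2\<close>.\<close>

lemma tr_eq_residue_ge_3:
  assumes "k \<ge> 3" "r \<ge> 1"
  shows "tr k r = - (1 / 2) * fls_residue ((1 - 2 * T) ^ 2 * E r ^ k)"
proof -
  have "degree (side_poly r ^ k) \<le> k * r"
    using degree_power_le[of "side_poly r" k] degree_side_poly[of r]
    by (metis le_trans mult.commute mult_le_mono1)
  from residue_E_power[OF _ assms(2) this] assms
  have 1: "fls_residue (T * (1 - 2 * T) * E r ^ k) = tr k r" and 2: "fls_residue ((1 - 2 * T) * E r ^ k) = 0"
    by (simp_all add: tr_eq_tree_coeff)
  have "(1 - 2 * T) ^ 2 * E r ^ k + (T * (1 - 2 * T) * E r ^ k + T * (1 - 2 * T) * E r ^ k) = (1 - 2 * T) * E r ^ k"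
    by (simp add: power2_eq_square algebra_simps)
  then have "fls_residue ((1 - 2 * T) ^ 2 * E r ^ k) + (tr k r + tr k r) = 0"
    using 1 2 by (metis fls_residue_add)
  moreover have "t = - (1 / 2) * R" if "R + (t + t) = 0" for R t :: complex
    using that by (simp add: field_simps eq_neg_iff_add_eq_0)
  ultimately show ?thesis by blast
qed

lemma tr_2_eq_residue:
  assumes "r \<ge> 1"
  shows "tr 2 r = - (1 / 2) * fls_residue ((1 - 2 * T) ^ 2 * E r ^ 2)"
proof -
  define f where "f = (\<lambda>t :: complex. ((1 - t) ^ (r + 1) - t ^ (r + 1))\<^sup>2 / (t ^ (2 * r) * (1 - t) ^ (2 * r)))"
  have "f has_laurent_expansion ((1 - T) ^ (r + 1) - T ^ (r + 1))\<^sup>2 / (T ^ (2 * r) * (1 - T) ^ (2 * r))"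
    unfolding f_def by (intro laurent_expansion_intros)
  then have res: "residue f 0 = fls_residue (((1 - T) ^ (r + 1) - T ^ (r + 1))\<^sup>2 / (T ^ (2 * r) * (1 - T) ^ (2 * r)))"
    by (rule has_laurent_expansion_residue_0)
  have hol: "f holomorphic_on ball 0 1 - {0}"
    unfolding f_def by (intro holomorphic_intros) auto
  \<comment> \<open>The unit disc contains the circle of radius 1/2 but not the pole at 1.\<close>
  have "contour_integral (circlepath 0 (1/2)) f = 2 * pi * \<i> * residue f 0"
    using base_residue[of "ball 0 1" 0 "1/2" f] hol contour_integral_unique by (auto simp: subset_eq)
  then have "tr 2 r = - (1 / (4 * pi * \<i>)) * (2 * pi * \<i> * residue f 0)"
    unfolding tr_def f_def by simp
  also have "\<dots> = - (1 / 2) * residue f 0" by (simp add: field_simps)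
  moreover have "((1 - T) ^ (r + 1) - T ^ (r + 1))\<^sup>2 / (T ^ (2 * r) * (1 - T) ^ (2 * r)) = (1 - 2 * T) ^ 2 * E r ^ 2"
  proof -
    have "(1 - 2 * T) * (A / ((1 - 2 * T) * B)) = A / B" for A B by simp
    then have "(1 - 2 * T) * E r = ((1 - T) ^ (r + 1) - T ^ (r + 1)) / (T * (1 - T)) ^ r"
      unfolding E_def by simp
    then have "((1 - 2 * T) * E r) ^ 2 = (((1 - T) ^ (r + 1) - T ^ (r + 1)) / (T * (1 - T)) ^ r) ^ 2" by simp
    then show ?thesis unfolding power_divide power_mult_distrib power_mult[symmetric] mult.commute[of 2 r] by simp
  qed
  ultimately show ?thesis unfolding res by simp
qed

lemma tr_eq_residue:
  assumes "k \<ge> 2" "r \<ge> 1"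
  shows "tr k r = - (1 / 2) * fls_residue ((1 - 2 * T) ^ 2 * E r ^ k)"
  using tr_eq_residue_ge_3[of k r] tr_2_eq_residue[of r] assms by (cases "k = 2") auto

section \<open>The small zeros as conjugate branches of a single inverse series\<close>

section \<open>Puiseux series and the small zeros\<close>

text \<open>\<open>puiseux_root d F\<close> is \<open>F(x\<^bsup>1/d\<^esup>)\<close>.\<close>

definition puiseux_root :: "nat \<Rightarrow> 'a :: zero fls \<Rightarrow> 'a puiseux" where
  "puiseux_root d F = abs_puiseux (d, F)"

lemma puiseux_rel_refl [simp]: "puiseux_rel (d, F) (d, F) \<longleftrightarrow> d > 0"
  by (simp add: puiseux_rel_def)

lemma puiseux_root_eq_iff:
  "d > 0 \<Longrightarrow> e > 0 \<Longrightarrow> puiseux_root d F = puiseux_root e G \<longleftrightarrow> fls_compose_power F e = fls_compose_power G d"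
  using Quotient3_rel[OF Quotient3_puiseux, of "(d, F)" "(e, G)"] by (simp add: puiseux_root_def puiseux_rel_def)

lemma puiseux_root_inject [simp]: "d > 0 \<Longrightarrow> puiseux_root d F = puiseux_root d G \<longleftrightarrow> F = G"
  by (auto simp: puiseux_root_eq_iff dest: fls_compose_power_inject)

lemma puiseux_root_compose_power:
  assumes "d > 0" "e > 0"
  shows "puiseux_root (d * e) (fls_compose_power F e) = puiseux_root d F"
  using assms by (subst puiseux_root_eq_iff) (auto simp: fls_compose_power_compose mult.commute)

lemma puiseux_root_cases:
  obtains d F where "d > 0" "t = puiseux_root d F"
proof -
  obtain d F where dF: "rep_puiseux t = (d, F)" by fastforce
  have "puiseux_rel (d, F) (d, F)" "abs_puiseux (d, F) = t"
    using Quotient3_rep_reflp[OF Quotient3_puiseux, of t] Quotient3_abs_rep[OF Quotient3_puiseux, of t] by (simp_all add: dF)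
  then show ?thesis using that[of d F] by (simp add: puiseux_root_def)
qed

lemma puiseux_small_root: "d > 0 \<Longrightarrow> puiseux_small (puiseux_root d F) \<longleftrightarrow> (\<forall>n\<le>0. fls_nth F n = 0)"
  by (simp add: puiseux_root_def puiseux_small.abs_eq)

lemma puiseux_of_fls_eq_root: "puiseux_of_fls F = puiseux_root 1 F"
  by (simp add: puiseux_of_fls_def puiseux_root_def)

lemma puiseux_root_0 [simp]: "d > 0 \<Longrightarrow> puiseux_root d 0 = 0"
  unfolding zero_puiseux_def puiseux_root_def[symmetric] by (simp add: puiseux_root_eq_iff)

lemma puiseux_root_1 [simp]: "d > 0 \<Longrightarrow> puiseux_root d 1 = (1 :: 'a :: field puiseux)"
  unfolding one_puiseux_def puiseux_root_def[symmetric] by (simp add: puiseux_root_eq_iff)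

context
  fixes d :: nat
  assumes d: "d > 0"
begin

lemma puiseux_root_add: "puiseux_root d (F + G) = puiseux_root d F + puiseux_root d (G :: 'a :: field fls)"
  using d puiseux_root_compose_power[OF d d, of "F + G"] by (simp add: puiseux_root_def plus_puiseux.abs_eq)

lemma puiseux_root_diff: "puiseux_root d (F - G) = puiseux_root d F - puiseux_root d (G :: 'a :: field fls)"
  using d puiseux_root_compose_power[OF d d, of "F - G"] by (simp add: puiseux_root_def minus_puiseux.abs_eq)

lemma puiseux_root_mult: "puiseux_root d (F * G) = puiseux_root d F * puiseux_root d (G :: 'a :: field fls)"
  using d puiseux_root_compose_power[OF d d, of "F * G"] by (simp add: puiseux_root_def times_puiseux.abs_eq)

lemma puiseux_root_uminus: "puiseux_root d (- F) = - puiseux_root d (F :: 'a :: field fls)"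
  using d by (simp add: puiseux_root_def uminus_puiseux.abs_eq)

lemma puiseux_root_inverse: "puiseux_root d (inverse F) = inverse (puiseux_root d (F :: 'a :: field fls))"
  using d by (simp add: puiseux_root_def inverse_puiseux.abs_eq)

lemma puiseux_root_divide: "puiseux_root d (F / G) = puiseux_root d F / puiseux_root d (G :: 'a :: field fls)"
  by (simp add: divide_inverse puiseux_root_mult puiseux_root_inverse)

lemma puiseux_root_power: "puiseux_root d (F ^ n) = puiseux_root d (F :: 'a :: field fls) ^ n"
  using d by (induction n) (simp_all add: puiseux_root_mult)

lemma puiseux_root_of_nat: "puiseux_root d (of_nat n) = (of_nat n :: 'a :: field puiseux)"
  using d by (induction n) (simp_all add: puiseux_root_add)

lemma puiseux_root_numeral: "puiseux_root d (numeral n) = (numeral n :: 'a :: field puiseux)"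
  using puiseux_root_of_nat[of "numeral n"] by simp

lemma puiseux_root_sum: "puiseux_root d (sum f A) = (\<Sum>a\<in>A. puiseux_root d (f a :: 'a :: field fls))"
  using d by (induction A rule: infinite_finite_induct) (simp_all add: puiseux_root_add)

lemmas puiseux_root_hom = puiseux_root_add puiseux_root_diff puiseux_root_mult puiseux_root_uminus
  puiseux_root_divide puiseux_root_power puiseux_root_of_nat puiseux_root_numeral puiseux_root_1[OF d]

lemma puiseux_X_eq_root: "puiseux_X = puiseux_root d (fls_X ^ d)"
  using puiseux_root_compose_power[of 1 d fls_X, symmetric] d
  by (simp add: puiseux_X_def puiseux_of_fls_eq_root fls_X_power_conv_shift_1)

end

lemma fps_to_fls_inverse: "fps_nth f 0 \<noteq> 0 \<Longrightarrow> fps_to_fls (inverse f) = inverse (fps_to_fls (f :: 'a :: field fps))"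
  by (subst fls_inverse_fps_to_fls) (auto simp: subdegree_eq_0_iff)

text \<open>\<open>X (1 - X)\<^bsup>j/m\<^esup>\<close>, whose \<open>m\<close>-th power is \<open>X\<^sup>m (1 - X)\<^sup>j\<close>.\<close>

definition phi :: "nat \<Rightarrow> nat \<Rightarrow> complex fps" where
  "phi j m = fps_X * (fps_binomial (of_nat j / of_nat m) oo (- fps_X))"

lemma phi_nth [simp]: "fps_nth (phi j m) 0 = 0" "fps_nth (phi j m) (Suc 0) = 1"
  by (simp_all add: phi_def)

lemma phi_power:
  assumes "m > 0"
  shows "phi j m ^ m = fps_X ^ m * (1 - fps_X) ^ j"
proof -
  have "(fps_binomial (of_nat j / of_nat m) oo (- fps_X)) ^ m = fps_binomial (of_nat j) oo (- fps_X :: complex fps)"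
    using assms by (subst fps_compose_power) (simp_all add: fps_binomial_power)
  also have "\<dots> = (1 - fps_X) ^ j"
    unfolding fps_binomial_of_nat by (subst fps_compose_power[symmetric]) (simp_all add: fps_compose_add_distrib)
  finally show ?thesis by (simp add: phi_def power_mult_distrib)
qed

abbreviation psi :: "nat \<Rightarrow> nat \<Rightarrow> complex fps" where
  "psi j m \<equiv> fps_inv (phi j m)"

lemma psi_nth [simp]: "fps_nth (psi j m) 0 = 0" "fps_nth (psi j m) (Suc 0) = 1"
  by (simp_all add: fps_inv_def)

definition branch :: "nat \<Rightarrow> nat \<Rightarrow> complex \<Rightarrow> complex fps" where
  "branch j m z = psi j m oo (fps_const z * fps_X)"

lemma branch_nth: "fps_nth (branch j m z) n = z ^ n * fps_nth (psi j m) n"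
  by (simp add: branch_def fps_compose_linear)

text \<open>After division by the monomial and by the constant term \<open>z\<close>, a series
  \<open>c\<close> with constant term 1 and \<open>c ^ m = 1\<close> remains. The cofactor of
  \<open>c - 1\<close> in \<open>c ^ m - 1\<close> has constant term \<open>m\<close>, hence is
  nonzero, and \<open>c = 1\<close>.\<close>

lemma fps_power_eq_X_power:
  fixes f :: "complex fps"
  assumes "f ^ m = fps_X ^ (d * m)" "m > 0"
  obtains z where "z ^ m = 1" "f = fps_const z * fps_X ^ d"
proof -
  have "f \<noteq> 0" using assms by (metis fps_X_power_iff power_0_left zero_neq_one fps_zero_nth fps_X_power_nth less_numeral_extra(3))
  have "m * subdegree f = d * m"
    using arg_cong[OF assms(1), of subdegree] by (simp add: mult.commute)
  then have sd: "subdegree f = d" using assms(2) by simp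
  define b where "b = fps_shift d f"
  have f: "f = b * fps_X ^ d" using subdegree_decompose[of f] by (simp add: b_def sd)
  have "b ^ m * fps_X ^ (d * m) = 1 * fps_X ^ (d * m)"
    using assms(1) unfolding f by (simp add: power_mult_distrib power_mult)
  then have bm: "b ^ m = 1" by (simp only: mult_cancel_right) simp
  define z where "z = fps_nth b 0"
  have zm: "z ^ m = 1" using arg_cong[OF bm, of "\<lambda>f. fps_nth f 0"] by (simp add: z_def fps_nth_power_0)
  then have z0: "z \<noteq> 0" using assms(2) by (auto simp: power_0_left)
  define c where "c = fps_const (1 / z) * b"
  have "c ^ m = 1" using zm bm by (simp add: c_def power_mult_distrib fps_const_power power_one_over)
  then have "(c - 1) * (\<Sum>i<m. c ^ i) = 0" using power_diff_1_eq[of c m] by simp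
  moreover have "fps_nth (\<Sum>i<m. c ^ i) 0 = of_nat m"
    using z0 by (simp add: fps_sum_nth fps_nth_power_0 c_def z_def)
  then have "(\<Sum>i<m. c ^ i) \<noteq> 0" using assms(2) by auto
  ultimately have "c = 1" by simp
  moreover have "fps_const z * c = b" using z0 by (simp add: c_def mult.assoc[symmetric])
  ultimately have "b = fps_const z" by simp
  with f zm show ?thesis using that by blast
qed

lemma poly_Q_root:
  assumes "d > 0"
  shows "poly (Q j k) (puiseux_root d F) = 0 \<longleftrightarrow> F ^ (k - j) * (1 - F) ^ j = fls_X ^ d"
proof -
  have "poly (Q j k) (puiseux_root d F) = puiseux_root d F ^ (k - j) * (1 - puiseux_root d F) ^ j - puiseux_X"
    by (simp add: Q_def)
  also have "\<dots> = puiseux_root d (F ^ (k - j) * (1 - F) ^ j) - puiseux_root d (fls_X ^ d)"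
    using assms by (simp add: puiseux_root_hom puiseux_X_eq_root[of d])
  finally show ?thesis using assms by simp
qed

lemma small_fls_eq_fps:
  fixes F :: "'a :: zero fls"
  assumes "\<forall>n\<le>0. fls_nth F n = 0"
  obtains f where "F = fps_to_fls f" "fps_nth f 0 = 0"
proof
  show "F = fps_to_fls (fls_regpart F)"
    using assms by (intro fls_eqI) (auto simp: not_le)
  show "fps_nth (fls_regpart F) 0 = 0" using assms by simp
qed

text \<open>For a small \<open>t\<close> the series \<open>(1 - t) ^ k\<close> has constant term 1,
  so it cannot be equal to \<open>x\<close>.\<close>

lemma small_zeros_eq_empty: "small_zeros k k = {}"
proof -
  have False if "t \<in> small_zeros k k" for t
  proof -
    obtain d F where d: "d > 0" and t: "t = puiseux_root d F" by (rule puiseux_root_cases)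
    have "\<forall>n\<le>0. fls_nth F n = 0" "(1 - F) ^ k = fls_X ^ d"
      using that by (auto simp: small_zeros_def t poly_Q_root[OF d] puiseux_small_root[OF d])
    then obtain f where f: "F = fps_to_fls f" "fps_nth f 0 = 0" "(1 - F) ^ k = fls_X ^ d"
      by (metis small_fls_eq_fps)
    then have "fps_to_fls ((1 - f) ^ k) = fps_to_fls (fps_X ^ d)" by (simp add: fps_to_fls_power)
    then have "(1 - f) ^ k = fps_X ^ d" by simp
    then have "fps_nth ((1 - f) ^ k) 0 = fps_nth (fps_X ^ d) 0" by simp
    then show False using f(2) d by (simp add: fps_nth_power_0 power_0_left)
  qed
  then show ?thesis by blast
qed

context
  fixes j k m :: nat
  assumes m: "m > 0" "m = k - j"
begin

lemma phi_compose_power: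
  assumes f: "fps_nth f 0 = 0"
  shows "(phi j m oo f) ^ m = f ^ m * (1 - f) ^ j"
proof -
  have "(phi j m oo f) ^ m = (fps_X ^ m * (1 - fps_X) ^ j) oo f"
    using f by (simp add: fps_compose_power phi_power[OF m(1)])
  also have "\<dots> = (fps_X oo f) ^ m * ((1 - fps_X) oo f) ^ j"
    unfolding fps_compose_power[OF f] by (rule fps_compose_mult_distrib[OF f])
  finally show ?thesis using f by (simp add: fps_compose_sub_distrib)
qed

lemma branch_small_zero:
  assumes "z ^ m = 1"
  shows "puiseux_root m (fps_to_fls (branch j m z)) \<in> small_zeros j k"
proof -
  let ?f = "branch j m z"
  have f0: "fps_nth ?f 0 = 0" by (simp add: branch_nth)
  have "phi j m oo ?f = (phi j m oo psi j m) oo (fps_const z * fps_X)"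
    unfolding branch_def by (rule fps_compose_assoc) simp_all
  also have "phi j m oo psi j m = fps_X" by (rule fps_inv_right) simp_all
  finally have "(phi j m oo ?f) ^ m = fps_X ^ m" using assms by (simp add: power_mult_distrib fps_const_power)
  then have "?f ^ m * (1 - ?f) ^ j = fps_X ^ m" by (simp only: phi_compose_power[OF f0])
  then have "fps_to_fls (?f ^ m * (1 - ?f) ^ j) = fps_to_fls (fps_X ^ m)" by simp
  then have "fps_to_fls ?f ^ m * (1 - fps_to_fls ?f) ^ j = fls_X ^ m"
    by (simp add: fls_times_fps_to_fls fps_to_fls_power)
  moreover have "fls_nth (fps_to_fls ?f) n = 0" if "n \<le> 0" for n using that f0 by (auto simp: le_less)
  ultimately show ?thesis
    unfolding small_zeros_def using m by (simp add: poly_Q_root puiseux_small_root)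
qed

text \<open>A zero may be given with any denominator \<open>d\<close>. Over the denominator
  \<open>d * m\<close> the right-hand side becomes an \<open>m\<close>-th power, and the root taken
  there is a multiple of \<open>fps_X ^ d\<close>. Inverting \<open>phi\<close> shows that the zero
  is a series in \<open>fps_X ^ d\<close>, which brings the denominator back to
  \<open>m\<close>.\<close>

lemma small_zero_branch:
  assumes "t \<in> small_zeros j k"
  shows "\<exists>z. z ^ m = 1 \<and> t = puiseux_root m (fps_to_fls (branch j m z))"
proof -
  obtain d F where d: "d > 0" and t0: "t = puiseux_root d F" by (rule puiseux_root_cases)
  have dm: "d * m > 0" using d m by simp
  have t: "t = puiseux_root (d * m) (fls_compose_power F m)"
    unfolding t0 using puiseux_root_compose_power d m by metis
  define F' where "F' = fls_compose_power F m"
  have F': "\<forall>n\<le>0. fls_nth F' n = 0" "F' ^ m * (1 - F') ^ j = fls_X ^ (d * m)"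
    using assms unfolding small_zeros_def t F'_def[symmetric]
    by (simp_all add: poly_Q_root[OF dm] puiseux_small_root[OF dm] flip: m(2))
  obtain f where f: "F' = fps_to_fls f" "fps_nth f 0 = 0" using small_fls_eq_fps[OF F'(1)] .
  have "fps_to_fls (f ^ m * (1 - f) ^ j) = fps_to_fls (fps_X ^ (d * m))"
    using F'(2) by (simp add: f(1) fls_times_fps_to_fls fps_to_fls_power)
  then have "f ^ m * (1 - f) ^ j = fps_X ^ (d * m)" by (simp only: fps_to_fls_eq_iff)
  then have "(phi j m oo f) ^ m = fps_X ^ (d * m)" by (simp only: phi_compose_power[OF f(2)])
  then obtain z where z: "z ^ m = 1" "phi j m oo f = fps_const z * fps_X ^ d"
    using fps_power_eq_X_power m(1) by metis
  have "f = (psi j m oo phi j m) oo f" using f(2) by (simp add: fps_inv)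
  also have "\<dots> = psi j m oo (phi j m oo f)"
    by (rule fps_compose_assoc[symmetric]) (use f in simp_all)
  also have "\<dots> = psi j m oo ((fps_const z * fps_X) oo fps_X ^ d)"
    using d by (simp add: z fps_compose_mult_distrib)
  also have "\<dots> = branch j m z oo fps_X ^ d"
    unfolding branch_def by (rule fps_compose_assoc) (use d in simp_all)
  finally have "F' = fls_compose_power (fps_to_fls (branch j m z)) d"
    using d by (simp add: f(1) fls_compose_power_fps_to_fls)
  then have "t = puiseux_root m (fps_to_fls (branch j m z))"
    unfolding t F'_def[symmetric] using puiseux_root_compose_power[OF m(1) d] by (simp add: mult.commute)
  then show ?thesis using z(1) by blast
qed

lemma small_zeros_eq: "small_zeros j k = (\<lambda>z. puiseux_root m (fps_to_fls (branch j m z))) ` {z. z ^ m = 1}"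
  using branch_small_zero small_zero_branch by blast

lemma inj_branch: "inj_on (\<lambda>z. puiseux_root m (fps_to_fls (branch j m z))) A"
proof (rule inj_onI)
  fix y z assume "puiseux_root m (fps_to_fls (branch j m y)) = puiseux_root m (fps_to_fls (branch j m z))"
  \<comment> \<open>The linear coefficient of a branch is the root of unity itself.\<close>
  then have "fps_nth (branch j m y) (Suc 0) = fps_nth (branch j m z) (Suc 0)" using m by simp
  then show "y = z" by (simp add: branch_nth)
qed

lemma card_small_zeros: "card (small_zeros j k) = m"
  unfolding small_zeros_eq card_image[OF inj_branch] using m by (simp add: card_complex_roots_unity)

end

lemma sum_roots_unity_power:
  assumes "m > 0"
  shows "(\<Sum>z | z ^ m = 1. z ^ n) = (if m dvd n then of_nat m else 0 :: complex)"
proof (cases "m dvd n")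
  case True
  then obtain l where "n = m * l" by (auto elim: dvdE)
  then have "(\<Sum>z | z ^ m = 1. z ^ n) = (\<Sum>z :: complex | z ^ m = 1. 1 :: complex)"
    by (intro sum.cong) (auto simp: power_mult)
  then show ?thesis using True assms by (simp add: card_complex_roots_unity)
next
  case False
  define w where "w = exp (2 * of_real pi * \<i> * of_nat 1 / of_nat m)"
  have wm: "w ^ m = 1" unfolding w_def using assms by (intro complex_root_unity) simp
  have "w ^ n = exp (2 * of_real pi * \<i> * of_nat n / of_nat m)"
    by (simp add: w_def field_simps flip: exp_of_nat_mult)
  then have wn: "w ^ n \<noteq> 1" using False assms complex_root_unity_eq_1[of m n] by simp
  have w0: "w \<noteq> 0" by (simp add: w_def)
  \<comment> \<open>Multiplication by \<open>w\<close> permutes the roots of unity and scales the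
    sum by \<open>w ^ n\<close>, which differs from 1.\<close>
  have "(\<Sum>z | z ^ m = 1. z ^ n) = (\<Sum>z | z ^ m = 1. (w * z) ^ n)"
    by (rule sum.reindex_bij_witness[of _ "\<lambda>z. w * z" "\<lambda>z. z / w"])
       (use w0 wm in \<open>auto simp: power_mult_distrib power_divide\<close>)
  also have "\<dots> = w ^ n * (\<Sum>z | z ^ m = 1. z ^ n)" by (simp add: power_mult_distrib sum_distrib_left)
  finally have "(1 - w ^ n) * (\<Sum>z | z ^ m = 1. z ^ n) = 0" by (simp add: algebra_simps)
  then show ?thesis using wn False by simp
qed

text \<open>Root-of-unity filter: only exponents divisible by \<open>m\<close> survive, and these
  are integral powers of \<open>x\<close>.\<close>

lemma sum_branches:
  assumes "m > 0"
  shows "(\<Sum>z | z ^ m = 1. puiseux_root m (fps_to_fls (H oo (fps_const z * fps_X)))) =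
    puiseux_of_fps (Abs_fps (\<lambda>r. of_nat m * fps_nth H (m * r)) :: complex fps)"
proof -
  let ?K = "Abs_fps (\<lambda>r. of_nat m * fps_nth H (m * r))"
  have "(\<Sum>z | z ^ m = 1. H oo (fps_const z * fps_X)) = ?K oo fps_X ^ m"
  proof (rule fps_ext)
    fix n
    have "fps_nth (\<Sum>z | z ^ m = 1. H oo (fps_const z * fps_X)) n = (\<Sum>z | z ^ m = 1. z ^ n) * fps_nth H n"
      by (simp add: fps_sum_nth fps_compose_linear sum_distrib_right)
    also have "\<dots> = fps_nth (?K oo fps_X ^ m) n"
      using assms by (simp add: sum_roots_unity_power fps_nth_compose_X_power)
    finally show "fps_nth (\<Sum>z | z ^ m = 1. H oo (fps_const z * fps_X)) n = fps_nth (?K oo fps_X ^ m) n" .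
  qed
  then have "fps_to_fls (\<Sum>z | z ^ m = 1. H oo (fps_const z * fps_X)) = fls_compose_power (fps_to_fls ?K) m"
    using assms by (simp add: fls_compose_power_fps_to_fls)
  moreover have "fps_to_fls (sum f A) = (\<Sum>a\<in>A. fps_to_fls (f a))" for f :: "complex \<Rightarrow> complex fps" and A
    by (induction A rule: infinite_finite_induct) auto
  ultimately have "(\<Sum>z | z ^ m = 1. fps_to_fls (H oo (fps_const z * fps_X))) = fls_compose_power (fps_to_fls ?K) m"
    by simp
  then have "(\<Sum>z | z ^ m = 1. puiseux_root m (fps_to_fls (H oo (fps_const z * fps_X)))) = puiseux_root m (fls_compose_power (fps_to_fls ?K) m)"
    by (simp flip: puiseux_root_sum[OF assms])
  also have "\<dots> = puiseux_root 1 (fps_to_fls ?K)"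
    using puiseux_root_compose_power[of 1 m "fps_to_fls ?K"] assms by simp
  finally show ?thesis by (simp only: puiseux_of_fls_eq_root)
qed

section \<open>From residues to coefficients of the sum over the small zeros\<close>

section \<open>The sum over the small zeros\<close>

text \<open>A term of the binomial expansion of the \<open>k\<close>-th power after
  \<open>T^(j r) * (1 - T)^((k - j) r)\<close> has been cancelled, which leaves \<open>r\<close> in
  a single exponent.\<close>

definition summand :: "nat \<Rightarrow> nat \<Rightarrow> nat \<Rightarrow> complex fls" where
  "summand k r j = T ^ j * (1 - T) ^ (k - j) / ((1 - 2 * T) ^ (k - 2) * (T ^ (k - j) * (1 - T) ^ j) ^ r)"

lemma tr_eq_sum_summands:
  assumes "k \<ge> 2" "r \<ge> 1"
  shows "tr k r = - (1 / 2) * (\<Sum>j\<le>k. (-1) ^ j * of_nat (k choose j) * fls_residue (summand k r j))"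
proof -
  let ?A = "(1 - T) ^ Suc r" and ?B = "T ^ Suc r" and ?D = "1 - 2 * T" and ?P = "T * (1 - T)"
  have "?D ^ k = ?D ^ 2 * ?D ^ (k - 2)" using assms(1) by (metis le_add_diff_inverse power_add)
  then have "?D ^ 2 * E r ^ k = (?A - ?B) ^ k / (?D ^ (k - 2) * (?P ^ r) ^ k)"
    unfolding E_def power_divide power_mult_distrib[of ?D] by (simp del: power_Suc)
  also have "(?A - ?B) ^ k = (\<Sum>j\<le>k. of_nat (k choose j) * (- ?B) ^ j * ?A ^ (k - j))"
    using binomial_ring[of "- ?B" ?A k] by (simp del: power_Suc)
  also have "\<dots> / (?D ^ (k - 2) * (?P ^ r) ^ k) = (\<Sum>j\<le>k. of_int ((-1) ^ j * int (k choose j)) * summand k r j)"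
    unfolding sum_divide_distrib
  proof (rule sum.cong[OF refl])
    fix j assume "j \<in> {..k}"
    then obtain m where m: "k = j + m" using le_Suc_ex by auto
    have P: "(?P ^ r) ^ k = (T ^ m * (1 - T) ^ j) ^ r * (T ^ (j * r) * (1 - T) ^ (m * r))"
      unfolding m by (simp add: power_mult_distrib power_add mult_ac flip: power_mult)
    have N: "?B ^ j * ?A ^ m = (T ^ j * (1 - T) ^ m) * (T ^ (j * r) * (1 - T) ^ (m * r))"
      by (simp add: power_mult_distrib mult_ac flip: power_mult)
    have "of_nat (k choose j) * (- ?B) ^ j * ?A ^ m = of_int ((-1) ^ j * int (k choose j)) * (?B ^ j * ?A ^ m)"
      by (subst power_minus) (simp del: power_Suc add: mult_ac)
    then have "of_nat (k choose j) * (- ?B) ^ j * ?A ^ (k - j) / (?D ^ (k - 2) * (?P ^ r) ^ k) =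
      of_int ((-1) ^ j * int (k choose j)) * (((T ^ j * (1 - T) ^ m) * (T ^ (j * r) * (1 - T) ^ (m * r))) /
        ((?D ^ (k - 2) * (T ^ m * (1 - T) ^ j) ^ r) * (T ^ (j * r) * (1 - T) ^ (m * r))))"
      unfolding P N[symmetric] using m by (simp del: power_Suc add: mult_ac)
    also have "\<dots> = of_int ((-1) ^ j * int (k choose j)) * summand k r j"
      unfolding summand_def using m by (subst mult_divide_mult_cancel_right) simp_all
    finally show "of_nat (k choose j) * (- ?B) ^ j * ?A ^ (k - j) / (?D ^ (k - 2) * (?P ^ r) ^ k) =
      of_int ((-1) ^ j * int (k choose j)) * summand k r j" .
  qed
  finally have "?D ^ 2 * E r ^ k = (\<Sum>j\<le>k. of_int ((-1) ^ j * int (k choose j)) * summand k r j)" .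
  moreover have "fls_residue (sum f A) = (\<Sum>a\<in>A. fls_residue (f a))" for f :: "nat \<Rightarrow> complex fls" and A
    by (induction A rule: infinite_finite_induct) auto
  ultimately have "fls_residue (?D ^ 2 * E r ^ k) = (\<Sum>j\<le>k. of_int ((-1) ^ j * int (k choose j)) * fls_residue (summand k r j))"
    by (simp only: fls_residue_of_int_times)
  then show ?thesis using tr_eq_residue[OF assms] by simp
qed

text \<open>For \<open>j = k\<close> no power of \<open>T\<close> is left in the denominator. This
  matches the empty set of small zeros.\<close>

lemma fls_residue_summand_k: "fls_residue (summand k r k) = 0"
proof -
  have "summand k r k = fps_to_fls (fps_X ^ k * inverse ((1 - 2 * fps_X) ^ (k - 2) * ((1 - fps_X) ^ k) ^ r))"
    by (simp add: summand_def fls_times_fps_to_fls fps_to_fls_power fps_to_fls_inverse fps_nth_power_0 divide_inverse)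
  then show ?thesis by (simp only: fls_residue_fps)
qed

text \<open>The summand of the theorem as a power series, so that inserting a zero becomes
  composition. The inverse is a genuine one for \<open>j < k\<close>, where the denominator has
  constant term \<open>k - j\<close>.\<close>

definition zero_term :: "nat \<Rightarrow> nat \<Rightarrow> complex fps" where
  "zero_term k j = fps_X ^ (j + 1) * (1 - fps_X) ^ (k - j + 1) *
     inverse ((1 - 2 * fps_X) ^ (k - 2) * (of_nat (k - j) - of_nat k * fps_X))"

lemma zero_term_fls:
  assumes "j < k"
  shows "fps_to_fls (zero_term k j) = T ^ (j + 1) * (1 - T) ^ (k - j + 1) /
    ((1 - 2 * T) ^ (k - 2) * (of_nat (k - j) - of_nat k * T))"
proof -
  have "fps_nth ((1 - 2 * fps_X) ^ (k - 2) * (of_nat (k - j) - of_nat k * fps_X)) 0 \<noteq> (0 :: complex)"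
    using assms by (simp add: fps_nth_power_0)
  then show ?thesis
    by (simp add: zero_term_def fls_times_fps_to_fls fps_to_fls_power fps_to_fls_inverse divide_inverse del: of_nat_diff)
qed

lemma zero_term_compose:
  assumes "j < k" "fps_nth f 0 = 0" "f \<noteq> 0"
  defines "F \<equiv> fps_to_fls f"
  shows "fps_to_fls (zero_term k j oo f) = F ^ (j + 1) * (1 - F) ^ (k - j + 1) /
    ((1 - 2 * F) ^ (k - 2) * (of_nat (k - j) - of_nat k * F))"
proof -
  have two: "fls_compose_fps (2 :: complex fls) f = 2"
    using fls_compose_fps_of_nat[of 2 f] by simp
  have "fps_to_fls (zero_term k j oo f) = fls_compose_fps (fps_to_fls (zero_term k j)) f"
    using assms by simp
  also have "\<dots> = F ^ (j + 1) * (1 - F) ^ (k - j + 1) / ((1 - 2 * F) ^ (k - 2) * (of_nat (k - j) - of_nat k * F))"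
    unfolding zero_term_fls[OF assms(1)] F_def using assms(2,3)
    by (simp add: fls_compose_fps_divide fls_compose_fps_mult fls_compose_fps_power fls_compose_fps_diff two
        del: of_nat_diff power_Suc)
  finally show ?thesis .
qed

text \<open>Lagrange inversion for \<open>phi\<close>. Its logarithmic derivative is
  \<open>(m - k T) / (m T (1 - T))\<close> with \<open>m = k - j\<close>: it cancels the factor
  \<open>k - j - k T\<close> of \<open>zero_term\<close> and lowers the exponents of
  \<open>T\<close> and \<open>1 - T\<close> by one, while the power \<open>m * r\<close> of
  \<open>phi\<close> is the \<open>r\<close>-th power in \<open>summand\<close>.\<close>

lemma zero_term_coeff:
  assumes "j < k"
  shows "of_nat (k - j) * fps_nth (zero_term k j oo psi j (k - j)) ((k - j) * r) = fls_residue (summand k r j)"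
proof -
  define m where "m = k - j"
  have m: "m > 0" "k = j + m" using assms by (auto simp: m_def)
  define \<phi> where "\<phi> = fps_to_fls (phi j m)"
  have "fps_nth (phi j m) (Suc 0) \<noteq> 0" by simp
  then have \<phi>0: "\<phi> \<noteq> 0" unfolding \<phi>_def by (metis fps_to_fls_eq_0_iff fps_zero_nth)
  have \<phi>m: "\<phi> ^ m = T ^ m * (1 - T) ^ j"
    unfolding \<phi>_def fps_to_fls_power[symmetric] phi_power[OF m(1)]
    by (simp add: fls_times_fps_to_fls fps_to_fls_power)
  have K: "of_nat m - of_nat k * T \<noteq> 0"
  proof -
    have "of_nat m - of_nat k * T = fps_to_fls (of_nat m - of_nat k * fps_X)"
      by (simp add: fls_times_fps_to_fls)
    moreover have "fps_nth (of_nat m - of_nat k * fps_X :: complex fps) 0 \<noteq> 0" using m(1) by simp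
    ultimately show ?thesis by (metis fps_to_fls_eq_0_iff fps_zero_nth)
  qed
  \<comment> \<open>Obtained by differentiating the \<open>m\<close>-th power, which is a
    polynomial, unlike \<open>phi\<close> in general.\<close>
  have D: "of_nat m * T * (1 - T) * fls_deriv \<phi> = (of_nat m - of_nat k * T) * \<phi>"
  proof -
    have "fls_deriv (\<phi> ^ m) * (T * (1 - T)) = (of_nat m - of_nat k * T) * \<phi> ^ m"
    proof -
      have 1: "fls_deriv (T ^ m) * T = of_nat m * T ^ m"
        unfolding fls_deriv_power using m(1) by (cases m) (simp_all add: mult_ac)
      have 2: "fls_deriv ((1 - T) ^ j) * (1 - T) = - of_nat j * (1 - T) ^ j"
        unfolding fls_deriv_power by (cases j) (simp_all add: algebra_simps)
      have "fls_deriv (\<phi> ^ m) * (T * (1 - T)) =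
        (fls_deriv (T ^ m) * T) * (1 - T) ^ j * (1 - T) + T ^ m * (fls_deriv ((1 - T) ^ j) * (1 - T)) * T"
        unfolding \<phi>m fls_deriv_mult by (simp add: algebra_simps)
      also have "\<dots> = (of_nat m - of_nat k * T) * \<phi> ^ m"
        unfolding 1 2 \<phi>m m(2) by (simp add: algebra_simps)
      finally show ?thesis .
    qed
    moreover have "fls_deriv (\<phi> ^ m) = of_nat m * \<phi> ^ (m - 1) * fls_deriv \<phi>"
      by (simp add: fls_deriv_power)
    moreover have "\<phi> ^ m = \<phi> ^ (m - 1) * \<phi>" using m(1) by (metis power_minus_mult)
    ultimately have "\<phi> ^ (m - 1) * (of_nat m * T * (1 - T) * fls_deriv \<phi>) = \<phi> ^ (m - 1) * ((of_nat m - of_nat k * T) * \<phi>)"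
      by (simp only: mult_ac)
    then show ?thesis using \<phi>0 by simp
  qed
  have "of_nat m * (fps_to_fls (zero_term k j) * fls_deriv \<phi> * inverse \<phi> ^ Suc (m * r)) =
    (T ^ j * (1 - T) ^ m / ((1 - 2 * T) ^ (k - 2) * (of_nat m - of_nat k * T))) * (of_nat m * T * (1 - T) * fls_deriv \<phi>) * inverse \<phi> ^ Suc (m * r)"
    unfolding zero_term_fls[OF assms] by (simp add: m_def[symmetric] mult_ac)
  also have "\<dots> = summand k r j"
    unfolding D summand_def using \<phi>0 K
    by (simp add: m_def[symmetric] \<phi>m[symmetric] power_mult divide_inverse power_inverse mult_ac)
  finally have "summand k r j = of_nat m * (fps_to_fls (zero_term k j) * fls_deriv \<phi> * inverse \<phi> ^ Suc (m * r))" ..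
  then have "fls_residue (summand k r j) = of_nat m * fls_residue (fps_to_fls (zero_term k j) * fls_deriv \<phi> * inverse \<phi> ^ Suc (m * r))"
    using fls_residue_of_int_times(1)[of "int m"] by simp
  also have "fls_residue (fps_to_fls (zero_term k j) * fls_deriv \<phi> * inverse \<phi> ^ Suc (m * r)) =
    fps_nth (zero_term k j oo psi j m) (m * r)"
    unfolding \<phi>_def by (rule Lagrange_inversion[symmetric]) simp_all
  finally show ?thesis by (simp add: m_def)
qed

lemma sum_small_zeros:
  assumes "j \<le> k"
  shows "(\<Sum>t\<in>small_zeros j k. t ^ (j + 1) * (1 - t) ^ (k - j + 1) /
      ((1 - 2 * t) ^ (k - 2) * (of_nat (k - j) - of_nat k * t))) =
    puiseux_of_fps (Abs_fps (\<lambda>r. if r \<ge> 1 then fls_residue (summand k r j) else 0))"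
proof (cases "j = k")
  case True
  have "Abs_fps (\<lambda>r. if r \<ge> 1 then fls_residue (summand k r k) else 0) = 0"
    by (simp only: fls_residue_summand_k if_cancel) (simp add: fps_eq_iff)
  then show ?thesis unfolding True by (simp only: small_zeros_eq_empty sum.empty) (simp add: puiseux_of_fls_eq_root)
next
  case False
  define m where "m = k - j"
  have jk: "j < k" and m: "m > 0" using False assms by (auto simp: m_def)
  let ?g = "\<lambda>t. t ^ (j + 1) * (1 - t) ^ (k - j + 1) / ((1 - 2 * t) ^ (k - 2) * (of_nat (k - j) - of_nat k * t)) :: complex puiseux"
  have "(\<Sum>t\<in>small_zeros j k. ?g t) = (\<Sum>z | z ^ m = 1. ?g (puiseux_root m (fps_to_fls (branch j m z))))"
    unfolding small_zeros_eq[OF m m_def] by (subst sum.reindex[OF inj_branch[OF m m_def]]) simp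
  also have "\<dots> = (\<Sum>z | z ^ m = 1. puiseux_root m (fps_to_fls ((zero_term k j oo psi j m) oo (fps_const z * fps_X))))"
  proof (rule sum.cong[OF refl])
    fix z :: complex assume "z \<in> {z. z ^ m = 1}"
    then have "z \<noteq> 0" using m by (auto simp: power_0_left)
    let ?f = "branch j m z"
    have f: "fps_nth ?f 0 = 0" "?f \<noteq> 0"
    proof -
      have "fps_nth ?f (Suc 0) \<noteq> 0" using \<open>z \<noteq> 0\<close> by (simp add: branch_nth)
      then show "?f \<noteq> 0" by (metis fps_zero_nth)
    qed (simp add: branch_nth)
    have "?g (puiseux_root m (fps_to_fls ?f)) = puiseux_root m (fps_to_fls (zero_term k j oo ?f))"
      unfolding zero_term_compose[OF jk f] puiseux_root_hom[OF m] by (rule refl)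
    also have "zero_term k j oo ?f = (zero_term k j oo psi j m) oo (fps_const z * fps_X)"
      unfolding branch_def by (rule fps_compose_assoc) simp_all
    finally show "?g (puiseux_root m (fps_to_fls ?f)) =
      puiseux_root m (fps_to_fls ((zero_term k j oo psi j m) oo (fps_const z * fps_X)))" .
  qed
  also have "\<dots> = puiseux_of_fps (Abs_fps (\<lambda>r. of_nat m * fps_nth (zero_term k j oo psi j m) (m * r)))"
    by (rule sum_branches[OF m])
  also have "(\<lambda>r. of_nat m * fps_nth (zero_term k j oo psi j m) (m * r)) =
    (\<lambda>r. if r \<ge> 1 then fls_residue (summand k r j) else 0)"
  proof
    fix r
    \<comment> \<open>This settles \<open>r = 0\<close>: the sum over the small zeros has no
      constant term, in agreement with a generating function that starts at
      \<open>r = 1\<close>.\<close>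
    have "fps_nth (zero_term k j) 0 = 0" by (simp add: zero_term_def fps_mult_nth_0)
    then show "of_nat m * fps_nth (zero_term k j oo psi j m) (m * r) = (if r \<ge> 1 then fls_residue (summand k r j) else 0)"
      using zero_term_coeff[OF jk, of r] by (cases "r = 0") (simp_all add: m_def)
  qed
  finally show ?thesis .
qed

text \<open>The cardinalities ensure that summation over the set \<open>small_zeros j k\<close> runs
  over exactly \<open>k - j\<close> distinct zeros. The prefactor must carry a minus sign: for
  \<open>k = 2\<close> the double sum begins with \<open>-2 x\<close>, whereas
  \<open>tr 2 1 = 1\<close>.\<close>

theorem theorem3p2:
  fixes k :: nat
  assumes "k \<ge> 2"
  shows "(\<forall>j\<le>k. card (small_zeros j k) = k - j) \<and>
    puiseux_of_fps (Abs_fps (\<lambda>r. if r \<ge> 1 then tr k r else 0)) =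
      - (1 / 2) * (\<Sum>j=0..k. (-1) ^ j * of_nat (k choose j) *
        (\<Sum>t\<in>small_zeros j k.
           t ^ (j + 1) * (1 - t) ^ (k - j + 1) /
           ((1 - 2 * t) ^ (k - 2) * (of_nat (k - j) - of_nat k * t))))"
proof
  show "\<forall>j\<le>k. card (small_zeros j k) = k - j"
    using card_small_zeros small_zeros_eq_empty
    by (metis card.empty diff_self_eq_0 le_neq_implies_less zero_less_diff)
  let ?K = "\<lambda>j. Abs_fps (\<lambda>r. if r \<ge> 1 then fls_residue (summand k r j) else 0)"
  have const: "puiseux_of_fps (fps_const c * f) = puiseux_of_fps (fps_const c) * puiseux_of_fps f"
    for c :: complex and f
    by (simp add: puiseux_of_fls_eq_root fls_times_fps_to_fls puiseux_root_mult)
  have psum: "puiseux_of_fps (sum f A) = (\<Sum>a\<in>A. puiseux_of_fps (f a))" for f :: "nat \<Rightarrow> complex fps" and A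
    by (induction A rule: infinite_finite_induct) (simp_all add: puiseux_of_fls_eq_root puiseux_root_add)
  have half: "puiseux_of_fps (fps_const (- (1 / 2))) = (- (1 / 2) :: complex puiseux)"
  proof -
    \<comment> \<open>Division by 2 in the field of Puiseux series is justified by transporting
      \<open>2 \<noteq> 0\<close> from Laurent series.\<close>
    have "(2 :: complex puiseux) \<noteq> 0"
      using puiseux_root_inject[of 1 "2 :: complex fls" 0] by (simp add: puiseux_root_numeral)
    moreover have "(2 :: complex fls) * fps_to_fls (fps_const (- (1 / 2))) = fps_to_fls (fps_const 2 * fps_const (- (1 / 2)))"
      by (simp only: fls_times_fps_to_fls) (simp flip: numeral_fps_const)
    moreover have "fps_to_fls (fps_const 2 * fps_const (- (1 / 2) :: complex)) = - 1"
      by (simp add: fps_const_neg[symmetric] del: fps_const_neg)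
    ultimately have "puiseux_root 1 (2 * fps_to_fls (fps_const (- (1 / 2) :: complex))) = puiseux_root 1 (- 1)" by simp
    with \<open>(2 :: complex puiseux) \<noteq> 0\<close> show ?thesis
      by (simp add: puiseux_of_fls_eq_root puiseux_root_mult puiseux_root_numeral puiseux_root_uminus field_simps)
  qed
  have sign: "puiseux_of_fps (fps_const ((-1) ^ j * of_nat (k choose j))) = ((-1) ^ j * of_nat (k choose j) :: complex puiseux)" for j
  proof -
    have "fps_const ((-1) ^ j * of_nat (k choose j)) = ((-1) ^ j * of_nat (k choose j) :: complex fps)"
      by (simp flip: fps_const_mult fps_const_power fps_const_neg fps_of_nat)
    then show ?thesis
      by (simp add: puiseux_of_fls_eq_root fls_times_fps_to_fls fps_to_fls_power puiseux_root_hom)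
  qed
  have "Abs_fps (\<lambda>r. if r \<ge> 1 then tr k r else 0) =
    fps_const (- (1 / 2)) * (\<Sum>j\<le>k. fps_const ((-1) ^ j * of_nat (k choose j)) * ?K j)"
    by (rule fps_ext) (simp add: fps_sum_nth tr_eq_sum_summands[OF assms] del: fps_const_neg)
  then have "puiseux_of_fps (Abs_fps (\<lambda>r. if r \<ge> 1 then tr k r else 0)) =
    - (1 / 2) * (\<Sum>j\<le>k. (-1) ^ j * of_nat (k choose j) * puiseux_of_fps (?K j))"
    by (simp only: const psum half sign)
  also have "\<dots> = - (1 / 2) * (\<Sum>j=0..k. (-1) ^ j * of_nat (k choose j) *
        (\<Sum>t\<in>small_zeros j k.
           t ^ (j + 1) * (1 - t) ^ (k - j + 1) /
           ((1 - 2 * t) ^ (k - 2) * (of_nat (k - j) - of_nat k * t))))"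
    unfolding atMost_atLeast0 by (intro arg_cong2[of _ _ _ _ "(*)"] refl sum.cong sum_small_zeros[symmetric]) auto
  finally show "puiseux_of_fps (Abs_fps (\<lambda>r. if r \<ge> 1 then tr k r else 0)) =
      - (1 / 2) * (\<Sum>j=0..k. (-1) ^ j * of_nat (k choose j) *
        (\<Sum>t\<in>small_zeros j k.
           t ^ (j + 1) * (1 - t) ^ (k - j + 1) /
           ((1 - 2 * t) ^ (k - 2) * (of_nat (k - j) - of_nat k * t))))" .
qed

end
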